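(* Let $\ell>0$, $\Omega_\ell=\mathbb{R}\times(-\ell/2,\ell/2)\subset\mathbb{C}$ and $y_0\in(-\ell/2,\ell/2)$. The map achieving $T(iy_0)$ is given by $$u_{y_0}(z)=\begin{cases}\dfrac{\pi}{\ell}\tanh\left(\dfrac{\pi}{2\ell}(z+iy_0)\right)-\dfrac{\pi}{\ell}\coth\left(\dfrac{\pi}{2\ell}(\bar z+iy_0)\right)+\dfrac{2}{\bar z+iy_0}&\text{if }z\in\Omega_\ell,\\[2mm]\dfrac{2}{\bar z+iy_0}&\text{if }z\in\mathbb{C}\setminus\Omega_\ell\end{cases}$$ (with the removable singularity at $z=iy_0$ filled in by continuity). Its energy is given by $$T(iy_0)=\frac{4\pi^3}{\ell^2\cos^2\left(\frac{\pi y_0}{\ell}\right)},$$ which is minimized (over $y_0\in(-\ell/2,\ell/2)$) by $y_0=0$ with $T(0)=\frac{4\pi^3}{\ell^2}$. The rescaled skyrmion radius is $r_0=\frac{\ell^2}{\pi^2}$ and the corresponding limiting energy is $\mathcal{E}_0\left(\mathrm{id},\frac{\ell^2}{\pi^2},0\right)=-\frac{4\ell^2}{\pi}$.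
   Context: Identify $\mathbb{C}$ with $\mathbb{R}^2$. For $y_0\in(-\ell/2,\ell/2)$, $$T(iy_0)=\inf\left\{\int_{\mathbb{R}^2}|\nabla u|^2dx: u\in H^1_{\mathrm{loc}}(\mathbb{R}^2;\mathbb{C}),\ u(z)=\frac{2}{\bar z+iy_0}\text{ in }\mathbb{C}\setminus\Omega_\ell\right\};$$ "the map achieving $T(iy_0)$" is the minimizer of this problem and its energy is $\int_{\mathbb{R}^2}|\nabla u|^2dx=T(iy_0)$. Let $e_3=(0,0,1)$ and $\Phi(x)=\left(-\frac{2x}{1+|x|^2},\frac{1-|x|^2}{1+|x|^2}\right)$ for $x\in\mathbb{R}^2$; for $v\in\mathbb{R}^3$ write $v=(v',v_3)$ with $v'\in\mathbb{R}^2$. For $R_0\in SO(3)$ with $R_0e_3=e_3$, $r_0>0$ and $y_0\in(-\ell/2,\ell/2)$, $$\mathcal{E}_0(R_0,r_0,y_0)=r_0^2T(iy_0)-2r_0\int_{\mathbb{R}^2}(R_0\Phi)'\cdot\nabla\Phi_3\,dx.$$ The rescaled skyrmion radius is the minimizer $r_0=\frac{4\pi}{T(iy_0)}$ of $r\mapsto\mathcal{E}_0(\mathrm{id},r,y_0)$ over $r>0$, taken at the minimizing value $y_0=0$. *)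

theory Defs
  imports "HOL-Analysis.Analysis"
begin

section \<open>Test functions, weak derivatives and $H^1_{\mathrm{loc}}$\<close>

definition partial_deriv ::
  "'a::euclidean_space \<Rightarrow> ('a \<Rightarrow> 'b::real_normed_vector) \<Rightarrow> 'a \<Rightarrow> 'b" where
  "partial_deriv e f x = frechet_derivative f (at x) e"

primrec iterated_partial ::
  "'a::euclidean_space list \<Rightarrow> ('a \<Rightarrow> 'b::real_normed_vector) \<Rightarrow> 'a \<Rightarrow> 'b" where
  "iterated_partial [] f = f"
| "iterated_partial (e # es) f = partial_deriv e (iterated_partial es f)"

text \<open>Differentiability of every iterated partial derivative makes all of them continuous,
  so this is the usual class of infinitely differentiable functions.\<close>

definition smooth :: "('a::euclidean_space \<Rightarrow> 'b::real_normed_vector) \<Rightarrow> bool" where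
  "smooth f \<longleftrightarrow> (\<forall>es x. set es \<subseteq> Basis \<longrightarrow> iterated_partial es f differentiable (at x))"

definition test_function :: "('a::euclidean_space \<Rightarrow> real) \<Rightarrow> bool" where
  "test_function \<phi> \<longleftrightarrow> smooth \<phi> \<and> compact (closure {x. \<phi> x \<noteq> 0})"

definition L2_loc :: "('a::euclidean_space \<Rightarrow> 'b::euclidean_space) \<Rightarrow> bool" where
  "L2_loc u \<longleftrightarrow> u \<in> borel_measurable lebesgue \<and>
     (\<forall>K. compact K \<longrightarrow> set_integrable lebesgue K (\<lambda>x. (norm (u x))\<^sup>2))"

definition is_weak_partial ::
  "'a::euclidean_space \<Rightarrow> ('a \<Rightarrow> 'b::euclidean_space) \<Rightarrow> ('a \<Rightarrow> 'b) \<Rightarrow> bool" where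
  "is_weak_partial e u g \<longleftrightarrow>
     (\<forall>\<phi>. test_function \<phi> \<longrightarrow>
        (\<integral>x. partial_deriv e \<phi> x *\<^sub>R u x \<partial>lebesgue) = - (\<integral>x. \<phi> x *\<^sub>R g x \<partial>lebesgue))"

definition H1_loc :: "('a::euclidean_space \<Rightarrow> 'b::euclidean_space) set" where
  "H1_loc = {u. L2_loc u \<and> (\<forall>e\<in>Basis. \<exists>g. L2_loc g \<and> is_weak_partial e u g)}"

text \<open>For \<open>u \<in> H1_loc\<close> the weak partial derivatives are unique up to null sets, so the
  choice below affects no integral.\<close>

definition weak_partial ::
  "'a::euclidean_space \<Rightarrow> ('a \<Rightarrow> 'b::euclidean_space) \<Rightarrow> 'a \<Rightarrow> 'b" where
  "weak_partial e u = (SOME g. L2_loc g \<and> is_weak_partial e u g)"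

definition dirichlet_energy :: "('a::euclidean_space \<Rightarrow> 'b::euclidean_space) \<Rightarrow> ennreal" where
  "dirichlet_energy u =
     (\<integral>\<^sup>+x. ennreal (\<Sum>e\<in>Basis. (norm (weak_partial e u x))\<^sup>2) \<partial>lebesgue)"


section \<open>The minimization problem on the strip\<close>

text \<open>The plane $\mathbb{R}^2$ is the type \<^typ>\<open>complex\<close>, whose \<^term>\<open>Basis\<close> is
  \<open>{1, \<i>}\<close>. Elements of \<^term>\<open>H1_loc\<close> are functions, not equivalence classes; hence
  the condition outside the strip is imposed almost everywhere.\<close>

definition strip :: "real \<Rightarrow> complex set" where
  "strip l = {z. Im z \<in> {-l/2<..<l/2}}"

definition admissible :: "real \<Rightarrow> real \<Rightarrow> (complex \<Rightarrow> complex) set" where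
  "admissible l y = {u \<in> H1_loc.
     AE z in lebesgue. z \<notin> strip l \<longrightarrow> u z = 2 / (cnj z + \<i> * of_real y)}"

text \<open>\<open>T l y\<close> stands for $T(iy)$.\<close>

definition T :: "real \<Rightarrow> real \<Rightarrow> ennreal" where
  "T l y = (INF u\<in>admissible l y. dirichlet_energy u)"

definition coth :: "complex \<Rightarrow> complex" where
  "coth z = cosh z / sinh z"

definition strip_formula :: "real \<Rightarrow> real \<Rightarrow> complex \<Rightarrow> complex" where
  "strip_formula l y z =
     of_real (pi / l) * tanh (of_real (pi / (2 * l)) * (z + \<i> * of_real y))
     - of_real (pi / l) * coth (of_real (pi / (2 * l)) * (cnj z + \<i> * of_real y))
     + 2 / (cnj z + \<i> * of_real y)"

definition u_opt :: "real \<Rightarrow> real \<Rightarrow> complex \<Rightarrow> complex" where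
  "u_opt l y z =
     (if z = \<i> * of_real y then Lim (at z) (strip_formula l y)
      else if z \<in> strip l then strip_formula l y z
      else 2 / (cnj z + \<i> * of_real y))"


section \<open>The limiting energy\<close>

definition Phi :: "complex \<Rightarrow> real ^ 3" where
  "Phi x = vector [- (2 * Re x / (1 + (norm x)\<^sup>2)), - (2 * Im x / (1 + (norm x)\<^sup>2)),
                   (1 - (norm x)\<^sup>2) / (1 + (norm x)\<^sup>2)]"

text \<open>The rotation \<open>R\<close> is meant to satisfy \<open>R *v axis 3 1 = axis 3 1\<close>, and
  \<open>r > 0\<close>.\<close>

definition E0 :: "real \<Rightarrow> real ^ 3 ^ 3 \<Rightarrow> real \<Rightarrow> real \<Rightarrow> real" where
  "E0 l R r y = r\<^sup>2 * enn2real (T l y)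
     - 2 * r * (\<integral>x. (R *v Phi x) $ 1 * partial_deriv 1 (\<lambda>w. Phi w $ 3) x
                   + (R *v Phi x) $ 2 * partial_deriv \<i> (\<lambda>w. Phi w $ 3) x \<partial>lebesgue)"

end

theory Submission
  imports Defs "HOL-Complex_Analysis.Cauchy_Integral_Formula"
begin

text \<open>
  In the strip the map is \<open>h(z) = f(z) + g(cnj z)\<close> with \<open>f\<close> and \<open>g\<close> holomorphic on a larger strip
  (the pole of \<open>coth\<close> cancels against \<open>2 / (cnj z + \<i> y0)\<close>), hence harmonic, and it matches
  \<open>2 / (cnj z + \<i> y0)\<close> on the boundary lines because \<open>tanh (s + \<i> pi / 2) = coth s\<close>.

  Minimality: an admissible competitor differs from the map by some \<open>w\<close> that vanishes off the
  strip, so it suffices that the gradients of \<open>h\<close> and \<open>w\<close> are orthogonal. The gradient of \<open>h\<close> is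
  the rotated gradient of the conjugate \<open>G = - \<i> (f(z) - g(cnj z))\<close>, which is bounded on the strip.
  Cutting \<open>G\<close> off to a test function \<open>\<theta>\<close>, orthogonality becomes the symmetry of the second
  derivatives of \<open>\<theta>\<close>; the error of a cutoff at horizontal scale \<open>N\<close> is of order \<open>N powr (- 1/2)\<close>.

  Energy: with \<open>c = deriv f (\<i> y0)\<close> and \<open>F(z) = (deriv f z - c) / (z - \<i> y0)\<close>, the energy density
  is the divergence of \<open>Re (cnj h * grad h)\<close>. Subtracting the divergence free field
  \<open>(Re (4 F), Re (4 \<i> F))\<close> makes the boundary flux a rational function of the real part. The terms not
  containing \<open>c\<close> cancel the energy outside the strip, and the total is \<open>8 pi c\<close>.
\<close>

section \<open>Smooth functions and test functions\<close>

text \<open>The conjugate \<open>G\<close> is used because cutting off the gradient of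
  \<open>h\<close> itself would leave an error containing \<open>w\<close>, calling for a Poincare
  inequality. With \<open>G\<close> the error is a bounded function times a weak derivative of
  \<open>w\<close>, and these derivatives are square integrable once the energy is finite. Vanishing
  of \<open>w\<close> off the strip takes the place of boundary values: \<open>h\<close> and
  \<open>G\<close> extend past the boundary lines, so a vertical cutoff may equal 1 on the whole
  strip and decrease only where the derivatives of \<open>w\<close> are 0.

  The correction by \<open>F\<close> arises as follows. On a boundary line cnj h is 2 / (z - i y0),
  and the vertical derivative of h is 2 i f' plus a rational function, so the flux contains the
  non-rational term 4 i f' / (z - i y0). This function is holomorphic except for a pole at i y0
  inside the strip, so it cannot be subtracted as it stands. Subtracting \<open>c\<close>, the value
  of f' at the pole, makes the singularity removable; the price is the flux of 4 i c / (z - i y0),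
  which is 4 pi c on each of the two lines.\<close>

definition smooth_on :: "'a::euclidean_space set \<Rightarrow> ('a \<Rightarrow> 'b::real_normed_vector) \<Rightarrow> bool" where
  "smooth_on S f \<longleftrightarrow> (\<forall>es x. set es \<subseteq> Basis \<longrightarrow> x \<in> S \<longrightarrow> iterated_partial es f differentiable (at x))"

lemma smooth_iff_smooth_on: "smooth f \<longleftrightarrow> smooth_on UNIV f"
  by (simp add: smooth_def smooth_on_def)

lemma partial_deriv_eqI:
  "(f has_derivative f') (at x) \<Longrightarrow> partial_deriv e f x = f' e"
  by (metis partial_deriv_def frechet_derivative_at)

lemma smooth_on_differentiable:
  "smooth_on S f \<Longrightarrow> x \<in> S \<Longrightarrow> f differentiable (at x)"
  unfolding smooth_on_def by (metis empty_set empty_subsetI iterated_partial.simps(1))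

lemma iterated_partial_append:
  "iterated_partial (es @ [e]) f = iterated_partial es (partial_deriv e f)"
  by (induction es) auto

lemma smooth_on_partial_deriv:
  assumes "smooth_on S f" "e \<in> Basis"
  shows "smooth_on S (partial_deriv e f)"
  unfolding smooth_on_def
proof (intro allI impI)
  fix es :: "'a list" and x assume "set es \<subseteq> Basis" "x \<in> S"
  then have "iterated_partial (es @ [e]) f differentiable (at x)"
    using assms unfolding smooth_on_def by (metis Un_insert_right empty_set insert_subset list.simps(15) set_append sup_bot.right_neutral)
  then show "iterated_partial es (partial_deriv e f) differentiable (at x)"
    by (simp add: iterated_partial_append)
qed

lemma partial_deriv_cong_open:
  assumes "open S" "x \<in> S" "f differentiable (at x)" "\<And>y. y \<in> S \<Longrightarrow> f y = g y"
  shows "partial_deriv e f x = partial_deriv e g x"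
  unfolding partial_deriv_def
  using frechet_derivative_transform_within_open[OF assms(3,1,2)] assms(4) by auto

lemma differentiable_cong_open:
  assumes "open S" "x \<in> S" "f differentiable (at x)" "\<And>y. y \<in> S \<Longrightarrow> f y = g y"
  shows "g differentiable (at x)"
  using assms has_derivative_transform_within_open unfolding differentiable_def by metis

text \<open>Induction on the list of directions keeps each iterated partial derivative equal, on
  \<open>S\<close>, to a member of \<open>P\<close>. Equality is asked only on the open set
  \<open>S\<close>, because off \<open>S\<close> the Frechet derivative may be an arbitrary value.
  Every closure property of smoothness below is then a choice of an invariant class
  \<open>P\<close>.\<close>

lemma smooth_on_coinduct:
  assumes S: "open S" and P: "P f"
    and step: "\<And>f. P f \<Longrightarrow> (\<forall>x\<in>S. f differentiable (at x)) \<and>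
      (\<forall>e\<in>Basis. \<exists>g. P g \<and> (\<forall>x\<in>S. partial_deriv e f x = g x))"
  shows "smooth_on S f"
proof -
  have "set es \<subseteq> Basis \<Longrightarrow> \<exists>g. P g \<and> (\<forall>x\<in>S. iterated_partial es f x = g x)" for es
  proof (induction es)
    case (Cons e es)
    then obtain g where g: "P g" "\<forall>x\<in>S. iterated_partial es f x = g x" by auto
    obtain g' where g': "P g'" "\<forall>x\<in>S. partial_deriv e g x = g' x"
      using step[OF g(1)] Cons.prems by auto
    have "partial_deriv e (iterated_partial es f) x = g' x" if "x \<in> S" for x
    proof -
      have "partial_deriv e g x = partial_deriv e (iterated_partial es f) x"
        by (rule partial_deriv_cong_open[OF S that]) (use step[OF g(1)] that g(2) in auto)
      then show ?thesis using g'(2) that by simp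
    qed
    then show ?case using g'(1) by auto
  qed (use P in auto)
  then show ?thesis
    unfolding smooth_on_def using step differentiable_cong_open[OF S] by metis
qed

lemma smooth_on_cong:
  assumes "open S" "smooth_on S f" "\<And>x. x \<in> S \<Longrightarrow> f x = g x"
  shows "smooth_on S g"
proof (rule smooth_on_coinduct[where P = "\<lambda>g. \<exists>f. smooth_on S f \<and> (\<forall>x\<in>S. f x = g x)"])
  fix g :: "'a \<Rightarrow> 'b" assume "\<exists>f. smooth_on S f \<and> (\<forall>x\<in>S. f x = g x)"
  then obtain f where f: "smooth_on S f" "\<forall>x\<in>S. f x = g x" by auto
  then have d: "f differentiable (at x)" if "x \<in> S" for x
    using smooth_on_differentiable that by blast
  then have "partial_deriv e g x = partial_deriv e f x" if "x \<in> S" for e x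
    using partial_deriv_cong_open[OF assms(1) that] f that by metis
  moreover have "g differentiable (at x)" if "x \<in> S" for x
    using differentiable_cong_open[OF assms(1) that] d f that by metis
  ultimately show "(\<forall>x\<in>S. g differentiable (at x)) \<and>
      (\<forall>e\<in>Basis. \<exists>h. (\<exists>f. smooth_on S f \<and> (\<forall>x\<in>S. f x = h x)) \<and> (\<forall>x\<in>S. partial_deriv e g x = h x))"
    by (metis f(1) smooth_on_partial_deriv)
qed (use assms in auto)

lemma smooth_on_Un: "smooth_on S f \<Longrightarrow> smooth_on S' f \<Longrightarrow> smooth_on (S \<union> S') f"
  unfolding smooth_on_def by auto

lemma smooth_on_subset: "smooth_on S f \<Longrightarrow> S' \<subseteq> S \<Longrightarrow> smooth_on S' f"
  unfolding smooth_on_def by auto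

lemma smooth_on_const: "open S \<Longrightarrow> smooth_on S (\<lambda>x. c)"
proof (rule smooth_on_coinduct[where P = "\<lambda>f. \<exists>c. f = (\<lambda>x. c)"], assumption, blast)
  fix f :: "'a \<Rightarrow> 'b" assume "\<exists>c. f = (\<lambda>x. c)"
  then obtain c where f: "f = (\<lambda>x. c)" by auto
  have "partial_deriv e f x = 0" for e x
    unfolding f by (rule partial_deriv_eqI[where f' = "\<lambda>_. 0", simplified]) auto
  then show "(\<forall>x\<in>S. f differentiable (at x)) \<and>
      (\<forall>e\<in>Basis. \<exists>h. (\<exists>c. h = (\<lambda>x. c)) \<and> (\<forall>x\<in>S. partial_deriv e f x = h x))"
    using f by auto
qed

lemma has_derivative_frechet:
  "f differentiable (at x) \<Longrightarrow> (f has_derivative frechet_derivative f (at x)) (at x)"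
  using frechet_derivative_works by blast

lemma partial_deriv_mult:
  fixes f g :: "'a::euclidean_space \<Rightarrow> real"
  assumes "f differentiable (at x)" "g differentiable (at x)"
  shows "partial_deriv e (\<lambda>x. f x * g x) x = partial_deriv e f x * g x + f x * partial_deriv e g x"
  using partial_deriv_eqI[OF has_derivative_mult[OF assms[THEN has_derivative_frechet]]]
  by (simp add: partial_deriv_def)

lemma partial_deriv_add:
  assumes "f differentiable (at x)" "g differentiable (at x)"
  shows "partial_deriv e (\<lambda>x. f x + g x) x = partial_deriv e f x + partial_deriv e g x"
  using partial_deriv_eqI[OF has_derivative_add[OF assms[THEN has_derivative_frechet]]]
  by (simp add: partial_deriv_def)

text \<open>The invariant class for products: by the Leibniz rule a derivative of a product is a sum
  of two products, so products alone are not closed under differentiation.\<close>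

inductive sums_of_products :: "'a::euclidean_space set \<Rightarrow> ('a \<Rightarrow> real) \<Rightarrow> bool" for S where
  product: "smooth_on S f \<Longrightarrow> smooth_on S g \<Longrightarrow> sums_of_products S (\<lambda>x. f x * g x)"
| plus: "sums_of_products S f \<Longrightarrow> sums_of_products S g \<Longrightarrow> sums_of_products S (\<lambda>x. f x + g x)"

lemma smooth_on_mult:
  fixes f g :: "'a::euclidean_space \<Rightarrow> real"
  assumes S: "open S" and "smooth_on S f" "smooth_on S g"
  shows "smooth_on S (\<lambda>x. f x * g x)"
proof (rule smooth_on_coinduct[OF S, where P = "sums_of_products S"])
  show "sums_of_products S (\<lambda>x. f x * g x)" by (rule product) fact+
next
  fix f :: "'a \<Rightarrow> real" assume "sums_of_products S f"
  then show "(\<forall>x\<in>S. f differentiable (at x)) \<and>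
      (\<forall>e\<in>Basis. \<exists>g. sums_of_products S g \<and> (\<forall>x\<in>S. partial_deriv e f x = g x))"
  proof induction
    case (product f g)
    have d: "f differentiable (at x)" "g differentiable (at x)" if "x \<in> S" for x
      using product smooth_on_differentiable that by blast+
    have "sums_of_products S (\<lambda>x. partial_deriv e f x * g x + f x * partial_deriv e g x)"
      if "e \<in> Basis" for e
      using that product by (intro sums_of_products.intros smooth_on_partial_deriv)
    then show ?case using d partial_deriv_mult[OF d] by (blast intro: differentiable_mult)
  next
    case (plus f g)
    have "\<exists>h. sums_of_products S h \<and> (\<forall>x\<in>S. partial_deriv e (\<lambda>x. f x + g x) x = h x)"
      if e: "e \<in> Basis" for e
    proof -
      obtain f' g' where "sums_of_products S f'" "\<forall>x\<in>S. partial_deriv e f x = f' x"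
        "sums_of_products S g'" "\<forall>x\<in>S. partial_deriv e g x = g' x"
        using plus.IH e by meson
      then show ?thesis
        using plus.IH by (intro exI[of _ "\<lambda>x. f' x + g' x"])
          (auto intro: sums_of_products.intros simp: partial_deriv_add)
    qed
    then show ?case using plus.IH by auto
  qed
qed

lemma smooth_on_linear_comp:
  assumes S: "open S" and "smooth_on S f" and L: "bounded_linear L"
  shows "smooth_on S (\<lambda>x. L (f x))"
proof (rule smooth_on_coinduct[OF S, where P = "\<lambda>F. \<exists>f. smooth_on S f \<and> F = (\<lambda>x. L (f x))"])
  fix F :: "'a \<Rightarrow> 'c" assume "\<exists>f. smooth_on S f \<and> F = (\<lambda>x. L (f x))"
  then obtain f where f: "smooth_on S f" "F = (\<lambda>x. L (f x))" by auto
  have d: "(F has_derivative (\<lambda>h. L (frechet_derivative f (at x) h))) (at x)" if "x \<in> S" for x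
    unfolding f(2)
    by (rule bounded_linear.has_derivative[OF L has_derivative_frechet[OF smooth_on_differentiable[OF f(1) that]]])
  have "partial_deriv e F x = L (partial_deriv e f x)" if "x \<in> S" for e x
    using partial_deriv_eqI[OF d[OF that]] by (simp add: partial_deriv_def)
  then show "(\<forall>x\<in>S. F differentiable (at x)) \<and>
      (\<forall>e\<in>Basis. \<exists>g. (\<exists>f. smooth_on S f \<and> g = (\<lambda>x. L (f x))) \<and> (\<forall>x\<in>S. partial_deriv e F x = g x))"
    using d f(1) smooth_on_partial_deriv by (metis differentiableI)
qed (use assms in auto)

text \<open>The basis of the reals is {1}, so the ordinary derivative replaces the partial
  derivatives.\<close>

lemma smooth_real_coinduct:
  fixes f :: "real \<Rightarrow> real"
  assumes "P f" and step: "\<And>f. P f \<Longrightarrow> \<exists>f'. P f' \<and> (\<forall>x. (f has_real_derivative f' x) (at x))"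
  shows "smooth f"
  unfolding smooth_iff_smooth_on
proof (rule smooth_on_coinduct[where P = P])
  fix f :: "real \<Rightarrow> real" assume "P f"
  then obtain f' where f': "P f'" "\<And>x. (f has_real_derivative f' x) (at x)" using step by blast
  then have "partial_deriv 1 f x = f' x" for x
    using partial_deriv_eqI[OF f'(2)[unfolded has_field_derivative_def], of 1 x] by simp
  then show "(\<forall>x\<in>UNIV. f differentiable (at x)) \<and> (\<forall>e\<in>Basis. \<exists>g. P g \<and> (\<forall>x\<in>UNIV. partial_deriv e f x = g x))"
    using f' by (auto simp: real_differentiable_def)
qed (use assms in auto)

lemma smooth_real_deriv:
  fixes f :: "real \<Rightarrow> real"
  assumes "smooth f"
  obtains f' where "smooth f'" "\<And>x. (f has_real_derivative f' x) (at x)"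
proof
  show "smooth (partial_deriv 1 f)" using assms smooth_on_partial_deriv[of UNIV f 1]
    unfolding smooth_iff_smooth_on by simp
  fix x
  have "f differentiable (at x)" using assms smooth_iff_smooth_on smooth_on_differentiable by blast
  then obtain D where "(f has_real_derivative D) (at x)" using real_differentiable_def by blast
  moreover from this have "partial_deriv 1 f x = D"
    using partial_deriv_eqI[of f "(*) D"] by (simp add: has_field_derivative_def)
  ultimately show "(f has_real_derivative partial_deriv 1 f x) (at x)" by simp
qed

lemma smooth_mult: "smooth f \<Longrightarrow> smooth g \<Longrightarrow> smooth (\<lambda>x. f x * g x)"
  for f g :: "'a::euclidean_space \<Rightarrow> real"
  by (simp add: smooth_iff_smooth_on smooth_on_mult)

lemma smooth_affine_comp:
  fixes f :: "real \<Rightarrow> real"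
  assumes "smooth f"
  shows "smooth (\<lambda>t. f (a * t + b))"
\<comment> \<open>The coefficient \<open>c\<close> absorbs the powers of \<open>a\<close> that the
  chain rule produces.\<close>
proof (rule smooth_real_coinduct[where P = "\<lambda>F. \<exists>f c. smooth f \<and> F = (\<lambda>t. c * f (a * t + b))"])
  show "\<exists>g c. smooth g \<and> (\<lambda>t. f (a * t + b)) = (\<lambda>t. c * g (a * t + b))"
    by (rule exI[of _ f], rule exI[of _ 1]) (use assms in simp)
  fix F :: "real \<Rightarrow> real" assume "\<exists>f c. smooth f \<and> F = (\<lambda>t. c * f (a * t + b))"
  then obtain f :: "real \<Rightarrow> real" and c where f: "smooth f" "F = (\<lambda>t. c * f (a * t + b))" by auto
  obtain f' where f': "smooth f'" "\<And>x. (f has_real_derivative f' x) (at x)"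
    using smooth_real_deriv f by blast
  have "(F has_real_derivative c * a * f' (a * t + b)) (at t)" for t
    unfolding f by (auto intro!: derivative_eq_intros DERIV_chain2[OF f'(2)])
  with f' show "\<exists>F'. (\<exists>f c. smooth f \<and> F' = (\<lambda>t. c * f (a * t + b))) \<and> (\<forall>x. (F has_real_derivative F' x) (at x))"
    by (intro exI[of _ "\<lambda>t. c * a * f' (a * t + b)"]) auto
qed

lemma smooth_inner_comp:
  fixes b :: "real \<Rightarrow> real" and v :: "'a::euclidean_space"
  assumes "smooth b"
  shows "smooth (\<lambda>z. b (z \<bullet> v))"
  unfolding smooth_iff_smooth_on
proof (rule smooth_on_coinduct[where P = "\<lambda>F. \<exists>b c. smooth b \<and> F = (\<lambda>z. c * b (z \<bullet> v))"])
  show "\<exists>g c. smooth g \<and> (\<lambda>z. b (z \<bullet> v)) = (\<lambda>z. c * g (z \<bullet> v))"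
    by (rule exI[of _ b], rule exI[of _ 1]) (use assms in simp)
  fix F :: "'a \<Rightarrow> real" assume "\<exists>b c. smooth b \<and> F = (\<lambda>z. c * b (z \<bullet> v))"
  then obtain b :: "real \<Rightarrow> real" and c where f: "smooth b" "F = (\<lambda>z. c * b (z \<bullet> v))" by auto
  obtain b' where b': "smooth b'" "\<And>x. (b has_real_derivative b' x) (at x)"
    using smooth_real_deriv f by blast
  have d: "(F has_derivative (\<lambda>h. c * (h \<bullet> v) * b' (z \<bullet> v))) (at z)" for z
    unfolding f by (auto intro!: derivative_eq_intros
        has_derivative_compose[OF _ b'(2)[unfolded has_field_derivative_def]])
  show "(\<forall>x\<in>UNIV. F differentiable (at x)) \<and> (\<forall>e\<in>Basis.
     \<exists>g. (\<exists>b c. smooth b \<and> g = (\<lambda>z. c * b (z \<bullet> v))) \<and> (\<forall>x\<in>UNIV. partial_deriv e F x = g x))"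
  proof (intro conjI ballI)
    fix e :: 'a
    show "\<exists>g. (\<exists>b c. smooth b \<and> g = (\<lambda>z. c * b (z \<bullet> v))) \<and> (\<forall>x\<in>UNIV. partial_deriv e F x = g x)"
      using b'(1) partial_deriv_eqI[OF d, of e]
      by (intro exI[of _ "\<lambda>z. c * (e \<bullet> v) * b' (z \<bullet> v)"]) auto
  qed (use d in \<open>auto simp: differentiable_def\<close>)
qed auto

lemma smooth_on_holomorphic:
  assumes S: "open S" and "f holomorphic_on S"
  shows "smooth_on S f"
proof (rule smooth_on_coinduct[OF S, where P = "\<lambda>f. f holomorphic_on S"])
  fix f assume f: "f holomorphic_on S"
  have d: "(f has_derivative (\<lambda>h. deriv f x * h)) (at x)" if "x \<in> S" for x
    using holomorphic_derivI[OF f S that] by (simp add: has_field_derivative_def)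
  have "(\<lambda>x. deriv f x * e) holomorphic_on S" for e
    using f S by (intro holomorphic_intros)
  then show "(\<forall>x\<in>S. f differentiable (at x)) \<and>
    (\<forall>e\<in>Basis. \<exists>g. g holomorphic_on S \<and> (\<forall>x\<in>S. partial_deriv e f x = g x))"
    using partial_deriv_eqI[OF d] d by (meson differentiableI)
qed (use assms in auto)

text \<open>In direction \<open>e\<close> the derivative is \<open>deriv f (cnj x) * cnj e\<close>,
  again a function holomorphic on the conjugate set composed with \<open>cnj\<close>; this is the
  class on which the coinduction runs.\<close>

lemma smooth_on_antiholomorphic:
  assumes S: "open S" and "f holomorphic_on cnj ` S"
  shows "smooth_on S (\<lambda>z. f (cnj z))"
proof (rule smooth_on_coinduct[OF S, where P = "\<lambda>F. \<exists>f. f holomorphic_on cnj ` S \<and> F = (\<lambda>z. f (cnj z))"])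
  have S': "open (cnj ` S)"
  proof -
    have "cnj ` S = cnj -` S"
      by (auto simp: image_iff intro!: bexI[of _ "cnj _"])
    then show ?thesis using open_vimage[OF S continuous_on_cnj[OF continuous_on_id]] by simp
  qed
  fix F assume "\<exists>f. f holomorphic_on cnj ` S \<and> F = (\<lambda>z. f (cnj z))"
  then obtain f where f: "f holomorphic_on cnj ` S" "F = (\<lambda>z. f (cnj z))" by auto
  have d: "(F has_derivative (\<lambda>h. deriv f (cnj x) * cnj h)) (at x)" if "x \<in> S" for x
  proof -
    have "(f has_derivative (\<lambda>h. deriv f (cnj x) * h)) (at (cnj x))"
      using holomorphic_derivI[OF f(1) S'] that by (simp add: has_field_derivative_def)
    from has_derivative_compose[OF bounded_linear_imp_has_derivative[OF bounded_linear_cnj] this]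
    show ?thesis by (simp add: f)
  qed
  have "(\<lambda>x. deriv f x * cnj e) holomorphic_on cnj ` S" for e
    using f S' by (intro holomorphic_intros)
  then show "(\<forall>x\<in>S. F differentiable (at x)) \<and>
    (\<forall>e\<in>Basis. \<exists>g. (\<exists>f. f holomorphic_on cnj ` S \<and> g = (\<lambda>z. f (cnj z))) \<and> (\<forall>x\<in>S. partial_deriv e F x = g x))"
    using partial_deriv_eqI[OF d] d differentiableI
    by (intro conjI ballI, blast, metis)
qed (use assms in auto)

lemma smooth_on_add:
  assumes S: "open S" and "smooth_on S f" "smooth_on S g"
  shows "smooth_on S (\<lambda>x. f x + g x)"
proof (rule smooth_on_coinduct[OF S, where P = "\<lambda>F. \<exists>f g. smooth_on S f \<and> smooth_on S g \<and> F = (\<lambda>x. f x + g x)"])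
  fix F :: "'a \<Rightarrow> 'b" assume "\<exists>f g. smooth_on S f \<and> smooth_on S g \<and> F = (\<lambda>x. f x + g x)"
  then obtain f g where f: "smooth_on S f" "smooth_on S g" "F = (\<lambda>x. f x + g x)" by auto
  have d: "f differentiable (at x)" "g differentiable (at x)" if "x \<in> S" for x
    using f smooth_on_differentiable that by blast+
  show "(\<forall>x\<in>S. F differentiable (at x)) \<and> (\<forall>e\<in>Basis. \<exists>h.
    (\<exists>f g. smooth_on S f \<and> smooth_on S g \<and> h = (\<lambda>x. f x + g x)) \<and> (\<forall>x\<in>S. partial_deriv e F x = h x))"
  proof (intro conjI ballI)
    fix e :: 'a assume "e \<in> Basis"
    then show "\<exists>h. (\<exists>f g. smooth_on S f \<and> smooth_on S g \<and> h = (\<lambda>x. f x + g x)) \<and> (\<forall>x\<in>S. partial_deriv e F x = h x)"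
      using partial_deriv_add[OF d, of _ e] f smooth_on_partial_deriv by blast
  qed (use d f in auto)
qed (use assms in auto)

section \<open>Bump, step and plateau functions from exp(-1/t)\<close>

lemma exp_inverse_poly_tendsto:
  "((\<lambda>t::real. poly p (1 / t) * exp (- 1 / t)) \<longlongrightarrow> 0) (at_right 0)"
proof -
  have "((\<lambda>y. \<Sum>i\<le>degree p. coeff p i * (y ^ i / exp y)) \<longlongrightarrow> (\<Sum>i\<le>degree p. coeff p i * 0)) at_top"
    by (intro tendsto_intros tendsto_power_div_exp_0)
  then have "((\<lambda>y::real. poly p y * exp (- y)) \<longlongrightarrow> 0) at_top"
    by (simp add: poly_altdef sum_distrib_right exp_minus divide_inverse mult.assoc)
  from filterlim_compose[OF this filterlim_inverse_at_top_right] show ?thesis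
    by (simp add: divide_inverse)
qed

text \<open>The flat function exp(-1/t), extended by 0. The polynomial factor in 1/t is carried
  along so that the family is closed under differentiation.\<close>

definition smooth_exp :: "real poly \<Rightarrow> real \<Rightarrow> real" where
  "smooth_exp p t = (if t > 0 then poly p (1 / t) * exp (- 1 / t) else 0)"

lemma smooth_smooth_exp: "smooth (smooth_exp p)"
proof (rule smooth_real_coinduct[where P = "\<lambda>f. \<exists>p. f = smooth_exp p"])
  fix f assume "\<exists>p. f = smooth_exp p"
  then obtain p where f: "f = smooth_exp p" by auto
  \<comment> \<open>The derivative of p(1/t) exp(-1/t) is (p(1/t) - p'(1/t)) exp(-1/t) / t^2; the
    two zero coefficients in front supply the factor 1/t^2.\<close>
  define q where "q = pCons 0 (pCons 0 (p - pderiv p))"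
  have "(smooth_exp p has_real_derivative smooth_exp q t) (at t)" for t
  proof -
    consider "t < 0" | "t = 0" | "t > 0" by linarith
    then show ?thesis
    proof cases
      case 1
      have "((\<lambda>_. 0) has_real_derivative smooth_exp q t) (at t)" using 1 by (simp add: smooth_exp_def)
      then show ?thesis
        by (rule has_field_derivative_transform_within_open[where S = "{..<0}"]) (use 1 in \<open>auto simp: smooth_exp_def\<close>)
    next
      case 3
      have "((\<lambda>t. poly p (1 / t) * exp (- 1 / t)) has_real_derivative smooth_exp q t) (at t)"
        using 3 by (auto simp: smooth_exp_def q_def intro!: derivative_eq_intros poly_DERIV[THEN DERIV_chain2])
          (simp add: field_simps power2_eq_square)
      then show ?thesis
        by (rule has_field_derivative_transform_within_open[where S = "{0<..}"]) (use 3 in \<open>auto simp: smooth_exp_def\<close>)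
    next
      case 2
      have "((\<lambda>h. (smooth_exp p (0 + h) - smooth_exp p 0) / h) \<longlongrightarrow> 0) (at_right 0)"
      \<comment> \<open>The right difference quotient at 0 has the extra factor 1/t, that is, one
        more zero coefficient.\<close>
      proof (rule Lim_transform_eventually[OF exp_inverse_poly_tendsto[of "pCons 0 p"]])
        show "\<forall>\<^sub>F t in at_right 0. poly (pCons 0 p) (1 / t) * exp (- 1 / t) = (smooth_exp p (0 + t) - smooth_exp p 0) / t"
          by (rule eventually_at_rightI[of 0 1]) (auto simp: smooth_exp_def)
      qed
      moreover have "((\<lambda>h. (smooth_exp p (0 + h) - smooth_exp p 0) / h) \<longlongrightarrow> 0) (at_left 0)"
      proof (rule Lim_transform_eventually[OF tendsto_const])
        show "\<forall>\<^sub>F t in at_left 0. 0 = (smooth_exp p (0 + t) - smooth_exp p 0) / t"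
          by (rule eventually_at_leftI[of "-1"]) (auto simp: smooth_exp_def)
      qed
      ultimately have "((\<lambda>h. (smooth_exp p (0 + h) - smooth_exp p 0) / h) \<longlongrightarrow> 0) (at 0)"
        using filterlim_split_at by blast
      then show ?thesis using 2 by (simp add: DERIV_def smooth_exp_def)
    qed
  qed
  then show "\<exists>f'. (\<exists>p. f' = smooth_exp p) \<and> (\<forall>x. (f has_real_derivative f' x) (at x))"
    using f by blast
qed auto

text \<open>The parameter \<open>n\<close> steepens both flanks: inside the interval the arguments
  of \<open>smooth_exp\<close> grow without bound and the bump tends to 1. It approximates the
  indicator pointwise without reaching the value 1 anywhere.\<close>

definition interval_bump :: "real \<Rightarrow> real \<Rightarrow> nat \<Rightarrow> real \<Rightarrow> real" where
  "interval_bump a b n t = smooth_exp 1 (real n * (t - a)) * smooth_exp 1 (real n * (b - t))"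

lemma smooth_interval_bump: "smooth (interval_bump a b n)"
proof -
  have "smooth (\<lambda>t. smooth_exp 1 (real n * t + (- real n * a)) * smooth_exp 1 ((- real n) * t + real n * b))"
    by (intro smooth_mult smooth_affine_comp smooth_smooth_exp)
  then show ?thesis by (simp add: interval_bump_def[abs_def] algebra_simps)
qed

lemma interval_bump_bounds: "0 \<le> interval_bump a b n t" "interval_bump a b n t \<le> 1"
proof -
  have *: "0 \<le> smooth_exp 1 s" "smooth_exp 1 s \<le> 1" for s
    by (auto simp: smooth_exp_def)
  show "0 \<le> interval_bump a b n t" "interval_bump a b n t \<le> 1"
    unfolding interval_bump_def using * by (auto intro!: mult_le_one)
qed

lemma interval_bump_eq_0: "t \<notin> {a<..<b} \<Longrightarrow> interval_bump a b n t = 0"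
  by (auto simp: interval_bump_def smooth_exp_def zero_less_mult_iff)

lemma interval_bump_pos: "n > 0 \<Longrightarrow> t \<in> {a<..<b} \<Longrightarrow> interval_bump a b n t > 0"
  by (auto simp: interval_bump_def smooth_exp_def)

lemma interval_bump_tendsto: "(\<lambda>n. interval_bump a b n t) \<longlonglongrightarrow> indicator {a<..<b} t"
proof (cases "t \<in> {a<..<b}")
  case True
  have *: "(\<lambda>n. smooth_exp 1 (real n * s)) \<longlonglongrightarrow> 1" if "s > 0" for s
  proof (rule Lim_transform_eventually)
    have "(\<lambda>n. exp (- (1 / s) * (1 / real n))) \<longlonglongrightarrow> exp (- (1 / s) * 0)"
      by (intro tendsto_intros lim_1_over_n)
    then show "(\<lambda>n. exp (- (1 / s) * (1 / real n))) \<longlonglongrightarrow> 1" by simp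
    show "\<forall>\<^sub>F n in sequentially. exp (- (1 / s) * (1 / real n)) = smooth_exp 1 (real n * s)"
      using eventually_gt_at_top[of 0] by eventually_elim (use that in \<open>simp add: smooth_exp_def\<close>)
  qed
  show ?thesis
    using True tendsto_mult[OF *[of "t - a"] *[of "b - t"]] by (simp add: interval_bump_def)
qed (simp add: interval_bump_eq_0)

lemma smooth_imp_continuous_on:
  assumes "smooth f" shows "continuous_on A f"
  using assms unfolding smooth_iff_smooth_on
  by (meson UNIV_I continuous_at_imp_continuous_on differentiable_imp_continuous_within smooth_on_differentiable)

lemma smooth_antiderivative:
  assumes "smooth (b :: real \<Rightarrow> real)"
  obtains B where "smooth B" "\<And>x. (B has_real_derivative b x) (at x)"
proof -
  obtain B where B: "\<And>x. (B has_vector_derivative b x) (at x)"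
    using einterval_antiderivative[of "-\<infinity>" "\<infinity>" b] smooth_imp_continuous_on[OF assms, of UNIV]
    by (auto simp: continuous_on_eq_continuous_at)
  then have B': "(B has_real_derivative b x) (at x)" for x
    by (simp add: has_real_derivative_iff_has_vector_derivative)
  have "smooth B"
  proof (rule smooth_real_coinduct[where P = "\<lambda>f. f = B \<or> smooth f"])
    fix f assume "f = B \<or> smooth f"
    then show "\<exists>f'. (f' = B \<or> smooth f') \<and> (\<forall>x. (f has_real_derivative f' x) (at x))"
      using B' assms smooth_real_deriv by metis
  qed auto
  then show ?thesis using B' that by blast
qed

text \<open>A normalised antiderivative of a bump on the unit interval: it is constant on either
  side and takes a larger value at 1 than at 0, so it can be rescaled to the values 0 and 1.\<close>

lemma smooth_step:
  obtains s :: "real \<Rightarrow> real" where "smooth s" "\<And>t. t \<le> 0 \<Longrightarrow> s t = 0" "\<And>t. 1 \<le> t \<Longrightarrow> s t = 1"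
proof -
  let ?b = "interval_bump 0 1 1"
  obtain B where B: "smooth B" "\<And>x. (B has_real_derivative ?b x) (at x)"
    using smooth_antiderivative[OF smooth_interval_bump] by blast
  have const: "B s = B t" if "s \<le> t" "{s<..<t} \<inter> {0<..<1} = {}" for s t
  proof (cases "s = t")
    case False
    have "continuous_on {s..t} B" by (rule smooth_imp_continuous_on[OF B(1)])
    moreover have "(B has_real_derivative 0) (at x)" if "s < x" "x < t" for x
      using B(2)[of x] that interval_bump_eq_0[of x 0 1 1] \<open>{s<..<t} \<inter> {0<..<1} = {}\<close> by fastforce
    ultimately show ?thesis using DERIV_isconst_end[of s t B] False that(1) by simp
  qed simp
  have lt: "B 0 < B 1"
  proof (rule DERIV_pos_imp_increasing_open[of 0 1 B])
    show "continuous_on {0..1} B" by (rule smooth_imp_continuous_on[OF B(1)])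
    show "\<exists>y. (B has_real_derivative y) (at x) \<and> 0 < y" if "0 < x" "x < 1" for x
      using B(2) interval_bump_pos[of 1 x 0 1] that by force
  qed simp
  let ?s = "\<lambda>t. (B t - B 0) * (1 / (B 1 - B 0))"
  show ?thesis
  proof
    have "smooth (\<lambda>t. B t + (- B 0))" using B(1) unfolding smooth_iff_smooth_on by (intro smooth_on_add smooth_on_const) auto
    then have "smooth (\<lambda>t. (B t + (- B 0)) * (1 / (B 1 - B 0)))"
      by (intro smooth_mult) (simp_all add: smooth_iff_smooth_on smooth_on_const)
    then show "smooth ?s" by simp
    show "?s t = 0" if "t \<le> 0" for t using const[of t 0] that by auto
    show "?s t = 1" if "1 \<le> t" for t using const[of 1 t] that lt by auto
  qed
qed

text \<open>A step rising between -b and -a, times its mirror image.\<close>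

lemma smooth_plateau:
  fixes a b :: real assumes "a < b"
  obtains p :: "real \<Rightarrow> real" where "smooth p" "\<And>t. \<bar>t\<bar> \<le> a \<Longrightarrow> p t = 1" "\<And>t. \<bar>t\<bar> \<ge> b \<Longrightarrow> p t = 0"
proof -
  obtain s :: "real \<Rightarrow> real" where s: "smooth s" "\<And>t. t \<le> 0 \<Longrightarrow> s t = 0" "\<And>t. 1 \<le> t \<Longrightarrow> s t = 1"
    using smooth_step by blast
  let ?p = "\<lambda>t. s (1 / (b - a) * t + b / (b - a)) * s (- 1 / (b - a) * t + b / (b - a))"
  have e: "1 / (b - a) * t + b / (b - a) = (b + t) / (b - a)" "- 1 / (b - a) * t + b / (b - a) = (b - t) / (b - a)" for t
    by (simp_all add: add_divide_distrib diff_divide_distrib)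
  show ?thesis
  proof
    show "smooth ?p" by (intro smooth_mult smooth_affine_comp s)
    show "?p t = 1" if "\<bar>t\<bar> \<le> a" for t
      unfolding e using that assms by (simp add: s(3) le_divide_eq)
    show "?p t = 0" if "\<bar>t\<bar> \<ge> b" for t
    proof (cases "t \<ge> 0")
      case True
      then have "(b - t) / (b - a) \<le> 0" using that assms by (auto simp: divide_nonpos_pos)
      then show ?thesis unfolding e using s(2) by simp
    next
      case False
      then have "(b + t) / (b - a) \<le> 0" using that assms by (auto simp: divide_nonpos_pos)
      then show ?thesis unfolding e using s(2) by simp
    qed
  qed
qed

section \<open>Integration over the plane and weak derivatives\<close>

lemma measurable_Complex [measurable]: "(\<lambda>p. Complex (fst p) (snd p)) \<in> borel \<rightarrow>\<^sub>M borel"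
  by (intro borel_measurable_continuous_onI) (auto simp: Complex_eq intro!: continuous_intros)

text \<open>Both measures give a box the product of its side lengths. This identification is what
  allows Fubini over rows and columns of the complex plane.\<close>

lemma lborel_complex: "(lborel :: complex measure) = distr (lborel \<Otimes>\<^sub>M lborel) borel (\<lambda>p. Complex (fst p) (snd p))"
proof (rule lborel_eqI)
  fix l u :: complex assume le: "\<And>b. b \<in> Basis \<Longrightarrow> l \<bullet> b \<le> u \<bullet> b"
  have le': "Re l \<le> Re u" "Im l \<le> Im u"
    using le[of 1] le[of \<i>] by (auto simp: Basis_complex_def)
  have eq: "(\<lambda>p. Complex (fst p) (snd p)) -` box l u = box (Re l) (Re u) \<times> box (Im l) (Im u)"
    by (auto simp: in_box_complex_iff)
  have "emeasure (distr (lborel \<Otimes>\<^sub>M lborel) borel (\<lambda>p. Complex (fst p) (snd p))) (box l u)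
    = emeasure (lborel \<Otimes>\<^sub>M lborel) (box (Re l) (Re u) \<times> box (Im l) (Im u))"
    by (subst emeasure_distr) (auto simp: eq space_pair_measure lborel_prod)
  also have "\<dots> = ennreal (Re u - Re l) * ennreal (Im u - Im l)"
    by (subst lborel.emeasure_pair_measure_Times) (auto simp: le')
  also have "\<dots> = (\<Prod>b\<in>Basis. (u - l) \<bullet> b)"
    using le' by (simp add: Basis_complex_def ennreal_mult)
  finally show "emeasure (distr (lborel \<Otimes>\<^sub>M lborel) borel (\<lambda>p. Complex (fst p) (snd p))) (box l u) = (\<Prod>b\<in>Basis. (u - l) \<bullet> b)" .
qed simp

lemma measurable_Complex_pair [measurable]:
  "(\<lambda>p. Complex (fst p) (snd p)) \<in> lborel \<Otimes>\<^sub>M lborel \<rightarrow>\<^sub>M borel"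
  by (subst lborel_prod) simp

lemma nn_integral_complex:
  assumes [measurable]: "f \<in> borel_measurable borel"
  shows "(\<integral>\<^sup>+z. f z \<partial>lborel) = (\<integral>\<^sup>+y. \<integral>\<^sup>+x. f (Complex x y) \<partial>lborel \<partial>lborel)"
proof -
  have "(\<integral>\<^sup>+z. f z \<partial>lborel) = (\<integral>\<^sup>+p. f (Complex (fst p) (snd p)) \<partial>(lborel \<Otimes>\<^sub>M lborel))"
    by (subst lborel_complex, subst nn_integral_distr) auto
  also have "\<dots> = (\<integral>\<^sup>+y. \<integral>\<^sup>+x. f (Complex x y) \<partial>lborel \<partial>lborel)"
    by (subst lborel_pair.nn_integral_snd[symmetric]) (auto simp: split_beta')
  finally show ?thesis .
qed

lemma integrable_complex:
  fixes f :: "complex \<Rightarrow> 'b::{banach, second_countable_topology}"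
  assumes "integrable lborel f"
  shows "integrable (lborel \<Otimes>\<^sub>M lborel) (\<lambda>p. f (Complex (fst p) (snd p)))"
    and "(\<integral>z. f z \<partial>lborel) = (\<integral>p. f (Complex (fst p) (snd p)) \<partial>(lborel \<Otimes>\<^sub>M lborel))"
proof -
  have [measurable]: "f \<in> borel_measurable borel" using assms by auto
  show "integrable (lborel \<Otimes>\<^sub>M lborel) (\<lambda>p. f (Complex (fst p) (snd p)))"
    using assms by (subst (asm) lborel_complex) (auto simp: integrable_distr_eq)
  show "(\<integral>z. f z \<partial>lborel) = (\<integral>p. f (Complex (fst p) (snd p)) \<partial>(lborel \<Otimes>\<^sub>M lborel))"
    by (subst lborel_complex, subst integral_distr) auto
qed

lemma integral_complex_rows:
  fixes f :: "complex \<Rightarrow> 'b::{banach, second_countable_topology}"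
  assumes "integrable lborel f"
  shows "(\<integral>z. f z \<partial>lborel) = (\<integral>y. \<integral>x. f (Complex x y) \<partial>lborel \<partial>lborel)"
    and "AE y in lborel. integrable lborel (\<lambda>x. f (Complex x y))"
  using lborel_pair.integral_snd[of "\<lambda>x y. f (Complex x y)"] lborel_pair.AE_integrable_snd[of "\<lambda>x y. f (Complex x y)"]
    integrable_complex[OF assms] by (auto simp: split_beta')

lemma integral_complex_columns:
  fixes f :: "complex \<Rightarrow> 'b::{banach, second_countable_topology}"
  assumes "integrable lborel f"
  shows "(\<integral>z. f z \<partial>lborel) = (\<integral>x. \<integral>y. f (Complex x y) \<partial>lborel \<partial>lborel)"
    and "AE x in lborel. integrable lborel (\<lambda>y. f (Complex x y))"
  using lborel_pair.integral_fst'[of "\<lambda>p. f (Complex (fst p) (snd p))"] lborel_pair.AE_integrable_fst'[of "\<lambda>p. f (Complex (fst p) (snd p))"]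
    integrable_complex[OF assms] by (auto simp: split_beta')

section \<open>Local square integrability and pairing with test functions\<close>

lemma compact_imp_sets_lebesgue: "compact K \<Longrightarrow> K \<in> sets lebesgue"
  by (simp add: borel_compact)

lemma continuous_imp_measurable_lebesgue:
  "continuous_on UNIV f \<Longrightarrow> f \<in> borel_measurable lebesgue"
  using borel_measurable_continuous_onI[of f] by (simp add: measurable_completion)

text \<open>On a compact set constants are integrable, and t \<le> 1 + t^2 bounds the norm by an
  integrable function.\<close>

lemma L2_loc_set_integrable:
  assumes "L2_loc u" "compact K"
  shows "set_integrable lebesgue K u"
proof -
  have [measurable]: "u \<in> borel_measurable lebesgue" "K \<in> sets lebesgue"
    using assms by (auto simp: L2_loc_def compact_imp_sets_lebesgue)
  have "set_integrable lebesgue K (\<lambda>x. 1 + (norm (u x))\<^sup>2)"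
    using assms lmeasurable_compact[OF assms(2)]
    by (intro set_integral_add) (auto simp: L2_loc_def set_integrable_def fmeasurable_def integrable_real_indicator)
  then show ?thesis unfolding set_integrable_def
  proof (rule Bochner_Integration.integrable_bound)
    have "t \<le> 1 + t\<^sup>2" for t :: real
      using zero_le_power2[of "t - 1/2"] by (simp add: power2_eq_square algebra_simps)
    then show "AE x in lebesgue. norm (indicat_real K x *\<^sub>R u x) \<le> norm (indicat_real K x *\<^sub>R (1 + (norm (u x))\<^sup>2))"
      by (intro AE_I2) (auto simp: indicator_def)
  qed measurable
qed

lemma continuous_compact_support_bounded:
  fixes f :: "'a::euclidean_space \<Rightarrow> 'b::real_normed_vector"
  assumes "continuous_on UNIV f" "compact K" "\<And>x. x \<notin> K \<Longrightarrow> f x = 0"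
  obtains B where "B > 0" "\<And>x. norm (f x) \<le> B"
proof -
  have "bounded (f ` K)"
    using assms by (meson compact_continuous_image compact_imp_bounded continuous_on_subset subset_UNIV)
  then obtain B where "B > 0" "\<forall>x\<in>f ` K. norm x \<le> B"
    using bounded_pos by blast
  then show ?thesis using that[of B] assms(3) by (metis imageI norm_zero order_less_imp_le)
qed

lemma integrable_scaleR_L2_loc:
  assumes "L2_loc u" "continuous_on UNIV \<phi>" "compact K" "\<And>x. x \<notin> K \<Longrightarrow> \<phi> x = (0::real)"
  shows "integrable lebesgue (\<lambda>x. \<phi> x *\<^sub>R u x)"
proof -
  obtain B where B: "B > 0" "\<And>x. norm (\<phi> x) \<le> B"
    using continuous_compact_support_bounded[OF assms(2-4)] by blast
  have [measurable]: "u \<in> borel_measurable lebesgue" "K \<in> sets lebesgue" "\<phi> \<in> borel_measurable lebesgue"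
    using assms by (auto simp: L2_loc_def compact_imp_sets_lebesgue continuous_imp_measurable_lebesgue)
  have "integrable lebesgue (\<lambda>x. B *\<^sub>R (indicator K x *\<^sub>R u x))"
    using L2_loc_set_integrable[OF assms(1,3)] unfolding set_integrable_def by (intro integrable_scaleR_right) 
  then show ?thesis
  proof (rule Bochner_Integration.integrable_bound)
    show "AE x in lebesgue. norm (\<phi> x *\<^sub>R u x) \<le> norm (B *\<^sub>R (indicat_real K x *\<^sub>R u x))"
      using B assms(4) by (intro AE_I2) (auto simp: indicator_def mult_right_mono)
  qed measurable
qed

lemma L2_locI_bounded:
  assumes "u \<in> borel_measurable lebesgue"
    and "\<And>K. compact K \<Longrightarrow> \<exists>B. \<forall>x\<in>K. norm (u x) \<le> B"
  shows "L2_loc u"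
  unfolding L2_loc_def
proof (intro conjI allI impI assms(1))
  fix K :: "'a set" assume K: "compact K"
  then obtain B where B: "\<forall>x\<in>K. norm (u x) \<le> B" using assms(2) by blast
  have [measurable]: "u \<in> borel_measurable lebesgue" "K \<in> sets lebesgue"
    using assms K by (auto simp: compact_imp_sets_lebesgue)
  have "set_integrable lebesgue K (\<lambda>x. B\<^sup>2)"
    using lmeasurable_compact[OF K] unfolding set_integrable_def
    by (intro integrable_scaleR_left integrable_real_indicator) (auto simp: fmeasurable_def)
  then show "set_integrable lebesgue K (\<lambda>x. (norm (u x))\<^sup>2)"
    unfolding set_integrable_def
  proof (rule Bochner_Integration.integrable_bound)
    show "AE x in lebesgue. norm (indicat_real K x *\<^sub>R (norm (u x))\<^sup>2) \<le> norm (indicat_real K x *\<^sub>R B\<^sup>2)"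
      using B by (intro AE_I2) (auto simp: indicator_def power_mono)
  qed measurable
qed

lemma norm_add_squared_le:
  fixes a b :: "'a::real_inner"
  shows "(norm (a + b))\<^sup>2 \<le> 2 * (norm a)\<^sup>2 + 2 * (norm b)\<^sup>2"
proof -
  have "(norm (a + b))\<^sup>2 \<le> (norm a + norm b)\<^sup>2" by (simp add: norm_triangle_ineq power_mono)
  also have "\<dots> \<le> 2 * (norm a)\<^sup>2 + 2 * (norm b)\<^sup>2"
    using zero_le_power2[of "norm a - norm b"] by (simp add: power2_eq_square algebra_simps)
  finally show ?thesis .
qed

lemma L2_loc_add:
  assumes "L2_loc u" "L2_loc v"
  shows "L2_loc (\<lambda>x. u x + v x)"
  unfolding L2_loc_def
proof (intro conjI allI impI)
  have [measurable]: "u \<in> borel_measurable lebesgue" "v \<in> borel_measurable lebesgue"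
    using assms by (auto simp: L2_loc_def)
  show "(\<lambda>x. u x + v x) \<in> borel_measurable lebesgue" by measurable
  fix K :: "'a set" assume K: "compact K"
  then have [measurable]: "K \<in> sets lebesgue" by (auto simp: compact_imp_sets_lebesgue)
  have "set_integrable lebesgue K (\<lambda>x. 2 * (norm (u x))\<^sup>2 + 2 * (norm (v x))\<^sup>2)"
    using assms K by (intro set_integral_add set_integrable_mult_right) (auto simp: L2_loc_def)
  then show "set_integrable lebesgue K (\<lambda>x. (norm (u x + v x))\<^sup>2)"
    unfolding set_integrable_def
  proof (rule Bochner_Integration.integrable_bound)
    show "AE x in lebesgue. norm (indicat_real K x *\<^sub>R (norm (u x + v x))\<^sup>2) \<le> norm (indicat_real K x *\<^sub>R (2 * (norm (u x))\<^sup>2 + 2 * (norm (v x))\<^sup>2))"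
      using norm_add_squared_le[of "u _" "v _"] by (intro AE_I2) (auto simp: indicator_def)
  qed measurable
qed

lemma L2_loc_uminus: "L2_loc u \<Longrightarrow> L2_loc (\<lambda>x. - u x)"
  by (auto simp: L2_loc_def)

lemma L2_loc_diff: "L2_loc u \<Longrightarrow> L2_loc v \<Longrightarrow> L2_loc (\<lambda>x. u x - v x)"
  using L2_loc_add[OF _ L2_loc_uminus, of u v] by simp

lemma test_functionI:
  assumes "smooth \<phi>" "compact K" "\<And>x. x \<notin> K \<Longrightarrow> \<phi> x = 0"
  shows "test_function \<phi>"
proof -
  have "closure {x. \<phi> x \<noteq> 0} \<subseteq> K"
    using assms by (intro closure_minimal) (auto intro: compact_imp_closed)
  then show ?thesis
    using assms by (metis bounded_subset closed_closure compact_eq_bounded_closed test_function_def)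
qed

lemma partial_deriv_eq_0_open:
  assumes "open S" "x \<in> S" "\<And>y. y \<in> S \<Longrightarrow> f y = c"
  shows "partial_deriv e f x = 0"
proof -
  have "partial_deriv e (\<lambda>_. c) x = partial_deriv e f x"
    using assms by (intro partial_deriv_cong_open[of S]) auto
  then show ?thesis
    using partial_deriv_eqI[of "\<lambda>_. c" "\<lambda>_. 0" x e] by simp
qed

lemma test_function_partial_deriv:
  assumes "test_function \<phi>" "e \<in> Basis"
  shows "test_function (partial_deriv e \<phi>)"
proof (rule test_functionI)
  show "smooth (partial_deriv e \<phi>)"
    using assms smooth_on_partial_deriv by (auto simp: test_function_def smooth_iff_smooth_on)
  show "compact (closure {x. \<phi> x \<noteq> 0})" using assms by (simp add: test_function_def)
  show "partial_deriv e \<phi> x = 0" if "x \<notin> closure {x. \<phi> x \<noteq> 0}" for x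
    using that closure_subset[of "{x. \<phi> x \<noteq> 0}"]
    by (intro partial_deriv_eq_0_open[of "- closure {x. \<phi> x \<noteq> 0}" _ _ 0]) auto
qed

lemma test_function_support: "x \<notin> closure {x. \<phi> x \<noteq> 0} \<Longrightarrow> \<phi> x = 0"
  using closure_subset[of "{x. \<phi> x \<noteq> 0}"] by blast

lemma integrable_test_function:
  assumes "L2_loc u" "test_function \<phi>"
  shows "integrable lebesgue (\<lambda>x. \<phi> x *\<^sub>R u x)"
  using assms by (intro integrable_scaleR_L2_loc[where K = "closure {x. \<phi> x \<noteq> 0}"])
    (auto simp: test_function_def smooth_imp_continuous_on dest: test_function_support)

lemma is_weak_partial_diff:
  assumes "L2_loc u" "L2_loc v" "L2_loc g" "L2_loc h" "e \<in> Basis" "is_weak_partial e u g" "is_weak_partial e v h"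
  shows "is_weak_partial e (\<lambda>x. u x - v x) (\<lambda>x. g x - h x)"
  unfolding is_weak_partial_def
proof (intro allI impI)
  fix \<phi> :: "'a \<Rightarrow> real" assume \<phi>: "test_function \<phi>"
  note \<phi>' = test_function_partial_deriv[OF \<phi> assms(5)]
  show "(\<integral>x. partial_deriv e \<phi> x *\<^sub>R (u x - v x) \<partial>lebesgue) = - (\<integral>x. \<phi> x *\<^sub>R (g x - h x) \<partial>lebesgue)"
    using assms(6,7) \<phi> unfolding is_weak_partial_def scaleR_diff_right
    by (subst (1 2) Bochner_Integration.integral_diff)
      (auto intro!: integrable_test_function assms \<phi>')
qed

section \<open>Uniqueness of weak derivatives\<close>

definition box_bump :: "complex \<Rightarrow> complex \<Rightarrow> nat \<Rightarrow> complex \<Rightarrow> real" where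
  "box_bump l u n z = interval_bump (Re l) (Re u) n (Re z) * interval_bump (Im l) (Im u) n (Im z)"

lemma smooth_Re_comp: "smooth b \<Longrightarrow> smooth (\<lambda>z::complex. b (Re z))"
  and smooth_Im_comp: "smooth b \<Longrightarrow> smooth (\<lambda>z::complex. b (Im z))" for b :: "real \<Rightarrow> real"
  using smooth_inner_comp[of b "1::complex"] smooth_inner_comp[of b "\<i>"] by auto

lemma box_bump_eq_0: "z \<notin> box l u \<Longrightarrow> box_bump l u n z = 0"
  by (auto simp: box_bump_def in_box_complex_iff interval_bump_eq_0)

lemma test_function_box_bump: "test_function (box_bump l u n)"
proof (rule test_functionI[where K = "cbox l u"])
  show "smooth (box_bump l u n)" unfolding box_bump_def[abs_def]
    by (intro smooth_mult smooth_Re_comp smooth_Im_comp smooth_interval_bump)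
  show "box_bump l u n x = 0" if "x \<notin> cbox l u" for x
    using that box_bump_eq_0 box_subset_cbox by blast
qed simp

lemma box_bump_bounds: "0 \<le> box_bump l u n z" "box_bump l u n z \<le> 1"
  unfolding box_bump_def using interval_bump_bounds by (auto intro!: mult_le_one mult_nonneg_nonneg)

lemma box_bump_tendsto: "(\<lambda>n. box_bump l u n z) \<longlonglongrightarrow> indicator (box l u) z"
proof -
  have "(\<lambda>n. box_bump l u n z) \<longlonglongrightarrow> indicator {Re l<..<Re u} (Re z) * indicator {Im l<..<Im u} (Im z)"
    unfolding box_bump_def by (intro tendsto_mult interval_bump_tendsto)
  also have "indicator {Re l<..<Re u} (Re z) * indicator {Im l<..<Im u} (Im z) = (indicator (box l u) z :: real)"
    by (auto simp: indicator_def in_box_complex_iff)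
  finally show ?thesis .
qed

text \<open>The Borel sets over which \<open>g\<close> integrates to 0 form a Dynkin system: the
  vanishing total integral handles complements, and countable additivity handles disjoint unions.
  Boxes are stable under intersection and generate the Borel sets; a Lebesgue set differs from a
  Borel set only inside a null set.\<close>

lemma integral_eq_0_on_lebesgue_sets:
  fixes g :: "'a::euclidean_space \<Rightarrow> 'b::{banach, second_countable_topology}"
  assumes int: "integrable lebesgue g" and 0: "(\<integral>x. g x \<partial>lebesgue) = 0"
    and box: "\<And>l u. (\<integral>x. indicat_real (box l u) x *\<^sub>R g x \<partial>lebesgue) = 0"
    and A: "A \<in> sets lebesgue"
  shows "(\<integral>x. indicat_real A x *\<^sub>R g x \<partial>lebesgue) = 0"
proof -
  have ia: "integrable lebesgue (\<lambda>x. indicat_real A x *\<^sub>R g x)" if "A \<in> sets lebesgue" for A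
    using that int by (intro integrable_mult_indicator)
  let ?E = "range (\<lambda>(a, b). box a b::'a set)"
  have stable: "Int_stable ?E" by (auto simp: Int_stable_def box_Int_box)
  have pow: "?E \<subseteq> Pow UNIV" by simp
  have sets: "sets borel = sigma_sets UNIV ?E" by (simp add: borel_eq_box)
  then have B: "A \<in> sigma_sets UNIV ?E \<Longrightarrow> A \<in> sets lebesgue" for A
    by (metis sets_completionI_sets sets_lborel)
  have borel: "(\<integral>x. indicat_real A x *\<^sub>R g x \<partial>lebesgue) = 0" if "A \<in> sigma_sets UNIV ?E" for A
    using stable pow that
  proof (induction rule: sigma_sets_induct_disjoint)
      case (basic A) then show ?case using box by auto
    next
      case empty show ?case by simp
    next
      case (compl A)
      have "(\<integral>x. indicat_real (UNIV - A) x *\<^sub>R g x \<partial>lebesgue) = (\<integral>x. g x - indicat_real A x *\<^sub>R g x \<partial>lebesgue)"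
        by (intro Bochner_Integration.integral_cong) (auto simp: indicator_def)
      also have "\<dots> = 0"
        using compl 0 int ia[OF B] by (subst Bochner_Integration.integral_diff) auto
      finally show ?case .
    next
      case (union F)
      have "(\<integral>x. indicat_real (\<Union> (range F)) x *\<^sub>R g x \<partial>lebesgue) = (\<Sum>n. \<integral>x. indicat_real (F n) x *\<^sub>R g x \<partial>lebesgue)"
        unfolding set_lebesgue_integral_def[symmetric]
      proof (rule lebesgue_integral_countable_add)
        show F: "F i \<in> sets lebesgue" for i using union(2) B by blast
        then have "\<Union> (range F) \<in> sets lebesgue" by blast
        then show "set_integrable lebesgue (\<Union> (range F)) g" using ia by (simp add: set_integrable_def)
      qed (use union(1) in \<open>auto simp: disjoint_family_on_def\<close>)
      then show ?case using union by simp
  qed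
  obtain S N N' where AB: "A = S \<union> N" "N \<subseteq> N'" "N' \<in> null_sets lborel" "S \<in> sets lborel"
    using A by (rule sets_completionE)
  have "AE x in lebesgue. x \<notin> N'"
    using AE_not_in[OF AB(3)] by (rule AE_completion)
  then have "(\<integral>x. indicat_real A x *\<^sub>R g x \<partial>lebesgue) = (\<integral>x. indicat_real S x *\<^sub>R g x \<partial>lebesgue)"
    using AB A ia
    by (intro integral_cong_AE borel_measurable_integrable ia) (auto simp: indicator_def)
  also have "\<dots> = 0" using AB(4) sets by (intro borel) simp
  finally show ?thesis .
qed

lemma box_cover: "\<exists>n::nat. x \<in> box (- real n *\<^sub>R One) (real n *\<^sub>R One)"
proof -
  have "x \<in> (\<Union>n::nat. box (- (real n *\<^sub>R One)) (real n *\<^sub>R One))" by (simp only: UN_box_eq_UNIV UNIV_I)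
  then show ?thesis by auto
qed

lemma sigma_finite_lebesgue: "sigma_finite_measure (lebesgue :: 'a::euclidean_space measure)"
proof
  show "\<exists>A. countable A \<and> A \<subseteq> sets (lebesgue :: 'a measure) \<and> \<Union> A = space lebesgue \<and> (\<forall>a\<in>A. emeasure lebesgue a \<noteq> \<infinity>)"
    by (rule exI[of _ "range (\<lambda>n::nat. box (- (real n *\<^sub>R One)) (real n *\<^sub>R One))"])
      (auto simp: UN_box_eq_UNIV)
qed

text \<open>A local form of the fundamental lemma of the calculus of variations: bumps on boxes
  inside the given one converge to indicators, so the integrals over all measurable subsets vanish.
  The localisation matters later, when the vanishing is known only for bumps supported away from the
  strip.\<close>

lemma AE_eq_0_on_box:
  fixes g :: "complex \<Rightarrow> 'b::euclidean_space"
  assumes g: "L2_loc g"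
    and zero: "\<And>l u n. box l u \<subseteq> box a b \<Longrightarrow> (\<integral>z. box_bump l u n z *\<^sub>R g z \<partial>lebesgue) = 0"
  shows "AE z in lebesgue. z \<in> box a b \<longrightarrow> g z = 0"
proof -
  have [measurable]: "g \<in> borel_measurable lebesgue" using g by (simp add: L2_loc_def)
  have int: "integrable lebesgue (\<lambda>z. indicat_real (box a b) z *\<^sub>R g z)"
    using set_integrable_subset[OF L2_loc_set_integrable[OF g compact_cbox, of a b], of "box a b"] box_subset_cbox
    by (auto simp: set_integrable_def)
  have box0: "(\<integral>z. indicat_real (box l u) z *\<^sub>R g z \<partial>lebesgue) = 0" if sub: "box l u \<subseteq> box a b" for l u
  proof -
    have "(\<lambda>n. \<integral>z. box_bump l u n z *\<^sub>R g z \<partial>lebesgue) \<longlonglongrightarrow> (\<integral>z. indicat_real (box l u) z *\<^sub>R g z \<partial>lebesgue)"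
    proof (rule integral_dominated_convergence)
      show "integrable lebesgue (\<lambda>z. norm (indicat_real (box a b) z *\<^sub>R g z))" using int by (rule integrable_norm)
      show "AE z in lebesgue. (\<lambda>n. box_bump l u n z *\<^sub>R g z) \<longlonglongrightarrow> indicat_real (box l u) z *\<^sub>R g z"
        by (intro AE_I2 tendsto_scaleR box_bump_tendsto tendsto_const)
      show "AE z in lebesgue. norm (box_bump l u n z *\<^sub>R g z) \<le> norm (indicat_real (box a b) z *\<^sub>R g z)" for n
      proof (intro AE_I2)
        fix z show "norm (box_bump l u n z *\<^sub>R g z) \<le> norm (indicat_real (box a b) z *\<^sub>R g z)"
        proof (cases "z \<in> box a b")
          case False
          then have "z \<notin> box l u" using sub by blast
          then show ?thesis using box_bump_eq_0[of z l u n] by simp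
        qed (use box_bump_bounds[of l u n] in \<open>auto intro!: mult_left_le_one_le\<close>)
      qed
      show "(\<lambda>z. box_bump l u n z *\<^sub>R g z) \<in> borel_measurable lebesgue" for n
        using integrable_test_function[OF g test_function_box_bump] by (rule borel_measurable_integrable)
    show "(\<lambda>z. indicat_real (box l u) z *\<^sub>R g z) \<in> borel_measurable lebesgue"
        using g by (intro borel_measurable_scaleR borel_measurable_indicator) (auto simp: L2_loc_def)
    qed
    then show ?thesis using zero[OF sub] by (simp add: LIMSEQ_const_iff)
  qed
  have "AE z in lebesgue. indicat_real (box a b) z *\<^sub>R g z = 0"
  proof (rule sigma_finite_measure.density_zero[OF sigma_finite_lebesgue int])
    fix A :: "complex set" assume A: "A \<in> sets lebesgue"
    have "(\<integral>z. indicat_real (box l u) z *\<^sub>R (indicat_real (box a b) z *\<^sub>R g z) \<partial>lebesgue) = 0" for l u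
    proof -
      obtain l' u' where eq: "box l u \<inter> box a b = box l' u'"
        using box_Int_box by blast
      have "indicat_real (box l u) z *\<^sub>R (indicat_real (box a b) z *\<^sub>R g z) = indicat_real (box l' u') z *\<^sub>R g z" for z
        unfolding eq[symmetric] by (simp add: indicator_inter_arith)
      then show ?thesis using box0[of l' u'] eq by (metis (no_types, lifting) Bochner_Integration.integral_cong inf.cobounded2)
    qed
    then show "set_lebesgue_integral lebesgue A (\<lambda>z. indicat_real (box a b) z *\<^sub>R g z) = 0"
      unfolding set_lebesgue_integral_def
      by (rule integral_eq_0_on_lebesgue_sets[OF int box0[OF subset_refl] _ A])
  qed
  then show ?thesis by eventually_elim (auto simp: indicator_def)
qed

lemma AE_eq_0_if_test:
  fixes g :: "complex \<Rightarrow> 'b::euclidean_space"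
  assumes g: "L2_loc g" and zero: "\<And>\<phi>. test_function \<phi> \<Longrightarrow> (\<integral>z. \<phi> z *\<^sub>R g z \<partial>lebesgue) = 0"
  shows "AE z in lebesgue. g z = 0"
proof -
  have "AE z in lebesgue. \<forall>n. z \<in> box (- real n *\<^sub>R One) (real n *\<^sub>R One) \<longrightarrow> g z = 0"
    unfolding AE_all_countable
    by (intro allI AE_eq_0_on_box g zero test_function_box_bump)
  then show ?thesis by eventually_elim (use box_cover in blast)
qed

lemma weak_partial_unique:
  fixes u :: "complex \<Rightarrow> 'b::euclidean_space"
  assumes "L2_loc g" "L2_loc h" "is_weak_partial e u g" "is_weak_partial e u h"
  shows "AE z in lebesgue. g z = h z"
proof -
  have "AE z in lebesgue. g z - h z = 0"
  proof (rule AE_eq_0_if_test)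
    show "L2_loc (\<lambda>z. g z - h z)" by (rule L2_loc_diff) fact+
    fix \<phi> :: "complex \<Rightarrow> real" assume \<phi>: "test_function \<phi>"
    have "(\<integral>z. \<phi> z *\<^sub>R (g z - h z) \<partial>lebesgue) = (\<integral>z. \<phi> z *\<^sub>R g z \<partial>lebesgue) - (\<integral>z. \<phi> z *\<^sub>R h z \<partial>lebesgue)"
      unfolding scaleR_diff_right using assms \<phi>
      by (intro Bochner_Integration.integral_diff integrable_test_function)
    also have "\<dots> = 0" using assms(3,4)[unfolded is_weak_partial_def, rule_format, OF \<phi>] by simp
    finally show "(\<integral>z. \<phi> z *\<^sub>R (g z - h z) \<partial>lebesgue) = 0" .
  qed
  then show ?thesis by eventually_elim simp
qed

lemma weak_partial_H1_loc:
  assumes "u \<in> H1_loc" "e \<in> Basis"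
  shows "L2_loc (weak_partial e u)" "is_weak_partial e u (weak_partial e u)"
proof -
  have "\<exists>g. L2_loc g \<and> is_weak_partial e u g" using assms by (auto simp: H1_loc_def)
  from someI_ex[OF this] show "L2_loc (weak_partial e u)" "is_weak_partial e u (weak_partial e u)"
    by (auto simp: weak_partial_def)
qed

text \<open>Transfers the energy, which is defined through an arbitrary choice of weak derivatives,
  to any explicitly known pair.\<close>

lemma dirichlet_energy_eq:
  assumes u: "u \<in> H1_loc" and "L2_loc g1" "is_weak_partial 1 u g1" "L2_loc g2" "is_weak_partial \<i> u g2"
  shows "dirichlet_energy u = (\<integral>\<^sup>+z. ennreal ((norm (g1 z))\<^sup>2 + (norm (g2 z))\<^sup>2) \<partial>lebesgue)"
proof -
  have "AE z in lebesgue. weak_partial 1 u z = g1 z"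
    by (rule weak_partial_unique[OF weak_partial_H1_loc(1)[OF u] assms(2) weak_partial_H1_loc(2)[OF u] assms(3)])
      (simp_all add: Basis_complex_def)
  moreover have "AE z in lebesgue. weak_partial \<i> u z = g2 z"
    by (rule weak_partial_unique[OF weak_partial_H1_loc(1)[OF u] assms(4) weak_partial_H1_loc(2)[OF u] assms(5)])
      (simp_all add: Basis_complex_def)
  ultimately have "AE z in lebesgue. ennreal (\<Sum>e\<in>Basis. (norm (weak_partial e u z))\<^sup>2) = ennreal ((norm (g1 z))\<^sup>2 + (norm (g2 z))\<^sup>2)"
    by eventually_elim (simp add: Basis_complex_def)
  then show ?thesis unfolding dirichlet_energy_def by (rule nn_integral_cong_AE)
qed

section \<open>Weak derivatives of functions differentiable off two horizontal lines\<close>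

lemma has_vector_derivative_row:
  fixes f :: "complex \<Rightarrow> 'b::real_normed_vector"
  assumes "(f has_derivative f') (at (Complex x y))"
  shows "((\<lambda>t. f (Complex t y)) has_vector_derivative f' 1) (at x)"
    and "((\<lambda>t. f (Complex x t)) has_vector_derivative f' \<i>) (at y)"
proof -
  interpret linear f' using assms by (rule has_derivative_linear)
  have 1: "((\<lambda>t. Complex t y) has_derivative (\<lambda>h. of_real h)) (at x)"
    unfolding Complex_eq by (auto intro!: derivative_eq_intros)
  have 2: "((\<lambda>t. Complex x t) has_derivative (\<lambda>h. \<i> * of_real h)) (at y)"
    unfolding Complex_eq by (auto intro!: derivative_eq_intros)
  have "f' (of_real h) = h *\<^sub>R f' 1" "f' (\<i> * of_real h) = h *\<^sub>R f' \<i>" for h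
    using scale[of h 1] scale[of h \<i>] by (simp_all add: scaleR_conv_of_real mult.commute)
  then show "((\<lambda>t. f (Complex t y)) has_vector_derivative f' 1) (at x)"
    "((\<lambda>t. f (Complex x t)) has_vector_derivative f' \<i>) (at y)"
    using has_derivative_compose[OF 1 assms] has_derivative_compose[OF 2 assms]
    by (simp_all add: has_vector_derivative_def)
qed

text \<open>The fundamental theorem of calculus survives finitely many exceptional points as long as
  \<open>f\<close> is continuous there. Such points occur where a vertical line crosses the boundary
  of the strip.\<close>

lemma integral_derivative_compact_support:
  fixes f :: "real \<Rightarrow> 'b::euclidean_space"
  assumes "finite S" "continuous_on UNIV f"
    and "\<And>x. x \<notin> S \<Longrightarrow> (f has_vector_derivative f' x) (at x)"
    and supp: "\<And>x. \<bar>x\<bar> \<ge> R \<Longrightarrow> f x = 0" "\<And>x. \<bar>x\<bar> \<ge> R \<Longrightarrow> f' x = 0"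
    and int: "integrable lborel f'"
  shows "(\<integral>x. f' x \<partial>lborel) = 0"
proof -
  define r where "r = \<bar>R\<bar>"
  have "(f' has_integral (f r - f (- r))) {-r..r}"
    by (rule fundamental_theorem_of_calculus_interior_strong[OF assms(1)])
      (use assms in \<open>auto simp: r_def intro: continuous_on_subset\<close>)
  then have "(f' has_integral 0) {-r..r}" using supp(1)[of r] supp(1)[of "-r"] by (simp add: r_def)
  then have "(f' has_integral 0) UNIV"
    by (rule has_integral_on_superset) (use supp(2) in \<open>auto simp: r_def\<close>)
  then show ?thesis using has_integral_integral_lborel[OF int] has_integral_unique by blast
qed

lemma test_function_properties:
  fixes \<phi> :: "complex \<Rightarrow> real"
  assumes "test_function \<phi>"
  obtains R where "R > 0" "\<And>z. norm z \<ge> R \<Longrightarrow> \<phi> z = 0" "\<And>z e. norm z \<ge> R \<Longrightarrow> partial_deriv e \<phi> z = 0"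
    "continuous_on UNIV \<phi>" "\<And>e. e \<in> Basis \<Longrightarrow> continuous_on UNIV (partial_deriv e \<phi>)"
    "\<And>z. (\<phi> has_derivative frechet_derivative \<phi> (at z)) (at z)"
proof -
  have "bounded (closure {x. \<phi> x \<noteq> 0})"
    using assms by (auto simp: test_function_def compact_imp_bounded)
  then obtain r where r: "r > 0" "\<And>z. z \<in> closure {x. \<phi> x \<noteq> 0} \<Longrightarrow> norm z \<le> r"
    by (auto simp: bounded_pos)
  have 0: "\<phi> z = 0" if "norm z > r" for z
    using that r(2)[of z] test_function_support[of z \<phi>] by fastforce
  show ?thesis
  proof (rule that[of "r + 1"])
    show "\<phi> z = 0" if "norm z \<ge> r + 1" for z using 0 that by force
    show "partial_deriv e \<phi> z = 0" if "norm z \<ge> r + 1" for z e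
      by (rule partial_deriv_eq_0_open[of "{z. norm z > r}" _ _ 0])
        (use that 0 in \<open>auto intro!: open_Collect_less continuous_intros\<close>)
    show "continuous_on UNIV (partial_deriv e \<phi>)" if "e \<in> Basis" for e
      using test_function_partial_deriv[OF assms that] smooth_imp_continuous_on by (auto simp: test_function_def)
    show "continuous_on UNIV \<phi>" "(\<phi> has_derivative frechet_derivative \<phi> (at z)) (at z)" for z
      using assms smooth_imp_continuous_on[of \<phi>] has_derivative_frechet[of \<phi>] smooth_on_differentiable[of UNIV \<phi>]
      by (auto simp: test_function_def smooth_iff_smooth_on)
  qed (use r in auto)
qed

text \<open>Abstracts the map glued from its formulas in and off the strip, with \<open>m\<close>
  half the width. Continuity rules out a jump across the two lines, which would give the vertical
  derivative a singular part. Local boundedness of \<open>g1\<close> and \<open>g2\<close> makes the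
  candidate derivatives locally square integrable.\<close>

locale piecewise_differentiable =
  fixes u g1 g2 :: "complex \<Rightarrow> complex" and m :: real
  assumes cont: "continuous_on UNIV u"
    and meas: "g1 \<in> borel_measurable borel" "g2 \<in> borel_measurable borel"
    and bdd: "\<And>K. compact K \<Longrightarrow> \<exists>B. \<forall>z\<in>K. norm (g1 z) \<le> B" "\<And>K. compact K \<Longrightarrow> \<exists>B. \<forall>z\<in>K. norm (g2 z) \<le> B"
    and deriv: "\<And>z. \<bar>Im z\<bar> \<noteq> m \<Longrightarrow> (u has_derivative (\<lambda>h. Re h *\<^sub>R g1 z + Im h *\<^sub>R g2 z)) (at z)"
begin

lemma L2: "L2_loc u" "L2_loc g1" "L2_loc g2"
proof -
  have "compact K \<Longrightarrow> \<exists>B. \<forall>z\<in>K. norm (u z) \<le> B" for K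
    using compact_continuous_image[OF continuous_on_subset[OF cont subset_UNIV], of K] compact_imp_bounded bounded_pos
    by (metis imageI)
  then show "L2_loc u" using continuous_imp_measurable_lebesgue[OF cont] by (intro L2_locI_bounded)
  show "L2_loc g1" "L2_loc g2" using meas bdd by (auto intro!: L2_locI_bounded simp: measurable_completion)
qed

text \<open>Passes from Lebesgue to Borel measure, where Fubini is available, and combines both
  sides into the integral of a derivative of \<open>\<phi>\<close> times \<open>u\<close>. The
  hypothesis \<open>zero\<close> may use integrability of that integrand, so that almost every row
  or column is integrable.\<close>

lemma is_weak_partial_if_lines:
  assumes \<phi>: "test_function \<phi>" and e: "e \<in> Basis" and g: "g \<in> borel_measurable borel" "L2_loc g"
    and zero: "integrable lborel (\<lambda>z. partial_deriv e \<phi> z *\<^sub>R u z + \<phi> z *\<^sub>R g z) \<Longrightarrow>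
      (\<integral>z. partial_deriv e \<phi> z *\<^sub>R u z + \<phi> z *\<^sub>R g z \<partial>lborel) = 0"
  shows "(\<integral>z. partial_deriv e \<phi> z *\<^sub>R u z \<partial>lebesgue) = - (\<integral>z. \<phi> z *\<^sub>R g z \<partial>lebesgue)"
proof -
  have [measurable]: "u \<in> borel_measurable borel" "\<phi> \<in> borel_measurable borel" "partial_deriv e \<phi> \<in> borel_measurable borel"
    using cont test_function_properties[OF \<phi>] e by (auto intro!: borel_measurable_continuous_onI)
  note [measurable] = g(1)
  have i: "integrable lebesgue (\<lambda>z. partial_deriv e \<phi> z *\<^sub>R u z)" "integrable lebesgue (\<lambda>z. \<phi> z *\<^sub>R g z)"
    using L2 g \<phi> test_function_partial_deriv[OF \<phi> e] by (auto intro: integrable_test_function)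
  then have i': "integrable lborel (\<lambda>z. partial_deriv e \<phi> z *\<^sub>R u z + \<phi> z *\<^sub>R g z)"
    by (simp add: integrable_completion)
  have "(\<integral>z. partial_deriv e \<phi> z *\<^sub>R u z \<partial>lebesgue) + (\<integral>z. \<phi> z *\<^sub>R g z \<partial>lebesgue) = (\<integral>z. partial_deriv e \<phi> z *\<^sub>R u z + \<phi> z *\<^sub>R g z \<partial>lborel)"
    using i by (simp add: integral_completion integrable_completion)
  then show ?thesis using zero[OF i'] by (simp add: add_eq_0_iff2)
qed

lemma weak_partial_1: "is_weak_partial 1 u g1"
  unfolding is_weak_partial_def
proof (intro allI impI)
  fix \<phi> :: "complex \<Rightarrow> real" assume \<phi>: "test_function \<phi>"
  obtain R where R: "R > 0" "\<And>z. norm z \<ge> R \<Longrightarrow> \<phi> z = 0" "\<And>z. norm z \<ge> R \<Longrightarrow> partial_deriv 1 \<phi> z = 0"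
    "continuous_on UNIV \<phi>" "\<And>z. (\<phi> has_derivative frechet_derivative \<phi> (at z)) (at z)"
    using test_function_properties[OF \<phi>] by metis
  show "(\<integral>z. partial_deriv 1 \<phi> z *\<^sub>R u z \<partial>lebesgue) = - (\<integral>z. \<phi> z *\<^sub>R g1 z \<partial>lebesgue)"
  proof (rule is_weak_partial_if_lines[OF \<phi> _ meas(1) L2(2)])
    let ?F = "\<lambda>z. partial_deriv 1 \<phi> z *\<^sub>R u z + \<phi> z *\<^sub>R g1 z"
    assume int: "integrable lborel ?F"
    have line: "(\<integral>x. ?F (Complex x y) \<partial>lborel) = 0" if y: "y \<notin> {m, -m}" and i: "integrable lborel (\<lambda>x. ?F (Complex x y))" for y
    proof (rule integral_derivative_compact_support[of "{}" "\<lambda>x. \<phi> (Complex x y) *\<^sub>R u (Complex x y)" _ R])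
      show "continuous_on UNIV (\<lambda>x. \<phi> (Complex x y) *\<^sub>R u (Complex x y))"
        by (intro continuous_on_scaleR continuous_on_compose2[OF R(4)] continuous_on_compose2[OF cont])
          (auto simp: Complex_eq intro!: continuous_intros)
      show "((\<lambda>x. \<phi> (Complex x y) *\<^sub>R u (Complex x y)) has_vector_derivative ?F (Complex x y)) (at x)" for x
      proof -
        have "\<bar>Im (Complex x y)\<bar> \<noteq> m" using y by auto
        from has_vector_derivative_row(1)[OF has_derivative_scaleR[OF R(5) deriv[OF this]]]
        show ?thesis by (simp add: partial_deriv_def add.commute)
      qed
      have "norm (Complex x y) \<ge> R" if "\<bar>x\<bar> \<ge> R" for x
        using abs_Re_le_cmod[of "Complex x y"] that by simp
      then show "\<phi> (Complex x y) *\<^sub>R u (Complex x y) = 0" "?F (Complex x y) = 0" if "\<bar>x\<bar> \<ge> R" for x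
        using R(2,3) that by auto
    qed (use i in auto)
    \<comment> \<open>A row at height m or -m lies entirely in the exceptional set, so no derivative
      is known along it; the outer integral ignores these two rows.\<close>
    have "AE y in lborel. y \<notin> {m, -m}"
      by (intro AE_not_in finite_imp_null_set_lborel) auto
    then have "AE y in lborel. (\<integral>x. ?F (Complex x y) \<partial>lborel) = 0"
      using integral_complex_rows(2)[OF int] by eventually_elim (rule line)
    then show "(\<integral>z. ?F z \<partial>lborel) = 0"
      unfolding integral_complex_rows(1)[OF int] by (rule integral_eq_zero_AE)
  qed simp
qed

lemma weak_partial_i: "is_weak_partial \<i> u g2"
  unfolding is_weak_partial_def
proof (intro allI impI)
  fix \<phi> :: "complex \<Rightarrow> real" assume \<phi>: "test_function \<phi>"
  obtain R where R: "R > 0" "\<And>z. norm z \<ge> R \<Longrightarrow> \<phi> z = 0" "\<And>z. norm z \<ge> R \<Longrightarrow> partial_deriv \<i> \<phi> z = 0"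
    "continuous_on UNIV \<phi>" "\<And>z. (\<phi> has_derivative frechet_derivative \<phi> (at z)) (at z)"
    using test_function_properties[OF \<phi>] by metis
  show "(\<integral>z. partial_deriv \<i> \<phi> z *\<^sub>R u z \<partial>lebesgue) = - (\<integral>z. \<phi> z *\<^sub>R g2 z \<partial>lebesgue)"
  proof (rule is_weak_partial_if_lines[OF \<phi> _ meas(2) L2(3)])
    let ?F = "\<lambda>z. partial_deriv \<i> \<phi> z *\<^sub>R u z + \<phi> z *\<^sub>R g2 z"
    assume int: "integrable lborel ?F"
    have line: "(\<integral>y. ?F (Complex x y) \<partial>lborel) = 0" if i: "integrable lborel (\<lambda>y. ?F (Complex x y))" for x
    \<comment> \<open>Every column crosses the exceptional lines in at most two points, which
      continuity of \<open>u\<close> makes harmless.\<close>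
    proof (rule integral_derivative_compact_support[of "{m, -m}" "\<lambda>y. \<phi> (Complex x y) *\<^sub>R u (Complex x y)" _ R])
      show "continuous_on UNIV (\<lambda>y. \<phi> (Complex x y) *\<^sub>R u (Complex x y))"
        by (intro continuous_on_scaleR continuous_on_compose2[OF R(4)] continuous_on_compose2[OF cont])
          (auto simp: Complex_eq intro!: continuous_intros)
      show "((\<lambda>y. \<phi> (Complex x y) *\<^sub>R u (Complex x y)) has_vector_derivative ?F (Complex x y)) (at y)" if "y \<notin> {m, -m}" for y
      proof -
        have "\<bar>Im (Complex x y)\<bar> \<noteq> m" using that by auto
        from has_vector_derivative_row(2)[OF has_derivative_scaleR[OF R(5) deriv[OF this]]]
        show ?thesis by (simp add: partial_deriv_def add.commute)
      qed
      have "norm (Complex x y) \<ge> R" if "\<bar>y\<bar> \<ge> R" for y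
        using abs_Im_le_cmod[of "Complex x y"] that by simp
      then show "\<phi> (Complex x y) *\<^sub>R u (Complex x y) = 0" "?F (Complex x y) = 0" if "\<bar>y\<bar> \<ge> R" for y
        using R(2,3) that by auto
    qed (use i in auto)
    have "AE x in lborel. (\<integral>y. ?F (Complex x y) \<partial>lborel) = 0"
      using integral_complex_columns(2)[OF int] by eventually_elim (rule line)
    then show "(\<integral>z. ?F z \<partial>lborel) = 0"
      unfolding integral_complex_columns(1)[OF int] by (rule integral_eq_zero_AE)
  qed simp
qed

lemma H1_loc: "u \<in> H1_loc"
  unfolding H1_loc_def using L2 weak_partial_1 weak_partial_i by (auto simp: Basis_complex_def)

end

section \<open>Symmetric second derivatives and cutoffs\<close>

text \<open>A separate predicate, verified by hand for functions of one coordinate and for real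
  components of the harmonic conjugate, and passed on to products. These are exactly the ingredients
  of the cutoffs to which the curl identity is applied.\<close>

definition mixed_symmetric :: "complex set \<Rightarrow> (complex \<Rightarrow> real) \<Rightarrow> bool" where
  "mixed_symmetric S f \<longleftrightarrow> (\<forall>z\<in>S. partial_deriv 1 (partial_deriv \<i> f) z = partial_deriv \<i> (partial_deriv 1 f) z)"

text \<open>Of the four terms in a second derivative of a product, the two outer ones are symmetric
  by hypothesis, and the two mixed ones are exchanged when the directions are swapped.\<close>

lemma mixed_symmetric_mult:
  assumes S: "open S" and f: "smooth_on S f" "mixed_symmetric S f" and g: "smooth_on S g" "mixed_symmetric S g"
  shows "mixed_symmetric S (\<lambda>z. f z * g z)"
  unfolding mixed_symmetric_def
proof
  fix z assume z: "z \<in> S"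
  note sd = smooth_on_partial_deriv[of S f] smooth_on_partial_deriv[of S g]
  have second: "partial_deriv d (partial_deriv e (\<lambda>z. f z * g z)) z =
      partial_deriv d (partial_deriv e f) z * g z + partial_deriv e f z * partial_deriv d g z +
      (partial_deriv d f z * partial_deriv e g z + f z * partial_deriv d (partial_deriv e g) z)"
    if e: "e \<in> Basis" for d e
  proof -
    have eq: "partial_deriv e f w * g w + f w * partial_deriv e g w = partial_deriv e (\<lambda>z. f z * g z) w" if "w \<in> S" for w
      using f(1) g(1) that by (simp add: partial_deriv_mult smooth_on_differentiable)
    have D: "f differentiable (at z)" "g differentiable (at z)" "partial_deriv e f differentiable (at z)" "partial_deriv e g differentiable (at z)"
      using f(1) g(1) sd e z by (auto intro: smooth_on_differentiable)
    have "partial_deriv d (\<lambda>w. partial_deriv e f w * g w + f w * partial_deriv e g w) z = partial_deriv d (partial_deriv e (\<lambda>z. f z * g z)) z"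
      by (rule partial_deriv_cong_open[OF S z]) (use D eq in \<open>auto intro!: differentiable_add differentiable_mult\<close>)
    then show ?thesis
      using D by (simp add: partial_deriv_add partial_deriv_mult differentiable_mult)
  qed
  show "partial_deriv 1 (partial_deriv \<i> (\<lambda>z. f z * g z)) z = partial_deriv \<i> (partial_deriv 1 (\<lambda>z. f z * g z)) z"
    using f(2) g(2) z by (subst (1 2) second) (auto simp: mixed_symmetric_def Basis_complex_def)
qed

lemma partial_deriv_Re_comp:
  assumes "(b has_real_derivative b') (at (Re z))"
  shows "partial_deriv 1 (\<lambda>z. b (Re z)) z = b'" "partial_deriv \<i> (\<lambda>z. b (Re z)) z = (0::real)"
  using partial_deriv_eqI[OF has_derivative_compose[OF bounded_linear_imp_has_derivative[OF bounded_linear_Re] assms[unfolded has_field_derivative_def]]]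
  by auto

lemma partial_deriv_Im_comp:
  assumes "(b has_real_derivative b') (at (Im z))"
  shows "partial_deriv \<i> (\<lambda>z. b (Im z)) z = b'" "partial_deriv 1 (\<lambda>z. b (Im z)) z = (0::real)"
  using partial_deriv_eqI[OF has_derivative_compose[OF bounded_linear_imp_has_derivative[OF bounded_linear_Im] assms[unfolded has_field_derivative_def]]]
  by auto

lemma partial_deriv_const: "partial_deriv e (\<lambda>_. c) z = 0"
  using partial_deriv_eqI[of "\<lambda>_. c" "\<lambda>_. 0" z e] by simp

lemma mixed_symmetric_Re_Im:
  fixes b :: "real \<Rightarrow> real"
  assumes "smooth b"
  shows "mixed_symmetric S (\<lambda>z. b (Re z))" "mixed_symmetric S (\<lambda>z. b (Im z))"
proof -
  obtain b' where b: "smooth b'" "\<And>x. (b has_real_derivative b' x) (at x)"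
    using smooth_real_deriv[OF assms] by blast
  obtain b'' where b': "\<And>x. (b' has_real_derivative b'' x) (at x)"
    using smooth_real_deriv[OF b(1)] by blast
  have "partial_deriv 1 (\<lambda>z. b (Re z)) = (\<lambda>z. b' (Re z))" "partial_deriv \<i> (\<lambda>z. b (Re z)) = (\<lambda>z. 0)"
    "partial_deriv 1 (\<lambda>z. b (Im z)) = (\<lambda>z. 0)" "partial_deriv \<i> (\<lambda>z. b (Im z)) = (\<lambda>z. b' (Im z))"
    by (auto intro!: ext partial_deriv_Re_comp partial_deriv_Im_comp b)
  then show "mixed_symmetric S (\<lambda>z. b (Re z))" "mixed_symmetric S (\<lambda>z. b (Im z))"
    by (auto simp: mixed_symmetric_def partial_deriv_const partial_deriv_Re_comp[OF b'] partial_deriv_Im_comp[OF b'])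
qed

text \<open>A gradient has no curl, tested against \<open>\<theta>\<close>.\<close>

lemma integral_curl_eq_0:
  fixes w w1 w2 :: "complex \<Rightarrow> complex"
  assumes w: "is_weak_partial 1 w w1" "is_weak_partial \<i> w w2" "L2_loc w1" "L2_loc w2"
    and \<theta>: "test_function \<theta>" "mixed_symmetric UNIV \<theta>"
  shows "(\<integral>z. partial_deriv \<i> \<theta> z *\<^sub>R w1 z - partial_deriv 1 \<theta> z *\<^sub>R w2 z \<partial>lebesgue) = 0"
proof -
  have t: "test_function (partial_deriv \<i> \<theta>)" "test_function (partial_deriv 1 \<theta>)"
    using \<theta>(1) by (auto intro!: test_function_partial_deriv)
  have "(\<integral>z. partial_deriv \<i> \<theta> z *\<^sub>R w1 z - partial_deriv 1 \<theta> z *\<^sub>R w2 z \<partial>lebesgue)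
    = (\<integral>z. partial_deriv \<i> \<theta> z *\<^sub>R w1 z \<partial>lebesgue) - (\<integral>z. partial_deriv 1 \<theta> z *\<^sub>R w2 z \<partial>lebesgue)"
    by (intro Bochner_Integration.integral_diff integrable_test_function t w)
  also have "\<dots> = - (\<integral>z. partial_deriv 1 (partial_deriv \<i> \<theta>) z *\<^sub>R w z \<partial>lebesgue) + (\<integral>z. partial_deriv \<i> (partial_deriv 1 \<theta>) z *\<^sub>R w z \<partial>lebesgue)"
    using w(1,2) t by (simp add: is_weak_partial_def)
  also have "\<dots> = 0" using \<theta>(2) by (simp add: mixed_symmetric_def)
  finally show ?thesis .
qed

text \<open>The plane is the union of the open set \<open>U\<close>, where both factors are smooth,
  and the complement of \<open>K\<close>, where the product is 0. Hence \<open>\<gamma>\<close> may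
  be arbitrary off \<open>U\<close>.\<close>

lemma test_function_cutoff:
  fixes P \<gamma> :: "complex \<Rightarrow> real"
  assumes "smooth P" "compact K" "\<And>z. z \<notin> K \<Longrightarrow> P z = 0" "K \<subseteq> U" "open U" "smooth_on U \<gamma>"
  shows "test_function (\<lambda>z. P z * \<gamma> z)"
proof (rule test_functionI[OF _ assms(2)])
  have "smooth_on U (\<lambda>z. P z * \<gamma> z)"
    using assms smooth_on_subset[of UNIV P U] by (intro smooth_on_mult) (auto simp: smooth_iff_smooth_on)
  moreover have "open (- K)" using assms(2) by (simp add: compact_imp_closed open_Compl)
  then have "smooth_on (- K) (\<lambda>z. P z * \<gamma> z)"
    using assms(3) by (intro smooth_on_cong[OF _ smooth_on_const[of _ 0]]) auto
  ultimately have "smooth_on (U \<union> - K) (\<lambda>z. P z * \<gamma> z)" by (rule smooth_on_Un)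
  moreover have "U \<union> - K = UNIV" using assms(4) by auto
  ultimately show "smooth (\<lambda>z. P z * \<gamma> z)" by (simp add: smooth_iff_smooth_on)
qed (use assms(3) in auto)

text \<open>Inside \<open>U\<close> the symmetry of products applies; off \<open>K\<close> every
  derivative of the product is 0.\<close>

lemma mixed_symmetric_cutoff:
  fixes P \<gamma> :: "complex \<Rightarrow> real"
  assumes "smooth P" "compact K" "\<And>z. z \<notin> K \<Longrightarrow> P z = 0" "K \<subseteq> U" "open U" "smooth_on U \<gamma>"
    "mixed_symmetric UNIV P" "mixed_symmetric U \<gamma>"
  shows "mixed_symmetric UNIV (\<lambda>z. P z * \<gamma> z)"
proof -
  have "mixed_symmetric U (\<lambda>z. P z * \<gamma> z)"
    using assms smooth_on_subset[of UNIV P U]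
    by (intro mixed_symmetric_mult) (auto simp: smooth_iff_smooth_on mixed_symmetric_def)
  moreover have "partial_deriv d (partial_deriv e (\<lambda>z. P z * \<gamma> z)) z = 0" if "z \<notin> K" for z d e
  proof -
    have o: "open (- K)" using assms(2) by (simp add: compact_imp_closed open_Compl)
    have "partial_deriv e (\<lambda>z. P z * \<gamma> z) w = 0" if "w \<in> - K" for w
      by (rule partial_deriv_eq_0_open[OF o that, of _ 0]) (simp add: assms(3))
    then show ?thesis using that by (intro partial_deriv_eq_0_open[OF o, of _ "partial_deriv e (\<lambda>z. P z * \<gamma> z)" 0]) auto
  qed
  ultimately show ?thesis using assms(4) unfolding mixed_symmetric_def by (metis UNIV_I subsetD)
qed

section \<open>Functions vanishing off the strip\<close>

lemma open_strip: "open (strip l)"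
proof -
  have "strip l = {z. - l / 2 < Im z} \<inter> {z. Im z < l / 2}" by (auto simp: strip_def)
  then show ?thesis by (auto intro!: open_Int open_Collect_less continuous_intros)
qed

lemma strip_sets [measurable]: "strip l \<in> sets borel"
  using open_strip by auto

lemma strip_sets_lebesgue [measurable]: "strip l \<in> sets lebesgue"
  using strip_sets by auto

lemma AE_Im_neq: "AE z in lebesgue. Im z \<noteq> c"
proof -
  have "{z::complex. \<i> \<bullet> z = c} \<in> null_sets lebesgue"
    using negligible_hyperplane[of \<i> c] by (simp add: negligible_iff_null_sets)
  from AE_not_in[OF this] show ?thesis by eventually_elim simp
qed

text \<open>The derivative of a bump supported in a box off the strip vanishes on the strip, while
  \<open>w\<close> vanishes off it, so \<open>g\<close> integrates to 0 against the bump. Two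
  families of growing open boxes cover everything above and below the strip except the boundary
  lines, which are null.\<close>

lemma weak_partial_eq_0_off_strip:
  fixes w g :: "complex \<Rightarrow> complex"
  assumes g: "L2_loc g" "is_weak_partial e w g" "e \<in> Basis" and w: "AE z in lebesgue. z \<notin> strip l \<longrightarrow> w z = 0"
  shows "AE z in lebesgue. z \<notin> strip l \<longrightarrow> g z = 0"
proof -
  have box: "AE z in lebesgue. z \<in> box a b \<longrightarrow> g z = 0" if "box a b \<inter> strip l = {}" for a b
  proof (rule AE_eq_0_on_box[OF g(1)])
    fix p q n assume sub: "box p q \<subseteq> box a b"
    have "partial_deriv e (box_bump p q n) z = 0" if "z \<in> strip l" for z
      by (rule partial_deriv_eq_0_open[OF open_strip that, of _ 0])
        (use sub \<open>box a b \<inter> strip l = {}\<close> in \<open>auto intro!: box_bump_eq_0\<close>)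
    then have "AE z in lebesgue. partial_deriv e (box_bump p q n) z *\<^sub>R w z = 0"
      using w by (auto elim!: eventually_mono)
    then have "(\<integral>z. partial_deriv e (box_bump p q n) z *\<^sub>R w z \<partial>lebesgue) = 0"
      by (rule integral_eq_zero_AE)
    then show "(\<integral>z. box_bump p q n z *\<^sub>R g z \<partial>lebesgue) = 0"
      using g(2) test_function_box_bump[of p q n] unfolding is_weak_partial_def by simp
  qed
  have "AE z in lebesgue. \<forall>n::nat. z \<in> box (Complex (- real n) (l / 2)) (Complex (real n) (real n)) \<longrightarrow> g z = 0"
    unfolding AE_all_countable by (intro allI box) (auto simp: in_box_complex_iff strip_def)
  moreover have "AE z in lebesgue. \<forall>n::nat. z \<in> box (Complex (- real n) (- real n)) (Complex (real n) (- l / 2)) \<longrightarrow> g z = 0"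
    unfolding AE_all_countable by (intro allI box) (auto simp: in_box_complex_iff strip_def)
  ultimately show ?thesis
    using AE_Im_neq[of "l / 2"] AE_Im_neq[of "- l / 2"]
  proof eventually_elim
    case (elim z)
    obtain n :: nat where n: "norm z < real n" using reals_Archimedean2 by blast
    then have "\<bar>Re z\<bar> < real n" "\<bar>Im z\<bar> < real n"
      using abs_Re_le_cmod[of z] abs_Im_le_cmod[of z] by linarith+
    then show ?case using elim by (auto simp: in_box_complex_iff strip_def dest!: spec[of _ n])
  qed
qed

text \<open>Provides uniqueness: a competitor with the same gradient differs from the map by a
  function that is constant along verticals and vanishes outside the strip. In weak form,
  \<open>w\<close> is tested with bumps, each of which is written on the strip as the vertical
  derivative of another test function.\<close>

lemma eq_0_if_vertical_derivative_0:
  fixes w g :: "complex \<Rightarrow> complex"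
  assumes l: "l > 0" and w: "L2_loc w" "is_weak_partial \<i> w g"
    and g: "AE z in lebesgue. g z = 0" and off: "AE z in lebesgue. z \<notin> strip l \<longrightarrow> w z = 0"
  shows "AE z in lebesgue. w z = 0"
proof -
  obtain \<psi> :: "real \<Rightarrow> real" where \<psi>: "smooth \<psi>" "\<And>t. \<bar>t\<bar> \<le> l \<Longrightarrow> \<psi> t = 1" "\<And>t. \<bar>t\<bar> \<ge> 2 * l \<Longrightarrow> \<psi> t = 0"
    using smooth_plateau[of l "2 * l"] l by auto
  have zero: "(\<integral>z. box_bump p q n z *\<^sub>R w z \<partial>lebesgue) = 0" for p q n
  proof -
    let ?a = "interval_bump (Re p) (Re q) n" and ?b = "interval_bump (Im p) (Im q) n"
    obtain B where B: "smooth B" "\<And>x. (B has_real_derivative ?b x) (at x)"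
      using smooth_antiderivative[OF smooth_interval_bump] by blast
    \<comment> \<open>The antiderivative \<open>B\<close> need not have compact support; the plateau
      \<open>\<psi>\<close> supplies it, and the derivative of \<open>\<psi>\<close> is felt only
      off the strip, where \<open>w\<close> is 0.\<close>
    define \<theta> where "\<theta> = (\<lambda>z. ?a (Re z) * (B (Im z) * \<psi> (Im z)))"
    have t: "test_function \<theta>"
    proof (rule test_functionI[where K = "cbox (Complex (Re p) (- 2 * l)) (Complex (Re q) (2 * l))"])
      show "smooth \<theta>" unfolding \<theta>_def
        by (intro smooth_mult smooth_Re_comp smooth_Im_comp smooth_interval_bump B \<psi>)
      show "\<theta> z = 0" if "z \<notin> cbox (Complex (Re p) (- 2 * l)) (Complex (Re q) (2 * l))" for z
      proof (cases "\<bar>Im z\<bar> \<ge> 2 * l")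
        case False
        then have "Re z \<notin> {Re p<..<Re q}" using that by (auto simp: in_cbox_complex_iff)
        then show ?thesis by (simp add: \<theta>_def interval_bump_eq_0)
      qed (simp add: \<theta>_def \<psi>)
    qed simp
    have d: "partial_deriv \<i> \<theta> z = box_bump p q n z" if "z \<in> strip l" for z
    proof -
      have "partial_deriv \<i> (\<lambda>z. ?a (Re z) * B (Im z)) z = partial_deriv \<i> \<theta> z"
      proof (rule partial_deriv_cong_open[OF open_strip that])
        show "?a (Re y) * B (Im y) = \<theta> y" if "y \<in> strip l" for y
        proof -
          have "\<bar>Im y\<bar> \<le> l" using that l unfolding strip_def mem_Collect_eq greaterThanLessThan_iff by linarith
          then show ?thesis by (simp add: \<theta>_def \<psi>)
        qed
        have "smooth (\<lambda>z. ?a (Re z) * B (Im z))"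
          by (intro smooth_mult smooth_Re_comp smooth_Im_comp smooth_interval_bump B)
        then show "(\<lambda>z. ?a (Re z) * B (Im z)) differentiable at z"
          by (simp add: smooth_iff_smooth_on smooth_on_differentiable)
      qed
      moreover have "partial_deriv \<i> (\<lambda>z. ?a (Re z) * B (Im z)) z = box_bump p q n z"
      proof -
        have D: "(\<lambda>z. ?a (Re z)) differentiable at z" "(\<lambda>z. B (Im z)) differentiable at z"
          using smooth_Re_comp[OF smooth_interval_bump[of "Re p" "Re q" n]] smooth_Im_comp[OF B(1)]
          by (simp_all add: smooth_iff_smooth_on smooth_on_differentiable)
        obtain a' where a': "\<And>x. (?a has_real_derivative a' x) (at x)"
          using smooth_real_deriv[OF smooth_interval_bump] by blast
        then show ?thesis
          using partial_deriv_mult[OF D, of \<i>] partial_deriv_Re_comp(2)[OF a', of z] partial_deriv_Im_comp(1)[OF B(2)]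
          by (simp add: box_bump_def)
      qed
      ultimately show ?thesis by simp
    qed
    have "(\<integral>z. box_bump p q n z *\<^sub>R w z \<partial>lebesgue) = (\<integral>z. partial_deriv \<i> \<theta> z *\<^sub>R w z \<partial>lebesgue)"
    proof (rule integral_cong_AE)
      show "AE z in lebesgue. box_bump p q n z *\<^sub>R w z = partial_deriv \<i> \<theta> z *\<^sub>R w z"
        using off by eventually_elim (metis d scaleR_eq_0_iff)
    qed (auto intro!: borel_measurable_integrable integrable_test_function w test_function_box_bump test_function_partial_deriv t)
    also have "\<dots> = - (\<integral>z. \<theta> z *\<^sub>R g z \<partial>lebesgue)"
      using w(2) t by (simp add: is_weak_partial_def)
    also have "(\<integral>z. \<theta> z *\<^sub>R g z \<partial>lebesgue) = 0"
      using g by (intro integral_eq_zero_AE) (auto elim!: eventually_mono)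
    finally show ?thesis by simp
  qed
  have "AE z in lebesgue. \<forall>n. z \<in> box (- real n *\<^sub>R One) (real n *\<^sub>R One) \<longrightarrow> w z = 0"
    unfolding AE_all_countable by (intro allI AE_eq_0_on_box w zero)
  then show ?thesis by eventually_elim (use box_cover in blast)
qed

section \<open>Orthogonality of a gradient to a rotated gradient\<close>

text \<open>The weight \<open>c\<close> is free: it is 1 for the integrability of a product of
  square integrable functions, and n + 1 to balance the two parts of the cutoff error.\<close>

lemma young_norm:
  fixes a b c :: real
  assumes "c > 0"
  shows "\<bar>a * b\<bar> \<le> b\<^sup>2 / c + c * a\<^sup>2"
proof -
  have "0 \<le> (\<bar>b\<bar> - c * \<bar>a\<bar>)\<^sup>2" by simp
  then have "2 * c * \<bar>a * b\<bar> \<le> b\<^sup>2 + c\<^sup>2 * a\<^sup>2"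
    by (simp add: power2_eq_square algebra_simps abs_mult)
  then have "c * \<bar>a * b\<bar> \<le> b\<^sup>2 + c\<^sup>2 * a\<^sup>2"
    using assms mult_nonneg_nonneg[of c "\<bar>a * b\<bar>"] by linarith
  then show ?thesis using assms by (simp add: field_simps power2_eq_square)
qed

lemma integrable_scaleR_square:
  fixes f :: "'a \<Rightarrow> real" and w :: "'a \<Rightarrow> 'b::euclidean_space"
  assumes [measurable]: "f \<in> borel_measurable M" "w \<in> borel_measurable M"
    and "integrable M (\<lambda>x. (f x)\<^sup>2)" "integrable M (\<lambda>x. (norm (w x))\<^sup>2)"
  shows "integrable M (\<lambda>x. f x *\<^sub>R w x)"
proof (rule Bochner_Integration.integrable_bound)
  show "integrable M (\<lambda>x. (norm (w x))\<^sup>2 + (f x)\<^sup>2)" using assms by auto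
  show "AE x in M. norm (f x *\<^sub>R w x) \<le> norm ((norm (w x))\<^sup>2 + (f x)\<^sup>2)"
    using young_norm[of 1 "f _" "norm (w _)"] by (intro AE_I2) (auto simp: abs_mult)
qed measurable

text \<open>Cut \<open>\<gamma>\<close> off to a test function and apply the curl identity. The
  vertical cutoff costs nothing, as it is 1 on the strip and \<open>w1\<close>, \<open>w2\<close>
  vanish elsewhere. The horizontal cutoff at scale \<open>N n\<close> leaves the error
  \<open>F2\<close>, which is controlled by the bound on \<open>\<gamma>\<close> and the square
  integrability of \<open>w2\<close>.\<close>

lemma gradient_orthogonal_rotated_gradient:
  fixes w w1 w2 :: "complex \<Rightarrow> complex" and \<gamma> :: "complex \<Rightarrow> real"
  assumes l: "l > 0" "l / 2 < d"
    and w: "is_weak_partial 1 w w1" "is_weak_partial \<i> w w2" "L2_loc w1" "L2_loc w2"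
    and wi: "integrable lebesgue (\<lambda>z. (norm (w1 z))\<^sup>2)" "integrable lebesgue (\<lambda>z. (norm (w2 z))\<^sup>2)"
    and off: "AE z in lebesgue. z \<notin> strip l \<longrightarrow> w1 z = 0" "AE z in lebesgue. z \<notin> strip l \<longrightarrow> w2 z = 0"
    and \<gamma>: "smooth_on {z. \<bar>Im z\<bar> < d} \<gamma>" "mixed_symmetric {z. \<bar>Im z\<bar> < d} \<gamma>"
    and bdd: "\<And>z. z \<in> strip l \<Longrightarrow> \<bar>\<gamma> z\<bar> \<le> B"
    and \<gamma>i: "\<And>e. e \<in> Basis \<Longrightarrow> integrable lebesgue (\<lambda>z. (indicator (strip l) z * partial_deriv e \<gamma> z)\<^sup>2)"
  shows "(\<integral>z. indicator (strip l) z *\<^sub>R (partial_deriv \<i> \<gamma> z *\<^sub>R w1 z - partial_deriv 1 \<gamma> z *\<^sub>R w2 z) \<partial>lebesgue) = 0"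
    (is "?I = 0")
proof -
  let ?X = "\<lambda>z. indicator (strip l) z *\<^sub>R (partial_deriv \<i> \<gamma> z *\<^sub>R w1 z - partial_deriv 1 \<gamma> z *\<^sub>R w2 z)"
  define U where "U = {z. \<bar>Im z\<bar> < d}"
  have U: "open U" unfolding U_def by (intro open_Collect_less continuous_intros)
  have strip_U: "strip l \<subseteq> U" using l by (auto simp: strip_def U_def)
  have [measurable]: "w1 \<in> borel_measurable lebesgue" "w2 \<in> borel_measurable lebesgue"
    using w by (auto simp: L2_loc_def)
  have m\<gamma>: "(\<lambda>z. indicator (strip l) z * f z) \<in> borel_measurable lebesgue" if "smooth_on U f" for f :: "complex \<Rightarrow> real"
  proof -
    have "continuous_on (strip l) f"
      using that strip_U by (meson continuous_at_imp_continuous_on differentiable_imp_continuous_within smooth_on_differentiable subsetD)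
    then show ?thesis
      using borel_measurable_continuous_on_indicator[OF strip_sets, of l f] by (simp add: measurable_completion)
  qed
  have m1 [measurable]: "(\<lambda>z. indicator (strip l) z * partial_deriv e \<gamma> z) \<in> borel_measurable lebesgue" if "e \<in> Basis" for e
    using m\<gamma> smooth_on_partial_deriv[OF \<gamma>(1) that] by (simp add: U_def)
  have m0 [measurable]: "(\<lambda>z. indicator (strip l) z * \<gamma> z) \<in> borel_measurable lebesgue"
    using m\<gamma> \<gamma>(1) by (simp add: U_def)
  obtain p :: "real \<Rightarrow> real" where p: "smooth p" "\<And>t. \<bar>t\<bar> \<le> 1 \<Longrightarrow> p t = 1" "\<And>t. \<bar>t\<bar> \<ge> 2 \<Longrightarrow> p t = 0"
    using smooth_plateau[of 1 2] by auto
  obtain p' where p': "smooth p'" "\<And>x. (p has_real_derivative p' x) (at x)"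
    using smooth_real_deriv[OF p(1)] by blast
  \<comment> \<open>Two heights strictly between l/2 and \<open>d\<close>: the vertical cutoff is 1
    up to \<open>d''\<close>, past the strip, and 0 from \<open>d'\<close> on, so its support stays
    inside the region where \<open>\<gamma>\<close> is smooth.\<close>
  define d' where "d' = (l / 2 + d) / 2"
  define d'' where "d'' = (l / 2 + d') / 2"
  have d': "l / 2 < d''" "d'' < d'" "d' < d" using l unfolding d'_def d''_def by (simp_all add: field_simps)
  obtain \<psi> :: "real \<Rightarrow> real" where \<psi>: "smooth \<psi>" "\<And>t. \<bar>t\<bar> \<le> d'' \<Longrightarrow> \<psi> t = 1" "\<And>t. \<bar>t\<bar> \<ge> d' \<Longrightarrow> \<psi> t = 0"
    using smooth_plateau[OF d'(2)] by auto
  have p0: "p' t = 0" if "\<bar>t\<bar> > 2" for t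
  proof -
    have "(p has_real_derivative 0) (at t)"
      by (rule has_field_derivative_transform_within_open[of "\<lambda>_. 0" _ _ "{t. \<bar>t\<bar> > 2}"])
        (use that p(3) in \<open>auto intro!: open_Collect_less continuous_intros\<close>)
    then show ?thesis using p'(2) DERIV_unique by blast
  qed
  obtain M where M: "M > 0" "\<And>t. norm (p' t) \<le> M"
    using continuous_compact_support_bounded[of p' "{-2..2}"] p0 smooth_imp_continuous_on[OF p'(1)]
    by (metis abs_le_iff atLeastAtMost_iff compact_Icc linorder_not_less minus_le_iff)
  obtain M0 where M0: "M0 > 0" "\<And>t. norm (p t) \<le> M0"
    using continuous_compact_support_bounded[of p "{-2..2}"] p(3) smooth_imp_continuous_on[OF p(1)]
    by (metis abs_le_iff atLeastAtMost_iff compact_Icc linorder_linear minus_le_iff)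
  have pM0: "norm (p t *\<^sub>R X) \<le> norm (M0 *\<^sub>R X)" for t and X :: complex
    using M0(2)[of t] M0(1) by (auto simp del: scaleR_conv_of_real intro!: mult_right_mono)
  \<comment> \<open>On a rectangle of area 4 N l the error is at most M B / N times |w2|, and it is
    0 elsewhere. Young's inequality with weight n + 1 bounds its integral by E / (n + 1) + (n + 1)
    (M B / N)^2 4 N l, where E is the integral of |w2|^2; the choice N = (n + 1)^2 makes both terms
    of order 1 / (n + 1).\<close>
  define N where "N = (\<lambda>n. (real (Suc n))\<^sup>2)"
  have N: "N n > 0" for n by (simp add: N_def)
  define F1 where "F1 = (\<lambda>n z. p (Re z / N n) *\<^sub>R (?X z))"
  define F2 where "F2 = (\<lambda>n z. (p' (Re z / N n) / N n * (indicator (strip l) z * \<gamma> z)) *\<^sub>R w2 z)"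
  have int0: "integrable lebesgue (\<lambda>z. ?X z)"
  proof -
    have "integrable lebesgue (\<lambda>z. (indicator (strip l) z * partial_deriv \<i> \<gamma> z) *\<^sub>R w1 z - (indicator (strip l) z * partial_deriv 1 \<gamma> z) *\<^sub>R w2 z)"
      by (intro Bochner_Integration.integrable_diff integrable_scaleR_square m1 \<gamma>i wi) auto
    then show ?thesis by (simp add: scaleR_diff_right)
  qed
  have mp [measurable]: "(\<lambda>z. p (Re z / N n)) \<in> borel_measurable lebesgue" "(\<lambda>z. p' (Re z / N n)) \<in> borel_measurable lebesgue" for n
    using N[of n] by (auto intro!: continuous_imp_measurable_lebesgue
        continuous_on_compose2[OF smooth_imp_continuous_on[OF p(1), of UNIV]] continuous_on_compose2[OF smooth_imp_continuous_on[OF p'(1), of UNIV]]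
        continuous_intros)
  have F1i: "integrable lebesgue (F1 n)" for n
    unfolding F1_def
  proof (rule Bochner_Integration.integrable_bound[OF integrable_scaleR_right[OF int0, of M0]])
    show "AE x in lebesgue. norm (p (Re x / N n) *\<^sub>R (?X x))
      \<le> norm (M0 *\<^sub>R (?X x))"
      by (intro AE_I2 pM0)
  qed (intro borel_measurable_scaleR mp borel_measurable_integrable[OF int0])
  define h where "h = (\<lambda>n z. (norm (w2 z))\<^sup>2 / real (Suc n) + real (Suc n) * (M * B / N n)\<^sup>2 * indicator (cbox (Complex (- 2 * N n) (- l / 2)) (Complex (2 * N n) (l / 2))) z)"
  have hi: "integrable lebesgue (h n)" for n
    unfolding h_def using wi(2) by (intro Bochner_Integration.integrable_add integrable_mult_right integrable_divide_zero integrable_real_indicator)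
      (use emeasure_lborel_cbox_finite in \<open>auto simp: infinity_ennreal_def\<close>)
  have F2h: "norm (F2 n z) \<le> h n z" for n z
  proof (cases "z \<in> strip l \<and> \<bar>Re z / N n\<bar> \<le> 2")
    case True
    then have c: "z \<in> cbox (Complex (- 2 * N n) (- l / 2)) (Complex (2 * N n) (l / 2))"
      using N[of n] by (auto simp: in_cbox_complex_iff strip_def abs_le_iff field_simps)
    have *: "\<bar>p' (Re z / N n) / N n * \<gamma> z\<bar> \<le> M / N n * B"
      unfolding abs_mult using M(2)[of "Re z / N n"] M(1) N[of n] bdd[of z] True
      by (intro mult_mono) (auto simp: abs_divide divide_right_mono)
    have "norm (F2 n z) = \<bar>p' (Re z / N n) / N n * \<gamma> z\<bar> * norm (w2 z)"
      using True by (simp add: F2_def)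
    also have "\<dots> \<le> M / N n * B * norm (w2 z)" by (rule mult_right_mono[OF *]) simp
    also have "\<dots> = (M * B / N n) * norm (w2 z)" by simp
    also have "\<dots> \<le> (norm (w2 z))\<^sup>2 / real (Suc n) + real (Suc n) * (M * B / N n)\<^sup>2"
      by (rule order_trans[OF abs_ge_self young_norm]) simp
    finally show ?thesis using c by (simp add: h_def)
  next
    case False
    then have "F2 n z = 0" using p0[of "Re z / N n"] by (auto simp: F2_def not_le)
    then show ?thesis by (auto simp: h_def)
  qed
  have F2i: "integrable lebesgue (F2 n)" for n
  proof (rule Bochner_Integration.integrable_bound[OF hi[of n]])
    show "F2 n \<in> borel_measurable lebesgue" unfolding F2_def by measurable
    show "AE x in lebesgue. norm (F2 n x) \<le> norm (h n x)"
      by (intro AE_I2, unfold real_norm_def) (rule order_trans[OF F2h abs_ge_self])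
  qed
  have eq: "(\<integral>z. F1 n z \<partial>lebesgue) = (\<integral>z. F2 n z \<partial>lebesgue)" for n
  proof -
    define P where "P = (\<lambda>z. p (Re z / N n) * \<psi> (Im z))"
    define K where "K = cbox (Complex (- 2 * N n) (- d')) (Complex (2 * N n) d')"
    have "smooth (\<lambda>t. p (1 / N n * t + 0))" by (rule smooth_affine_comp[OF p(1)])
    then have pN: "smooth (\<lambda>t. p (t / N n))" by simp
    have P: "smooth P" "compact K" "K \<subseteq> U" "mixed_symmetric UNIV P"
    proof -
      show "smooth P" unfolding P_def
        by (rule smooth_mult[OF smooth_Re_comp[OF pN] smooth_Im_comp[OF \<psi>(1)]])
      show "compact K" by (simp add: K_def)
      show "K \<subseteq> U" using d' by (auto simp: K_def U_def in_cbox_complex_iff)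
      show "mixed_symmetric UNIV P" unfolding P_def
        by (rule mixed_symmetric_mult[OF open_UNIV _ mixed_symmetric_Re_Im(1)[OF pN] _ mixed_symmetric_Re_Im(2)[OF \<psi>(1)]])
          (simp_all only: smooth_iff_smooth_on[symmetric] smooth_Re_comp[OF pN] smooth_Im_comp[OF \<psi>(1)])
    qed
    have P0: "P z = 0" if "z \<notin> K" for z
    proof (cases "\<bar>Im z\<bar> \<ge> d'")
      case False
      then have "\<bar>Re z\<bar> > 2 * N n" using that by (auto simp: K_def in_cbox_complex_iff)
      then have "\<bar>Re z / N n\<bar> \<ge> 2" using N[of n] by (simp add: abs_divide field_simps)
      then show ?thesis using p(3) by (simp add: P_def)
    qed (simp add: P_def \<psi>)
    define \<theta> where "\<theta> = (\<lambda>z. P z * \<gamma> z)"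
    have t: "test_function \<theta>" unfolding \<theta>_def
      by (rule test_function_cutoff[OF P(1,2) P0 P(3) U]) (use \<gamma> in \<open>auto simp: U_def\<close>)
    have ms: "mixed_symmetric UNIV \<theta>" unfolding \<theta>_def
      by (rule mixed_symmetric_cutoff[OF P(1,2) P0 P(3) U _ P(4)]) (use \<gamma> in \<open>auto simp: U_def\<close>)
    have D: "partial_deriv 1 \<theta> z = p' (Re z / N n) / N n * \<gamma> z + p (Re z / N n) * partial_deriv 1 \<gamma> z"
      "partial_deriv \<i> \<theta> z = p (Re z / N n) * partial_deriv \<i> \<gamma> z" if z: "z \<in> strip l" for z
    proof -
      let ?Q = "\<lambda>z. p (Re z / N n)"
      have zU: "z \<in> U" using z strip_U by auto
      have dQ: "?Q differentiable at z"
        using smooth_Re_comp[OF pN] by (simp add: smooth_iff_smooth_on smooth_on_differentiable)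
      have d\<gamma>: "\<gamma> differentiable at z" using \<gamma>(1) zU by (auto simp: U_def intro: smooth_on_differentiable)
      have eq: "partial_deriv e (\<lambda>z. ?Q z * \<gamma> z) z = partial_deriv e \<theta> z" for e
      proof (rule partial_deriv_cong_open[OF open_strip z])
        show "?Q y * \<gamma> y = \<theta> y" if "y \<in> strip l" for y
        proof -
          have "\<bar>Im y\<bar> \<le> d''" using that d'(1) unfolding strip_def mem_Collect_eq greaterThanLessThan_iff by linarith
          then show ?thesis by (simp add: \<theta>_def P_def \<psi>)
        qed
      qed (use dQ d\<gamma> in simp)
      have "((\<lambda>t. p (t / N n)) has_real_derivative p' (Re z / N n) / N n) (at (Re z))"
        using DERIV_chain2[OF p'(2), of "\<lambda>t. t / N n" "1 / N n"] DERIV_cdivide[OF DERIV_ident, of "N n"] by simp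
      note R = partial_deriv_Re_comp[OF this]
      show "partial_deriv 1 \<theta> z = p' (Re z / N n) / N n * \<gamma> z + p (Re z / N n) * partial_deriv 1 \<gamma> z"
        "partial_deriv \<i> \<theta> z = p (Re z / N n) * partial_deriv \<i> \<gamma> z"
        unfolding eq[symmetric] partial_deriv_mult[OF dQ d\<gamma>] R by simp_all
    qed
    have "(\<integral>z. F1 n z \<partial>lebesgue) - (\<integral>z. F2 n z \<partial>lebesgue) = (\<integral>z. F1 n z - F2 n z \<partial>lebesgue)"
      using F1i F2i by (simp add: Bochner_Integration.integral_diff)
    also have "\<dots> = (\<integral>z. partial_deriv \<i> \<theta> z *\<^sub>R w1 z - partial_deriv 1 \<theta> z *\<^sub>R w2 z \<partial>lebesgue)"
    proof (rule integral_cong_AE)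
      show "AE z in lebesgue. F1 n z - F2 n z = partial_deriv \<i> \<theta> z *\<^sub>R w1 z - partial_deriv 1 \<theta> z *\<^sub>R w2 z"
        using off
      proof eventually_elim
        case (elim z)
        then show ?case
          by (cases "z \<in> strip l") (simp_all add: F1_def F2_def D algebra_simps)
      qed
      show "(\<lambda>z. F1 n z - F2 n z) \<in> borel_measurable lebesgue"
        by (intro borel_measurable_diff borel_measurable_integrable F1i F2i)
      show "(\<lambda>z. partial_deriv \<i> \<theta> z *\<^sub>R w1 z - partial_deriv 1 \<theta> z *\<^sub>R w2 z) \<in> borel_measurable lebesgue"
        by (intro borel_measurable_diff borel_measurable_integrable integrable_test_function w test_function_partial_deriv t) auto
    qed
    also have "\<dots> = 0" by (rule integral_curl_eq_0[OF w t ms])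
    finally show ?thesis by simp
  qed
  have lim1: "(\<lambda>n. \<integral>z. F1 n z \<partial>lebesgue) \<longlonglongrightarrow> ?I"
  proof (rule integral_dominated_convergence)
    show "integrable lebesgue (\<lambda>z. norm (M0 *\<^sub>R (?X z)))"
      by (intro integrable_norm integrable_scaleR_right int0)
    show "AE z in lebesgue. norm (F1 n z) \<le> norm (M0 *\<^sub>R (?X z))" for n
      unfolding F1_def by (intro AE_I2 pM0)
    show "AE z in lebesgue. (\<lambda>n. F1 n z) \<longlonglongrightarrow> ?X z"
    proof (intro AE_I2 tendsto_eventually)
      fix z
      obtain n0 :: nat where n0: "\<bar>Re z\<bar> < real n0" using reals_Archimedean2 by blast
      have "p (Re z / N n) = 1" if "n \<ge> n0" for n
      proof -
        have "\<bar>Re z\<bar> \<le> real (Suc n)" using n0 that by simp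
        also have "\<dots> \<le> N n" unfolding N_def by (simp add: power2_eq_square)
        finally have "\<bar>Re z / N n\<bar> \<le> 1" using N[of n] by (simp add: abs_divide)
        then show ?thesis using p(2) by simp
      qed
      then show "\<forall>\<^sub>F n in sequentially. F1 n z = ?X z"
        unfolding eventually_sequentially F1_def by (intro exI[of _ n0]) simp
    qed
  qed (use F1i int0 in \<open>auto intro: borel_measurable_integrable\<close>)
  let ?E = "\<integral>z. (norm (w2 z))\<^sup>2 \<partial>lebesgue"
  have h_int: "(\<integral>z. h n z \<partial>lebesgue) = (?E + 4 * l * (M * B)\<^sup>2) / real (Suc n)" for n
  proof -
    have "measure lborel (cbox (Complex (- 2 * N n) (- l / 2)) (Complex (2 * N n) (l / 2))) = 4 * N n * l"
      using l N[of n] by (simp add: content_cbox_if box_eq_empty Basis_complex_def)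
    then have "(\<integral>z. h n z \<partial>lebesgue) = ?E / real (Suc n) + real (Suc n) * (M * B / N n)\<^sup>2 * (4 * N n * l)"
      unfolding h_def using wi(2) emeasure_lborel_cbox_finite
      by (subst Bochner_Integration.integral_add) (auto simp: infinity_ennreal_def intro!: integrable_mult_right integrable_real_indicator)
    also have "real (Suc n) * (M * B / N n)\<^sup>2 * (4 * N n * l) = 4 * l * (M * B)\<^sup>2 / real (Suc n)"
      using N[of n] by (simp add: N_def field_simps power2_eq_square del: of_nat_Suc)
    finally show ?thesis by (simp add: add_divide_distrib)
  qed
  have F2b: "norm (\<integral>z. F2 n z \<partial>lebesgue) \<le> (?E + 4 * l * (M * B)\<^sup>2) / real (Suc n)" for n
  proof -
    have "norm (\<integral>z. F2 n z \<partial>lebesgue) \<le> (\<integral>z. norm (F2 n z) \<partial>lebesgue)" by (rule integral_norm_bound)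
    also have "\<dots> \<le> (\<integral>z. h n z \<partial>lebesgue)"
      by (rule integral_mono[OF integrable_norm[OF F2i] hi F2h])
    finally show ?thesis unfolding h_int .
  qed
  have "(\<lambda>n. (?E + 4 * l * (M * B)\<^sup>2) / real (Suc n)) \<longlonglongrightarrow> 0"
    by (rule LIMSEQ_Suc[OF lim_const_over_n])
  then have "(\<lambda>n. \<integral>z. F2 n z \<partial>lebesgue) \<longlonglongrightarrow> 0"
    by (rule Lim_null_comparison[OF always_eventually[OF allI[OF F2b]]])
  then show ?thesis using LIMSEQ_unique[OF lim1] unfolding eq by blast
qed

section \<open>Explicit integrals\<close>

lemma has_bochner_integral_FTC_UNIV:
  fixes f F :: "real \<Rightarrow> real"
  assumes "\<And>x. (F has_real_derivative f x) (at x)" "\<And>x. isCont f x" "\<And>x. 0 \<le> f x"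
    and "(F \<longlongrightarrow> A) at_bot" "(F \<longlongrightarrow> B) at_top"
  shows "has_bochner_integral lborel f (B - A)"
proof -
  have e: "einterval (- \<infinity>) \<infinity> = UNIV" by (auto simp: einterval_def)
  have "set_integrable lborel (einterval (- \<infinity>) \<infinity>) f" "(LBINT x=-\<infinity>..\<infinity>. f x) = B - A"
    by (rule interval_integral_FTC_nonneg[of _ _ F]; use assms in \<open>simp add: ereal_tendsto_simps\<close>)+
  then show ?thesis
    by (simp add: e set_integrable_def interval_lebesgue_integral_def set_lebesgue_integral_def has_bochner_integral_iff)
qed

lemma tendsto_at_bot_odd:
  fixes F :: "real \<Rightarrow> real"
  assumes "\<And>x. F (- x) = - F x" "(F \<longlongrightarrow> B) at_top"
  shows "(F \<longlongrightarrow> - B) at_bot"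
  using tendsto_minus[OF assms(2)] by (simp add: filterlim_at_bot_mirror assms(1))

lemma has_bochner_integral_FTC_odd:
  fixes f F :: "real \<Rightarrow> real"
  assumes "\<And>x. (F has_real_derivative f x) (at x)" "\<And>x. isCont f x" "\<And>x. 0 \<le> f x"
    and "\<And>x. F (- x) = - F x" "(F \<longlongrightarrow> B) at_top"
  shows "has_bochner_integral lborel f (2 * B)"
  using has_bochner_integral_FTC_UNIV[OF assms(1-3) tendsto_at_bot_odd[OF assms(4,5)] assms(5)] by simp

lemma tendsto_arctan_scaled:
  fixes s :: real
  assumes "s > 0"
  shows "((\<lambda>x. arctan (x / s)) \<longlongrightarrow> pi / 2) at_top"
proof (rule filterlim_compose[OF tendsto_arctan_at_top])
  have "filterlim (\<lambda>x. inverse s * x) at_top at_top"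
    by (rule filterlim_tendsto_pos_mult_at_top[OF tendsto_const _ filterlim_ident]) (use assms in simp)
  then show "filterlim (\<lambda>x. x / s) at_top at_top" by (simp add: divide_inverse mult.commute)
qed

lemma tendsto_quotient_at_top:
  fixes s :: real
  assumes "s > 0"
  shows "((\<lambda>x. x / (x\<^sup>2 + s\<^sup>2)) \<longlongrightarrow> 0) at_top" "((\<lambda>x. x / (x\<^sup>2 + s\<^sup>2)\<^sup>2) \<longlongrightarrow> 0) at_top"
proof -
  have b: "0 \<le> x / (x\<^sup>2 + s\<^sup>2) \<and> x / (x\<^sup>2 + s\<^sup>2) \<le> 1 / x" if "x > 0" for x
  proof -
    have "x * x \<le> 1 * (x\<^sup>2 + s\<^sup>2)" "0 < x\<^sup>2 + s\<^sup>2" using that by (auto simp: power2_eq_square add_pos_nonneg)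
    then show ?thesis using that by (auto simp: divide_simps)
  qed
  have 0: "((\<lambda>x::real. 1 / x) \<longlongrightarrow> 0) at_top"
    by (rule tendsto_divide_0[OF tendsto_const]) (simp add: filterlim_at_top_imp_at_infinity filterlim_ident)
  show 1: "((\<lambda>x. x / (x\<^sup>2 + s\<^sup>2)) \<longlongrightarrow> 0) at_top"
    by (rule tendsto_sandwich[OF _ _ tendsto_const 0])
      (rule eventually_mono[OF eventually_gt_at_top[of 0]], use b in blast)+
  have b2: "0 \<le> x / (x\<^sup>2 + s\<^sup>2)\<^sup>2 \<and> x / (x\<^sup>2 + s\<^sup>2)\<^sup>2 \<le> x / (x\<^sup>2 + s\<^sup>2) * (1 / s\<^sup>2)" if "x > 0" for x
  proof -
    have "s\<^sup>2 \<le> x\<^sup>2 + s\<^sup>2" "0 < s\<^sup>2" using assms by auto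
    then have "1 / (x\<^sup>2 + s\<^sup>2) \<le> 1 / s\<^sup>2" by (simp add: frac_le)
    then have "x / (x\<^sup>2 + s\<^sup>2) * (1 / (x\<^sup>2 + s\<^sup>2)) \<le> x / (x\<^sup>2 + s\<^sup>2) * (1 / s\<^sup>2)"
      using b[OF that] by (intro mult_left_mono) auto
    then show ?thesis using that by (simp add: power2_eq_square)
  qed
  show "((\<lambda>x. x / (x\<^sup>2 + s\<^sup>2)\<^sup>2) \<longlongrightarrow> 0) at_top"
    by (rule tendsto_sandwich[OF _ _ tendsto_const tendsto_mult_left_zero[OF 1, of "1 / s\<^sup>2"]])
      (rule eventually_mono[OF eventually_gt_at_top[of 0]], use b2 in blast)+
qed

lemma sum_squares_pos: "s > 0 \<Longrightarrow> x\<^sup>2 + s\<^sup>2 > 0" for s x :: real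
  by (simp add: add_nonneg_pos)

text \<open>The antiderivatives come from the reduction formula (x / A^n)' = 2 n s^2 / A^(n+1) - (2
  n - 1) / A^n with A = x^2 + s^2, for n = 1 and n = 2, starting from the arctangent. Since they are
  odd, each integral is twice the limit at infinity.\<close>

lemma cauchy_kernel_integrals:
  fixes s :: real
  assumes s: "s > 0"
  shows "has_bochner_integral lborel (\<lambda>x. 1 / (x\<^sup>2 + s\<^sup>2)) (pi / s)"
    and "has_bochner_integral lborel (\<lambda>x. 1 / (x\<^sup>2 + s\<^sup>2)\<^sup>2) (pi / (2 * s ^ 3))"
    and "has_bochner_integral lborel (\<lambda>x. 1 / (x\<^sup>2 + s\<^sup>2) ^ 3) (3 * pi / (8 * s ^ 5))"
proof -
  note p = sum_squares_pos[OF s]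
  have nz: "x\<^sup>2 + s\<^sup>2 \<noteq> 0" for x using p[of x] by (rule less_imp_neq[symmetric])
  have c: "isCont (\<lambda>x. 1 / (x\<^sup>2 + s\<^sup>2) ^ n) x" for n x
    using nz by (intro continuous_intros) auto
  have d1: "((\<lambda>x. arctan (x / s) / s) has_real_derivative 1 / (x\<^sup>2 + s\<^sup>2)) (at x)" for x
    using s nz[of x] by (auto intro!: derivative_eq_intros simp: divide_simps) (auto simp: power2_eq_square algebra_simps)
  show "has_bochner_integral lborel (\<lambda>x. 1 / (x\<^sup>2 + s\<^sup>2)) (pi / s)"
  proof -
    have "isCont (\<lambda>x. 1 / (x\<^sup>2 + s\<^sup>2)) x" for x using c[of x 1] by simp
    then have "has_bochner_integral lborel (\<lambda>x. 1 / (x\<^sup>2 + s\<^sup>2)) (2 * (pi / 2 / s))"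
      using s by (intro has_bochner_integral_FTC_odd[OF d1] tendsto_divide tendsto_arctan_scaled tendsto_const) (auto simp: arctan_minus)
    then show ?thesis by simp
  qed
  have d2a: "((\<lambda>x. x / (x\<^sup>2 + s\<^sup>2)) has_real_derivative (s\<^sup>2 - x\<^sup>2) / (x\<^sup>2 + s\<^sup>2)\<^sup>2) (at x)" for x
    using nz[of x] by (auto intro!: derivative_eq_intros simp: power2_eq_square algebra_simps)
  have d2: "((\<lambda>x. x / (x\<^sup>2 + s\<^sup>2) / (2 * s\<^sup>2) + arctan (x / s) / s / (2 * s\<^sup>2)) has_real_derivative 1 / (x\<^sup>2 + s\<^sup>2)\<^sup>2) (at x)" for x
  proof -
    have "(s\<^sup>2 - x\<^sup>2) / (x\<^sup>2 + s\<^sup>2)\<^sup>2 / (2 * s\<^sup>2) + 1 / (x\<^sup>2 + s\<^sup>2) / (2 * s\<^sup>2) = 1 / (x\<^sup>2 + s\<^sup>2)\<^sup>2"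
    proof -
      have "1 / (x\<^sup>2 + s\<^sup>2) = (x\<^sup>2 + s\<^sup>2) / (x\<^sup>2 + s\<^sup>2)\<^sup>2" using nz[of x] by (simp add: power2_eq_square)
      then have "(s\<^sup>2 - x\<^sup>2) / (x\<^sup>2 + s\<^sup>2)\<^sup>2 + 1 / (x\<^sup>2 + s\<^sup>2) = (2 * s\<^sup>2) / (x\<^sup>2 + s\<^sup>2)\<^sup>2"
        by (simp add: add_divide_distrib[symmetric])
      then show ?thesis using s unfolding add_divide_distrib[symmetric] by simp
    qed
    from this[symmetric] show ?thesis by (simp only: DERIV_add[OF DERIV_cdivide[OF d2a] DERIV_cdivide[OF d1]])
  qed
  have "((\<lambda>x. x / (x\<^sup>2 + s\<^sup>2) / (2 * s\<^sup>2) + arctan (x / s) / s / (2 * s\<^sup>2)) \<longlongrightarrow> 0 / (2 * s\<^sup>2) + pi / 2 / s / (2 * s\<^sup>2)) at_top"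
    using s by (intro tendsto_intros tendsto_quotient_at_top tendsto_arctan_scaled) auto
  then have l2: "((\<lambda>x. x / (x\<^sup>2 + s\<^sup>2) / (2 * s\<^sup>2) + arctan (x / s) / s / (2 * s\<^sup>2)) \<longlongrightarrow> pi / (4 * s ^ 3)) at_top"
    by (simp add: power2_eq_square power3_eq_cube mult.assoc)
  have "has_bochner_integral lborel (\<lambda>x. 1 / (x\<^sup>2 + s\<^sup>2)\<^sup>2) (2 * (pi / (4 * s ^ 3)))"
    using c[of _ 2] by (intro has_bochner_integral_FTC_odd[OF d2 _ _ _ l2]) (auto simp: arctan_minus)
  then show "has_bochner_integral lborel (\<lambda>x. 1 / (x\<^sup>2 + s\<^sup>2)\<^sup>2) (pi / (2 * s ^ 3))"
    by simp
  have d3a: "((\<lambda>x. x / (x\<^sup>2 + s\<^sup>2)\<^sup>2) has_real_derivative (s\<^sup>2 - 3 * x\<^sup>2) / (x\<^sup>2 + s\<^sup>2) ^ 3) (at x)" for x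
  proof -
    have "((\<lambda>x. x / (x\<^sup>2 + s\<^sup>2)\<^sup>2) has_real_derivative (1 * (x\<^sup>2 + s\<^sup>2)\<^sup>2 - x * (2 * (x\<^sup>2 + s\<^sup>2) * (2 * x))) / ((x\<^sup>2 + s\<^sup>2)\<^sup>2 * (x\<^sup>2 + s\<^sup>2)\<^sup>2)) (at x)"
      using nz[of x] by (intro DERIV_divide) (auto intro!: derivative_eq_intros)
    moreover have "s\<^sup>2 - 3 * x\<^sup>2 = (x\<^sup>2 + s\<^sup>2) - 4 * x\<^sup>2" by simp
    moreover have "(1 * A\<^sup>2 - x * (2 * A * (2 * x))) / (A\<^sup>2 * A\<^sup>2) = (A - 4 * x\<^sup>2) / A ^ 3" if "A \<noteq> 0" for A
      using that by (simp add: divide_simps) (simp add: algebra_simps eval_nat_numeral)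
    note this[OF nz[of x]]
    ultimately show ?thesis by (simp only:)
  qed
  have d3: "((\<lambda>x. x / (x\<^sup>2 + s\<^sup>2)\<^sup>2 / (4 * s\<^sup>2) + (x / (x\<^sup>2 + s\<^sup>2) / (2 * s\<^sup>2) + arctan (x / s) / s / (2 * s\<^sup>2)) * (3 / (4 * s\<^sup>2)))
      has_real_derivative 1 / (x\<^sup>2 + s\<^sup>2) ^ 3) (at x)" for x
  proof -
    have "(s\<^sup>2 - 3 * x\<^sup>2) / (x\<^sup>2 + s\<^sup>2) ^ 3 / (4 * s\<^sup>2) + 1 / (x\<^sup>2 + s\<^sup>2)\<^sup>2 * (3 / (4 * s\<^sup>2)) = 1 / (x\<^sup>2 + s\<^sup>2) ^ 3"
    proof -
      have "3 / (x\<^sup>2 + s\<^sup>2)\<^sup>2 = 3 * (x\<^sup>2 + s\<^sup>2) / (x\<^sup>2 + s\<^sup>2) ^ 3"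
      proof -
        have "3 / A\<^sup>2 = 3 * A / A ^ 3" if "A \<noteq> 0" for A :: real
          using that by (simp add: power2_eq_square power3_eq_cube)
        then show ?thesis using nz[of x] by blast
      qed
      then have "(s\<^sup>2 - 3 * x\<^sup>2) / (x\<^sup>2 + s\<^sup>2) ^ 3 + 3 / (x\<^sup>2 + s\<^sup>2)\<^sup>2 = (4 * s\<^sup>2) / (x\<^sup>2 + s\<^sup>2) ^ 3"
        by (simp add: add_divide_distrib[symmetric])
      then have "((s\<^sup>2 - 3 * x\<^sup>2) / (x\<^sup>2 + s\<^sup>2) ^ 3 + 3 / (x\<^sup>2 + s\<^sup>2)\<^sup>2) / (4 * s\<^sup>2) = 1 / (x\<^sup>2 + s\<^sup>2) ^ 3"
        using s by simp
      then show ?thesis by (simp add: add_divide_distrib mult.commute)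
    qed
    from this[symmetric] show ?thesis by (simp only: DERIV_add[OF DERIV_cdivide[OF d3a] DERIV_cmult_right[OF d2]])
  qed
  have v: "0 / (4 * s\<^sup>2) + pi / (4 * s ^ 3) * (3 / (4 * s\<^sup>2)) = 3 * pi / (16 * s ^ 5)"
    by (simp add: eval_nat_numeral)
  have l3: "((\<lambda>x. x / (x\<^sup>2 + s\<^sup>2)\<^sup>2 / (4 * s\<^sup>2) + (x / (x\<^sup>2 + s\<^sup>2) / (2 * s\<^sup>2) + arctan (x / s) / s / (2 * s\<^sup>2)) * (3 / (4 * s\<^sup>2)))
      \<longlongrightarrow> 3 * pi / (16 * s ^ 5)) at_top"
    unfolding v[symmetric]
    using s by (intro tendsto_add[OF tendsto_divide tendsto_mult_right] tendsto_const tendsto_quotient_at_top l2) auto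
  have "has_bochner_integral lborel (\<lambda>x. 1 / (x\<^sup>2 + s\<^sup>2) ^ 3) (2 * (3 * pi / (16 * s ^ 5)))"
    using c[of _ 3] p by (intro has_bochner_integral_FTC_odd[OF d3 _ _ _ l3]) (auto simp: arctan_minus less_imp_le algebra_simps)
  then show "has_bochner_integral lborel (\<lambda>x. 1 / (x\<^sup>2 + s\<^sup>2) ^ 3) (3 * pi / (8 * s ^ 5))"
    by simp
qed

lemma nn_integral_if_has_bochner_integral:
  "has_bochner_integral M f I \<Longrightarrow> (\<And>x. 0 \<le> f x) \<Longrightarrow> (\<integral>\<^sup>+x. ennreal (f x) \<partial>M) = ennreal I" for f :: "'a \<Rightarrow> real"
  by (simp add: has_bochner_integral_iff nn_integral_eq_integral)

section \<open>The skyrmion integral\<close>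

text \<open>With A = x^2 + s^2 and s^2 = 1 + y^2 the numerator is 8 (A - 1), which splits the
  integrand into two of the kernels just integrated.\<close>

lemma skyrmion_slice:
  "(\<integral>\<^sup>+x. ennreal (8 * (x\<^sup>2 + y\<^sup>2) / (1 + x\<^sup>2 + y\<^sup>2) ^ 3) \<partial>lborel) =
    ennreal (pi * (4 / (sqrt (1 + y\<^sup>2)) ^ 3 - 3 / (sqrt (1 + y\<^sup>2)) ^ 5))"
proof -
  define s where "s = sqrt (1 + y\<^sup>2)"
  have s: "s > 0" "s\<^sup>2 = 1 + y\<^sup>2" by (simp_all add: s_def add_pos_nonneg)
  have "8 * (x\<^sup>2 + y\<^sup>2) / (1 + x\<^sup>2 + y\<^sup>2) ^ 3 = 8 * (1 / (x\<^sup>2 + s\<^sup>2)\<^sup>2) - 8 * (1 / (x\<^sup>2 + s\<^sup>2) ^ 3)" for x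
  proof -
    have e: "1 + x\<^sup>2 + y\<^sup>2 = x\<^sup>2 + s\<^sup>2" "x\<^sup>2 + y\<^sup>2 = (x\<^sup>2 + s\<^sup>2) - 1" using s by simp_all
    have "x\<^sup>2 + s\<^sup>2 \<noteq> 0" using sum_squares_pos[OF s(1), of x] by (rule less_imp_neq[symmetric])
    moreover have "8 * (A - 1) / A ^ 3 = 8 * (1 / A\<^sup>2) - 8 * (1 / A ^ 3)" if "A \<noteq> 0" for A :: real
      using that by (simp add: divide_simps) (simp add: algebra_simps eval_nat_numeral)
    ultimately show ?thesis unfolding e by blast
  qed
  moreover have "has_bochner_integral lborel (\<lambda>x. 8 * (1 / (x\<^sup>2 + s\<^sup>2)\<^sup>2) - 8 * (1 / (x\<^sup>2 + s\<^sup>2) ^ 3)) (8 * (pi / (2 * s ^ 3)) - 8 * (3 * pi / (8 * s ^ 5)))"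
    by (intro has_bochner_integral_diff has_bochner_integral_mult_right cauchy_kernel_integrals s)
  ultimately have "has_bochner_integral lborel (\<lambda>x. 8 * (x\<^sup>2 + y\<^sup>2) / (1 + x\<^sup>2 + y\<^sup>2) ^ 3) (pi * (4 / s ^ 3 - 3 / s ^ 5))"
    by (simp add: right_diff_distrib mult.commute)
  then show ?thesis unfolding s_def
    by (rule nn_integral_if_has_bochner_integral) (auto intro!: divide_nonneg_nonneg zero_le_power add_nonneg_nonneg)
qed

lemma skyrmion_outer_nonneg: "0 \<le> pi * (4 / (sqrt (1 + y\<^sup>2)) ^ 3 - 3 / (sqrt (1 + y\<^sup>2)) ^ 5)"
proof -
    let ?s = "sqrt (1 + y\<^sup>2)"
    have s: "?s \<ge> 1" by simp
    have "3 / ?s ^ 5 \<le> 4 / ?s ^ 3"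
    proof -
      have "3 / ?s ^ 5 = 3 / ?s ^ 3 * (1 / ?s\<^sup>2)" by (simp add: eval_nat_numeral)
      also have "\<dots> \<le> 3 / ?s ^ 3 * 1"
      proof (rule mult_left_mono)
        show "1 / ?s\<^sup>2 \<le> 1" using power_mono[OF s, of 2] by (simp add: divide_le_eq_1 del: real_sqrt_pow2)
      qed (use s in simp)
      also have "\<dots> \<le> 4 / ?s ^ 3" using s by (simp add: divide_right_mono)
      finally show ?thesis .
    qed
    then show ?thesis by simp
qed

lemma skyrmion_outer: "has_bochner_integral lborel (\<lambda>y. pi * (4 / (sqrt (1 + y\<^sup>2)) ^ 3 - 3 / (sqrt (1 + y\<^sup>2)) ^ 5)) (4 * pi)"
proof -
  \<comment> \<open>This is the sine of arctan y: q' = 1 / s^3 and q^2 = 1 - 1 / s^2 with s = sqrt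
    (1 + y^2). Hence (q + q^3)' = (1 + 3 q^2) / s^3 = 4 / s^3 - 3 / s^5, and q + q^3 runs from -2 to
    2.\<close>
  define q where "q = (\<lambda>y::real. y / sqrt (1 + y\<^sup>2))"
  have pos: "1 + y\<^sup>2 > 0" for y :: real by (simp add: add_pos_nonneg)
  have dq: "(q has_real_derivative 1 / (sqrt (1 + y\<^sup>2)) ^ 3) (at y)" for y
  proof -
    have "sqrt (1 + y\<^sup>2) \<noteq> 0" using pos[of y] by simp
    moreover have "sqrt (1 + y\<^sup>2) * sqrt (1 + y\<^sup>2) = 1 + y * y" using pos[of y] by (simp add: power2_eq_square)
    ultimately have "(sqrt (1 + y\<^sup>2) - y * (y / sqrt (1 + y\<^sup>2))) / (sqrt (1 + y\<^sup>2))\<^sup>2 = 1 / (sqrt (1 + y\<^sup>2)) ^ 3"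
      by (simp add: field_simps power2_eq_square power3_eq_cube)
    moreover have "(q has_real_derivative (sqrt (1 + y\<^sup>2) - y * (y / sqrt (1 + y\<^sup>2))) / (sqrt (1 + y\<^sup>2))\<^sup>2) (at y)"
      unfolding q_def using pos[of y]
      by (auto intro!: derivative_eq_intros simp: power2_eq_square divide_simps)
    ultimately show ?thesis by simp
  qed
  have d: "((\<lambda>y. pi * (q y + q y ^ 3)) has_real_derivative pi * (4 / (sqrt (1 + y\<^sup>2)) ^ 3 - 3 / (sqrt (1 + y\<^sup>2)) ^ 5)) (at y)" for y
  proof -
    let ?s = "sqrt (1 + y\<^sup>2)"
    have s: "?s > 0" "?s\<^sup>2 = 1 + y\<^sup>2" using pos[of y] by simp_all
    have "((\<lambda>y. pi * (q y + q y ^ 3)) has_real_derivative pi * (1 / ?s ^ 3 + 3 * (q y)\<^sup>2 * (1 / ?s ^ 3))) (at y)"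
      by (auto intro!: derivative_eq_intros dq simp: power2_eq_square)
    also have "(q y)\<^sup>2 = 1 - 1 / ?s\<^sup>2"
      using s by (simp add: q_def power_divide field_simps)
    also have "1 / ?s ^ 3 + 3 * (1 - 1 / ?s\<^sup>2) * (1 / ?s ^ 3) = 4 / ?s ^ 3 - 3 / ?s ^ 5"
    proof -
      have "1 / ?s\<^sup>2 * (1 / ?s ^ 3) = 1 / ?s ^ 5" by (simp add: eval_nat_numeral)
      then show ?thesis by (simp add: algebra_simps)
    qed
    finally show ?thesis .
  qed
  have "(q \<longlongrightarrow> 1) at_top"
  proof (rule Lim_transform_eventually)
    have "((\<lambda>y. sqrt (1 + (1 / y)\<^sup>2)) \<longlongrightarrow> sqrt (1 + 0\<^sup>2)) (at_top :: real filter)"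
      by (intro tendsto_intros tendsto_divide_0[OF tendsto_const]) (simp add: filterlim_at_top_imp_at_infinity filterlim_ident)
    then show "((\<lambda>y. 1 / sqrt (1 + (1 / y)\<^sup>2)) \<longlongrightarrow> 1) (at_top :: real filter)"
      using tendsto_divide[OF tendsto_const, of _ 1 _ 1] by fastforce
    show "\<forall>\<^sub>F y in at_top. 1 / sqrt (1 + (1 / y)\<^sup>2) = q y"
      using eventually_gt_at_top[of 0]
    proof eventually_elim
      case (elim y)
      then have "1 + (1 / y)\<^sup>2 = (1 + y\<^sup>2) / y\<^sup>2" by (simp add: field_simps)
      then show ?case using elim by (simp add: q_def real_sqrt_divide)
    qed
  qed
  then have lim: "((\<lambda>y. pi * (q y + q y ^ 3)) \<longlongrightarrow> pi * (1 + 1 ^ 3)) at_top"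
    by (intro tendsto_intros)
  have "has_bochner_integral lborel (\<lambda>y. pi * (4 / (sqrt (1 + y\<^sup>2)) ^ 3 - 3 / (sqrt (1 + y\<^sup>2)) ^ 5)) (2 * (pi * (1 + 1 ^ 3)))"
  proof (rule has_bochner_integral_FTC_odd[OF d _ _ _ lim])
    fix y :: real
    show "0 \<le> pi * (4 / (sqrt (1 + y\<^sup>2)) ^ 3 - 3 / (sqrt (1 + y\<^sup>2)) ^ 5)" by (rule skyrmion_outer_nonneg)
    show "isCont (\<lambda>y. pi * (4 / (sqrt (1 + y\<^sup>2)) ^ 3 - 3 / (sqrt (1 + y\<^sup>2)) ^ 5)) y"
      using pos[of y] by (intro continuous_intros) auto
  qed (simp add: q_def algebra_simps)
  then show ?thesis by simp
qed

lemma Phi_partial_derivs: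
  "partial_deriv 1 (\<lambda>w. Phi w $ 3) z = - 4 * Re z / (1 + (norm z)\<^sup>2)\<^sup>2"
  "partial_deriv \<i> (\<lambda>w. Phi w $ 3) z = - 4 * Im z / (1 + (norm z)\<^sup>2)\<^sup>2"
proof -
  have e: "Phi w $ 3 = (1 - ((Re w)\<^sup>2 + (Im w)\<^sup>2)) / (1 + ((Re w)\<^sup>2 + (Im w)\<^sup>2))" for w
    by (simp add: Phi_def cmod_power2)
  have nz: "1 + ((Re z)\<^sup>2 + (Im z)\<^sup>2) \<noteq> 0" using add_pos_nonneg[of 1 "(Re z)\<^sup>2 + (Im z)\<^sup>2"] by simp
  have "((\<lambda>w. (1 - ((Re w)\<^sup>2 + (Im w)\<^sup>2)) / (1 + ((Re w)\<^sup>2 + (Im w)\<^sup>2))) has_derivative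
    (\<lambda>h. - 4 * (Re z * Re h + Im z * Im h) / (1 + ((Re z)\<^sup>2 + (Im z)\<^sup>2))\<^sup>2)) (at z)"
    using nz by (auto intro!: derivative_eq_intros simp: field_simps power2_eq_square)
  from partial_deriv_eqI[OF this]
  show "partial_deriv 1 (\<lambda>w. Phi w $ 3) z = - 4 * Re z / (1 + (norm z)\<^sup>2)\<^sup>2"
    "partial_deriv \<i> (\<lambda>w. Phi w $ 3) z = - 4 * Im z / (1 + (norm z)\<^sup>2)\<^sup>2"
    unfolding e by (simp_all add: cmod_power2)
qed

text \<open>The horizontal part of \<open>Phi\<close> and the gradient of its third component are
  both negative multiples of z, so the integrand is the nonnegative function \<open>f\<close>. The
  value 4 pi turns the limiting energy into T r^2 - 8 pi r, whence the radius 4 pi / T.\<close>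

lemma skyrmion_integral:
  "(\<integral>x. (mat 1 *v Phi x) $ 1 * partial_deriv 1 (\<lambda>w. Phi w $ 3) x
       + (mat 1 *v Phi x) $ 2 * partial_deriv \<i> (\<lambda>w. Phi w $ 3) x \<partial>lebesgue) = 4 * pi"
proof -
  define f :: "complex \<Rightarrow> real" where "f = (\<lambda>z. 8 * ((Re z)\<^sup>2 + (Im z)\<^sup>2) / (1 + (Re z)\<^sup>2 + (Im z)\<^sup>2) ^ 3)"
  have [measurable]: "f \<in> borel_measurable borel" unfolding f_def by measurable
  have f0: "f z \<ge> 0" for z unfolding f_def by (auto intro!: divide_nonneg_nonneg zero_le_power add_nonneg_nonneg)
  have "(\<integral>\<^sup>+z. ennreal (f z) \<partial>lborel) = ennreal (4 * pi)"
  proof -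
    have "0 \<le> pi * (4 / (sqrt (1 + y\<^sup>2)) ^ 3 - 3 / (sqrt (1 + y\<^sup>2)) ^ 5)" for y
      using skyrmion_outer_nonneg by simp
    then have "(\<integral>\<^sup>+y. ennreal (pi * (4 / (sqrt (1 + y\<^sup>2)) ^ 3 - 3 / (sqrt (1 + y\<^sup>2)) ^ 5)) \<partial>lborel) = ennreal (4 * pi)"
      by (rule nn_integral_if_has_bochner_integral[OF skyrmion_outer])
    then show ?thesis
      by (subst nn_integral_complex) (simp_all only: f_def skyrmion_slice complex.sel, measurable)
  qed
  then have "(\<integral>z. f z \<partial>lborel) = 4 * pi"
    using f0 by (subst integral_eq_nn_integral) auto
  moreover have "(mat 1 *v Phi z) $ 1 * partial_deriv 1 (\<lambda>w. Phi w $ 3) z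
       + (mat 1 *v Phi z) $ 2 * partial_deriv \<i> (\<lambda>w. Phi w $ 3) z = f z" for z
  proof -
    have "1 + (norm z)\<^sup>2 \<noteq> 0" using add_pos_nonneg[of 1 "(norm z)\<^sup>2"] by simp
    then have "- (2 * Re z / (1 + (norm z)\<^sup>2)) * (- 4 * Re z / (1 + (norm z)\<^sup>2)\<^sup>2)
      + - (2 * Im z / (1 + (norm z)\<^sup>2)) * (- 4 * Im z / (1 + (norm z)\<^sup>2)\<^sup>2) = 8 * ((Re z)\<^sup>2 + (Im z)\<^sup>2) / (1 + (norm z)\<^sup>2) ^ 3"
      by (simp add: power2_eq_square power3_eq_cube add_divide_distrib[symmetric] algebra_simps)
    then show ?thesis unfolding Phi_partial_derivs f_def matrix_vector_mul_lid
      by (simp add: Phi_def cmod_power2 add.assoc)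
  qed
  ultimately show ?thesis by (simp add: integral_completion)
qed

section \<open>Green's formula on the strip\<close>

lemma rectangle_indicator:
  "indicat_real (cbox (Complex a c) (Complex b d)) (Complex x y) = indicator {c..d} y * indicator {a..b} x"
  by (auto simp: indicator_def in_cbox_complex_iff)

lemma continuous_on_Complex_rows:
  assumes "continuous_on S f" "\<And>t. t \<in> X \<Longrightarrow> Complex t y \<in> S"
  shows "continuous_on X (\<lambda>t. f (Complex t y))"
  using assms by (intro continuous_on_compose2[OF assms(1)]) (auto simp: Complex_eq intro!: continuous_intros)

lemma continuous_on_Complex_columns:
  assumes "continuous_on S f" "\<And>t. t \<in> X \<Longrightarrow> Complex x t \<in> S"
  shows "continuous_on X (\<lambda>t. f (Complex x t))"
  using assms by (intro continuous_on_compose2[OF assms(1)]) (auto simp: Complex_eq intro!: continuous_intros)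

text \<open>Only the derivative of \<open>P\<close> along rows and that of \<open>Q\<close> along
  columns enter, so each is integrated by the fundamental theorem in its own variable.\<close>

lemma green_rectangle:
  fixes P Q P1 Q2 :: "complex \<Rightarrow> real"
  assumes ab: "a \<le> b" "c \<le> d" and R: "R = cbox (Complex a c) (Complex b d)"
    and cont: "continuous_on R P1" "continuous_on R Q2"
    and P: "\<And>x y. Complex x y \<in> R \<Longrightarrow> ((\<lambda>t. P (Complex t y)) has_real_derivative P1 (Complex x y)) (at x)"
    and Q: "\<And>x y. Complex x y \<in> R \<Longrightarrow> ((\<lambda>t. Q (Complex x t)) has_real_derivative Q2 (Complex x y)) (at y)"
  shows "integrable lborel (\<lambda>z. indicator R z *\<^sub>R (P1 z + Q2 z))"
    and "(\<integral>z. indicator R z *\<^sub>R (P1 z + Q2 z) \<partial>lborel) =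
      (\<integral>y. indicator {c..d} y * (P (Complex b y) - P (Complex a y)) \<partial>lborel) +
      (\<integral>x. indicator {a..b} x * (Q (Complex x d) - Q (Complex x c)) \<partial>lborel)"
proof -
  have R_iff: "Complex x y \<in> R \<longleftrightarrow> x \<in> {a..b} \<and> y \<in> {c..d}" for x y by (auto simp: R in_cbox_complex_iff)
  have "compact R" by (simp add: R)
  then have i: "integrable lborel (\<lambda>z. indicator R z *\<^sub>R P1 z)" "integrable lborel (\<lambda>z. indicator R z *\<^sub>R Q2 z)"
    using cont by (blast intro: borel_integrable_compact)+
  then show "integrable lborel (\<lambda>z. indicator R z *\<^sub>R (P1 z + Q2 z))" by (simp add: algebra_simps)
  have "(\<integral>x. indicator R (Complex x y) *\<^sub>R P1 (Complex x y) \<partial>lborel) = indicator {c..d} y * (P (Complex b y) - P (Complex a y))" for y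
  proof (cases "y \<in> {c..d}")
    case True
    have "(\<integral>x. indicator {a..b} x *\<^sub>R P1 (Complex x y) \<partial>lborel) = P (Complex b y) - P (Complex a y)"
    proof (rule integral_FTC_atLeastAtMost[OF ab(1)])
      show "((\<lambda>t. P (Complex t y)) has_vector_derivative P1 (Complex x y)) (at x within {a..b})" if "a \<le> x" "x \<le> b" for x
        using P[of x y] that True R_iff
        by (auto simp: has_real_derivative_iff_has_vector_derivative[symmetric] intro: has_field_derivative_at_within)
      show "continuous_on {a..b} (\<lambda>x. P1 (Complex x y))"
        by (rule continuous_on_Complex_rows[OF cont(1)]) (use True R_iff in auto)
    qed
    then show ?thesis using True by (simp add: R rectangle_indicator)
  qed (simp add: R rectangle_indicator)
  moreover have "(\<integral>y. indicator R (Complex x y) *\<^sub>R Q2 (Complex x y) \<partial>lborel) = indicator {a..b} x * (Q (Complex x d) - Q (Complex x c))" for x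
  proof (cases "x \<in> {a..b}")
    case True
    have "(\<integral>y. indicator {c..d} y *\<^sub>R Q2 (Complex x y) \<partial>lborel) = Q (Complex x d) - Q (Complex x c)"
    proof (rule integral_FTC_atLeastAtMost[OF ab(2)])
      show "((\<lambda>t. Q (Complex x t)) has_vector_derivative Q2 (Complex x y)) (at y within {c..d})" if "c \<le> y" "y \<le> d" for y
        using Q[of x y] that True R_iff
        by (auto simp: has_real_derivative_iff_has_vector_derivative[symmetric] intro: has_field_derivative_at_within)
      show "continuous_on {c..d} (\<lambda>y. Q2 (Complex x y))"
        by (rule continuous_on_Complex_columns[OF cont(2)]) (use True R_iff in auto)
    qed
    then show ?thesis using True by (simp add: R rectangle_indicator)
  qed (simp add: R rectangle_indicator)
  ultimately show "(\<integral>z. indicator R z *\<^sub>R (P1 z + Q2 z) \<partial>lborel) =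
      (\<integral>y. indicator {c..d} y * (P (Complex b y) - P (Complex a y)) \<partial>lborel) +
      (\<integral>x. indicator {a..b} x * (Q (Complex x d) - Q (Complex x c)) \<partial>lborel)"
    unfolding scaleR_add_right Bochner_Integration.integral_add[OF i]
    using integral_complex_rows(1)[OF i(1)] integral_complex_columns(1)[OF i(2)] by simp
qed

text \<open>Exhaustion by rectangles: by \<open>decay\<close> the vertical sides contribute at most
  a constant over the half length, and the horizontal sides converge to the flux \<open>I\<close>.
  Nonnegativity of the divergence lets monotone convergence identify the limit of the area
  integrals, so integrability over the strip is obtained rather than presupposed.\<close>

lemma green_strip:
  fixes P Q P1 Q2 :: "complex \<Rightarrow> real"
  assumes m: "m > 0" and S: "S = {z. \<bar>Im z\<bar> \<le> m}"
    and cont: "continuous_on S P" "continuous_on S P1" "continuous_on S Q2"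
    and P: "\<And>x y. Complex x y \<in> S \<Longrightarrow> ((\<lambda>t. P (Complex t y)) has_real_derivative P1 (Complex x y)) (at x)"
    and Q: "\<And>x y. Complex x y \<in> S \<Longrightarrow> ((\<lambda>t. Q (Complex x t)) has_real_derivative Q2 (Complex x y)) (at y)"
    and nonneg: "\<And>z. z \<in> S \<Longrightarrow> 0 \<le> P1 z + Q2 z"
    and decay: "\<And>z. z \<in> S \<Longrightarrow> 1 \<le> \<bar>Re z\<bar> \<Longrightarrow> \<bar>P z\<bar> \<le> C / \<bar>Re z\<bar>"
    and I: "has_bochner_integral lborel (\<lambda>x. Q (Complex x m) - Q (Complex x (- m))) I"
  shows "(\<integral>\<^sup>+z. ennreal (indicator S z * (P1 z + Q2 z)) \<partial>lborel) = ennreal I" and "0 \<le> I"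
proof -
  let ?D = "\<lambda>z. P1 z + Q2 z" and ?q = "\<lambda>x. Q (Complex x m) - Q (Complex x (- m))"
  define R where "R = (\<lambda>n::nat. cbox (Complex (- real (Suc n)) (- m)) (Complex (real (Suc n)) m))"
  have RS: "R n \<subseteq> S" for n by (auto simp: R_def S in_cbox_complex_iff)
  have gi: "integrable lborel (\<lambda>z. indicator (R n) z *\<^sub>R ?D z)"
    and ge: "(\<integral>z. indicator (R n) z *\<^sub>R ?D z \<partial>lborel) =
      (\<integral>y. indicator {-m..m} y * (P (Complex (real (Suc n)) y) - P (Complex (- real (Suc n)) y)) \<partial>lborel) +
      (\<integral>x. indicator {- real (Suc n)..real (Suc n)} x * ?q x \<partial>lborel)" for n
    by (rule green_rectangle[of "- real (Suc n)" "real (Suc n)" "-m" m "R n" P1 Q2 P Q];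
        use m P Q RS cont in \<open>force simp: R_def intro: continuous_on_subset\<close>)+
  have lim1: "(\<lambda>n. \<integral>y. indicator {-m..m} y * (P (Complex (real (Suc n)) y) - P (Complex (- real (Suc n)) y)) \<partial>lborel) \<longlonglongrightarrow> 0"
  proof (rule Lim_null_comparison[OF always_eventually[OF allI]])
    fix n
    let ?f = "\<lambda>y. indicator {-m..m} y *\<^sub>R (P (Complex (real (Suc n)) y) - P (Complex (- real (Suc n)) y))"
    let ?g = "\<lambda>y. indicator {-m..m} y *\<^sub>R (2 * C / real (Suc n))"
    have fi: "integrable lborel ?f"
      by (intro borel_integrable_compact continuous_on_diff continuous_on_Complex_columns[OF cont(1)]) (auto simp: S)
    have gi: "integrable lborel ?g"
      by (intro borel_integrable_compact) auto
    have "norm (\<integral>y. ?f y \<partial>lborel) \<le> (\<integral>y. ?g y \<partial>lborel)"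
    proof (rule order_trans[OF integral_norm_bound integral_mono[OF integrable_norm[OF fi] gi]])
      fix y
      show "norm (?f y) \<le> ?g y"
      proof (cases "y \<in> {-m..m}")
        case True
        then have "\<bar>P (Complex (real (Suc n)) y)\<bar> \<le> C / real (Suc n)" "\<bar>P (Complex (- real (Suc n)) y)\<bar> \<le> C / real (Suc n)"
          using decay[of "Complex (real (Suc n)) y"] decay[of "Complex (- real (Suc n)) y"] by (auto simp: S abs_le_iff simp del: of_nat_Suc)
        then have "\<bar>P (Complex (real (Suc n)) y) - P (Complex (- real (Suc n)) y)\<bar> \<le> C / real (Suc n) + C / real (Suc n)"
          by linarith
        then show ?thesis using True by (simp add: add_divide_distrib[symmetric] del: of_nat_Suc)
      qed simp
    qed
    also have "(\<integral>y. ?g y \<partial>lborel) = (2 * m * (2 * C)) / real (Suc n)"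
      using m by simp
    finally show "norm (\<integral>y. indicator {-m..m} y * (P (Complex (real (Suc n)) y) - P (Complex (- real (Suc n)) y)) \<partial>lborel) \<le> (2 * m * (2 * C)) / real (Suc n)"
      by simp
  qed (rule LIMSEQ_Suc[OF lim_const_over_n])
  have "(\<lambda>n. \<integral>x. indicator {- real (Suc n)..real (Suc n)} x * ?q x \<partial>lborel)
    \<longlonglongrightarrow> (\<integral>x. ?q x \<partial>lborel)"
  proof (rule integral_dominated_convergence)
    show "integrable lborel (\<lambda>x. \<bar>?q x\<bar>)" using I by (auto simp: has_bochner_integral_iff)
    show "(\<lambda>x. ?q x) \<in> borel_measurable lborel" using I by (auto simp: has_bochner_integral_iff)
    then show "(\<lambda>x. indicator {- real (Suc n)..real (Suc n)} x * ?q x) \<in> borel_measurable lborel" for n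
      by (intro borel_measurable_times) auto
    show "AE x in lborel. (\<lambda>n. indicator {- real (Suc n)..real (Suc n)} x * ?q x) \<longlonglongrightarrow> ?q x"
    proof (intro AE_I2 tendsto_eventually)
      fix x :: real
      obtain n0 :: nat where "\<bar>x\<bar> < real n0" using reals_Archimedean2 by blast
      then show "\<forall>\<^sub>F n in sequentially. indicator {- real (Suc n)..real (Suc n)} x * ?q x = ?q x"
        unfolding eventually_sequentially by (intro exI[of _ n0]) (auto simp: indicator_def)
    qed
  qed (auto simp: indicator_def)
  then have lim: "(\<lambda>n. \<integral>z. indicator (R n) z *\<^sub>R ?D z \<partial>lborel) \<longlonglongrightarrow> I"
    unfolding ge using tendsto_add[OF lim1] I by (fastforce simp: has_bochner_integral_iff)
  have "(\<lambda>n. \<integral>\<^sup>+z. ennreal (indicator (R n) z * ?D z) \<partial>lborel) \<longlonglongrightarrow> (\<integral>\<^sup>+z. ennreal (indicator S z * ?D z) \<partial>lborel)"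
  proof (rule nn_integral_LIMSEQ)
    show "incseq (\<lambda>n z. ennreal (indicator (R n) z * ?D z))"
    proof (intro incseq_SucI le_funI ennreal_leI)
      fix n z
      have "R n \<subseteq> R (Suc n)" by (auto simp: R_def in_cbox_complex_iff)
      then show "indicator (R n) z * ?D z \<le> indicator (R (Suc n)) z * ?D z"
        using nonneg[of z] RS by (auto simp: indicator_def)
    qed
    show "(\<lambda>z. ennreal (indicator (R n) z * ?D z)) \<in> borel_measurable lborel" for n
      using borel_measurable_integrable[OF gi[of n]] by simp
    show "(\<lambda>n. ennreal (indicator (R n) z * ?D z)) \<longlonglongrightarrow> ennreal (indicator S z * ?D z)" for z
    proof (rule tendsto_eventually)
      obtain n0 :: nat where "\<bar>Re z\<bar> < real n0" using reals_Archimedean2 by blast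
      then have "z \<in> R n \<longleftrightarrow> z \<in> S" if "n \<ge> n0" for n
        using that by (auto simp: R_def S in_cbox_complex_iff)
      then show "\<forall>\<^sub>F n in sequentially. ennreal (indicator (R n) z * ?D z) = ennreal (indicator S z * ?D z)"
        unfolding eventually_sequentially by (intro exI[of _ n0]) (auto simp: indicator_def)
    qed
  qed
  moreover have "(\<integral>\<^sup>+z. ennreal (indicator (R n) z * ?D z) \<partial>lborel) = ennreal (\<integral>z. indicator (R n) z *\<^sub>R ?D z \<partial>lborel)" for n
  proof -
    have "0 \<le> indicator (R n) z *\<^sub>R ?D z" for z
      using nonneg[of z] RS[of n] by (cases "z \<in> R n") auto
    then show ?thesis using nn_integral_eq_integral[OF gi[of n]] by simp
  qed
  ultimately show "(\<integral>\<^sup>+z. ennreal (indicator S z * ?D z) \<partial>lborel) = ennreal I"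
    using tendsto_ennrealI[OF lim] LIMSEQ_unique by simp
  have "0 \<le> (\<integral>z. indicator (R n) z *\<^sub>R ?D z \<partial>lborel)" for n
  proof (rule integral_nonneg_AE, rule AE_I2)
    show "0 \<le> indicator (R n) z *\<^sub>R ?D z" for z
      using nonneg[of z] RS[of n] by (cases "z \<in> R n") auto
  qed
  then show "0 \<le> I" using LIMSEQ_le_const[OF lim] by blast
qed

section \<open>Energy of the dipole outside the strip\<close>

text \<open>\<open>4 * pi / s ^ 3\<close> is the energy of the dipole on a horizontal line at
  distance s from its pole.\<close>

lemma dipole_half_plane:
  assumes "c > a"
  shows "(\<integral>\<^sup>+y. ennreal (4 * pi / (y - a) ^ 3) * indicator {c..} y \<partial>lborel) = ennreal (2 * pi / (c - a)\<^sup>2)"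
proof -
  have "(\<integral>\<^sup>+y. ennreal (4 * pi / (y - a) ^ 3) * indicator {c..} y \<partial>lborel) = ennreal (0 - (- 2 * pi / (c - a)\<^sup>2))"
  proof (rule nn_integral_FTC_atLeast)
    show "((\<lambda>y. - 2 * pi / (y - a)\<^sup>2) has_real_derivative 4 * pi / (y - a) ^ 3) (at y)" if "c \<le> y" for y
      using that assms by (auto intro!: derivative_eq_intros simp: divide_simps) (simp add: eval_nat_numeral)
    have "filterlim (\<lambda>y. y - a) at_top at_top"
      using filterlim_tendsto_add_at_top[OF tendsto_const filterlim_ident, of "- a"] by simp
    then have "filterlim (\<lambda>y. (y - a)\<^sup>2) at_top at_top"
      by (rule filterlim_pow_at_top[rotated]) simp
    then show "((\<lambda>y. - 2 * pi / (y - a)\<^sup>2) \<longlongrightarrow> 0) at_top"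
      by (intro tendsto_divide_0[OF tendsto_const] filterlim_at_top_imp_at_infinity)
  qed (use assms in \<open>auto intro!: divide_nonneg_nonneg\<close>)
  then show ?thesis by simp
qed

text \<open>Either partial derivative of 2 / (cnj z + i a) has squared modulus 4 / r^4, where r is
  the distance to the pole i a. Reflection in the real axis sends the lower half plane to the upper
  one and the pole height a to -a.\<close>

lemma dipole_energy_off_strip:
  assumes "\<bar>a\<bar> < l / 2"
  shows "(\<integral>\<^sup>+z. ennreal (indicator (- strip l) z * (8 / ((Re z)\<^sup>2 + (Im z - a)\<^sup>2)\<^sup>2)) \<partial>lborel) =
    ennreal (2 * pi / (l / 2 - a)\<^sup>2 + 2 * pi / (l / 2 + a)\<^sup>2)"
proof -
  have sl: "(\<integral>\<^sup>+x. ennreal (8 / (x\<^sup>2 + s\<^sup>2)\<^sup>2) \<partial>lborel) = ennreal (4 * pi / s ^ 3)" if "s > 0" for s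
  proof -
    have "has_bochner_integral lborel (\<lambda>x. 8 * (1 / (x\<^sup>2 + s\<^sup>2)\<^sup>2)) (8 * (pi / (2 * s ^ 3)))"
      by (intro has_bochner_integral_mult_right cauchy_kernel_integrals that)
    from nn_integral_if_has_bochner_integral[OF this] show ?thesis by simp
  qed
  have slice: "(\<integral>\<^sup>+x. ennreal (indicator (- strip l) (Complex x y) * (8 / (x\<^sup>2 + (y - a)\<^sup>2)\<^sup>2)) \<partial>lborel) =
    ennreal (4 * pi / (y - a) ^ 3) * indicator {l / 2..} y + ennreal (4 * pi / (- y - (- a)) ^ 3) * indicator {l / 2..} (- y)" for y
  proof -
    consider "y \<ge> l / 2" | "y \<le> - l / 2" | "- l / 2 < y" "y < l / 2" by linarith
    then show ?thesis
    proof cases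
      case 1
      then have "indicator (- strip l) (Complex x y) = (1::real)" for x by (auto simp: strip_def)
      then show ?thesis using 1 assms sl[of "y - a"] by (auto simp: indicator_def)
    next
      case 2
      then have "indicator (- strip l) (Complex x y) = (1::real)" for x by (auto simp: strip_def)
      moreover have "(y - a)\<^sup>2 = (- y - (- a))\<^sup>2" by (simp add: power2_commute)
      ultimately show ?thesis using 2 assms sl[of "- y - (- a)"] by (auto simp: indicator_def)
    next
      case 3
      then have "indicator (- strip l) (Complex x y) = (0::real)" for x by (auto simp: strip_def)
      then show ?thesis using 3 by (auto simp: indicator_def)
    qed
  qed
  have refl: "(\<integral>\<^sup>+y. ennreal (4 * pi / (- y - (- a)) ^ 3) * indicator {l / 2..} (- y) \<partial>lborel) = (\<integral>\<^sup>+y. ennreal (4 * pi / (y - (- a)) ^ 3) * indicator {l / 2..} y \<partial>lborel)"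
    using nn_integral_real_affine[of "\<lambda>y. ennreal (4 * pi / (y - (- a)) ^ 3) * indicator {l / 2..} y" "-1" 0] by simp
  have "(\<integral>\<^sup>+z. ennreal (indicator (- strip l) z * (8 / ((Re z)\<^sup>2 + (Im z - a)\<^sup>2)\<^sup>2)) \<partial>lborel) =
    (\<integral>\<^sup>+y. ennreal (4 * pi / (y - a) ^ 3) * indicator {l / 2..} y + ennreal (4 * pi / (- y - (- a)) ^ 3) * indicator {l / 2..} (- y) \<partial>lborel)"
    by (subst nn_integral_complex) (measurable, simp only: complex.sel slice)
  also have "\<dots> = ennreal (2 * pi / (l / 2 - a)\<^sup>2) + ennreal (2 * pi / (l / 2 - (- a))\<^sup>2)"
    using assms by (subst nn_integral_add) (auto simp del: minus_diff_minus diff_minus_eq_add simp: refl intro!: arg_cong2[where f = "(+)"] dipole_half_plane)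
  finally show ?thesis by simp
qed

section \<open>The optimal map in the strip\<close>

text \<open>Half of the antiperiod i pi. The shift matches tanh with coth on the boundary lines, and
  it also carries the modulus formula for cosh over to sinh.\<close>

lemma cosh_add_i_half_pi:
  "cosh (z + \<i> * of_real pi / 2) = \<i> * sinh z" "sinh (z + \<i> * of_real pi / 2) = \<i> * cosh z" for z :: complex
proof -
  have e: "exp (\<i> * of_real pi / 2) = \<i>"
    using cis_conv_exp[of "pi / 2"] by (simp add: cis_pi_half)
  moreover have "exp (- (\<i> * of_real pi / 2)) = - \<i>"
    unfolding exp_minus e by simp
  ultimately have "cosh (\<i> * of_real pi / 2) = 0" "sinh (\<i> * of_real pi / 2) = \<i>"
    by (simp_all add: cosh_field_def sinh_field_def)
  then show "cosh (z + \<i> * of_real pi / 2) = \<i> * sinh z" "sinh (z + \<i> * of_real pi / 2) = \<i> * cosh z"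
    by (simp_all add: cosh_add sinh_add)
qed

lemma norm_cosh_squared: "(norm (cosh z))\<^sup>2 = (sinh (Re z))\<^sup>2 + (cos (Im z))\<^sup>2" for z :: complex
proof -
  have "cosh z = cos (\<i> * z)" using cosh_complex[of z] by (simp add: cosh_field_def exp_minus)
  then show ?thesis
    by (simp add: norm_cos_squared sinh_field_def exp_minus power_divide)
qed

lemma norm_sinh_squared: "(norm (sinh z))\<^sup>2 = (sinh (Re z))\<^sup>2 + (sin (Im z))\<^sup>2" for z :: complex
proof -
  have "norm (sinh z) = norm (cosh (z + \<i> * of_real pi / 2))"
    by (simp add: cosh_add_i_half_pi norm_mult)
  then show ?thesis by (simp add: norm_cosh_squared cos_add)
qed

lemma abs_le_abs_sinh: "\<bar>x\<bar> \<le> \<bar>sinh x\<bar>" for x :: real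
proof -
  have "y \<le> sinh y" if "0 \<le> y" for y :: real
  proof -
    have "sinh 0 - 0 \<le> sinh y - y"
    proof (rule DERIV_nonneg_imp_nondecreasing[OF that])
      fix x :: real
      have "((\<lambda>y. sinh y - y) has_real_derivative cosh x * 1 - 1) (at x)" by (auto intro!: derivative_eq_intros)
      then show "\<exists>D. ((\<lambda>y. sinh y - y) has_real_derivative D) (at x) \<and> 0 \<le> D"
        using cosh_real_ge_1[of x] by auto
    qed
    then show ?thesis by simp
  qed
  from this[of "\<bar>x\<bar>"] show ?thesis by simp
qed

lemma norm_cosh_sinh_lower:
  "\<bar>Re z\<bar> \<le> norm (cosh z)" "\<bar>Re z\<bar> \<le> norm (sinh z)" for z :: complex
proof -
  have "\<bar>sinh (Re z)\<bar> \<le> norm (cosh z)" "\<bar>sinh (Re z)\<bar> \<le> norm (sinh z)"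
    by (rule power2_le_imp_le; simp add: norm_cosh_squared norm_sinh_squared)+
  then show "\<bar>Re z\<bar> \<le> norm (cosh z)" "\<bar>Re z\<bar> \<le> norm (sinh z)"
    using abs_le_abs_sinh[of "Re z"] by linarith+
qed

text \<open>Numerator and denominator both have modulus between |sinh (Re z)| and |sinh (Re z)| + 1,
  so either quotient is at most 1 + 1 / |sinh (Re z)|.\<close>

lemma norm_tanh_coth_le:
  assumes "Re z \<noteq> 0"
  shows "norm (tanh z) \<le> 1 + 1 / \<bar>Re z\<bar>" "norm (coth z) \<le> 1 + 1 / \<bar>Re z\<bar>"
proof -
  let ?s = "\<bar>sinh (Re z)\<bar>"
  have s: "\<bar>Re z\<bar> \<le> ?s" "0 < ?s" using abs_le_abs_sinh[of "Re z"] assms by auto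
  have sq: "a\<^sup>2 + c\<^sup>2 \<le> (\<bar>a\<bar> + 1)\<^sup>2" if "\<bar>c\<bar> \<le> 1" for a c :: real
  proof -
    have "c\<^sup>2 \<le> 1" using that by (simp add: abs_square_le_1)
    then show ?thesis by (simp add: power2_sum)
  qed
  have "norm (cosh z) \<le> ?s + 1"
    by (rule power2_le_imp_le) (simp_all add: norm_cosh_squared sq)
  moreover have "norm (sinh z) \<le> ?s + 1"
    by (rule power2_le_imp_le) (simp_all add: norm_sinh_squared sq)
  ultimately have up: "norm (cosh z) \<le> ?s + 1" "norm (sinh z) \<le> ?s + 1" .
  have lo: "?s \<le> norm (cosh z)" "?s \<le> norm (sinh z)"
    by (rule power2_le_imp_le; simp add: norm_cosh_squared norm_sinh_squared)+
  have b: "(?s + 1) / ?s \<le> 1 + 1 / \<bar>Re z\<bar>"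
    using s assms by (simp add: add_divide_distrib frac_le)
  have "norm (tanh z) \<le> (?s + 1) / ?s" unfolding tanh_def norm_divide
    by (rule frac_le) (use up lo s in auto)
  with b show "norm (tanh z) \<le> 1 + 1 / \<bar>Re z\<bar>" by linarith
  have "norm (coth z) \<le> (?s + 1) / ?s" unfolding coth_def norm_divide
    by (rule frac_le) (use up lo s in auto)
  with b show "norm (coth z) \<le> 1 + 1 / \<bar>Re z\<bar>" by linarith
qed

lemma holomorphic_sinh_cosh: "sinh holomorphic_on A" "cosh holomorphic_on A"
proof -
  have "(sinh has_field_derivative cosh z) (at z within A)" "(cosh has_field_derivative sinh z) (at z within A)" for z :: complex
    by (auto intro!: derivative_eq_intros)
  then show "sinh holomorphic_on A" "cosh holomorphic_on A"
    by (auto simp: holomorphic_on_def field_differentiable_def)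
qed

text \<open>Two removable singularities. Write sinh s = s S(s) with S(0) = 1; then cosh - S vanishes
  at 0, hence equals s N1(s), and coth s - 1/s = (cosh s - S(s)) / (s S(s)) = N1(s) / S(s). The
  quotient is holomorphic because the zeros of sinh are the multiples of i pi, of which only 0 has
  |Im| < pi.\<close>

lemma coth_regular_part_exists:
  "\<exists>R. R holomorphic_on {s. \<bar>Im s\<bar> < pi} \<and> (\<forall>s. s \<noteq> 0 \<longrightarrow> \<bar>Im s\<bar> < pi \<longrightarrow> R s = coth s - 1 / s)"
proof -
  have d: "deriv sinh 0 = (1 :: complex)"
    by (rule DERIV_imp_deriv) (auto intro!: derivative_eq_intros)
  define S where "S = (\<lambda>s::complex. if s = 0 then deriv sinh 0 else (sinh s - sinh 0) / (s - 0))"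
  have S: "S holomorphic_on UNIV" unfolding S_def
    by (rule pole_lemma_open[OF holomorphic_sinh_cosh(1) open_UNIV])
  define N where "N = (\<lambda>s. cosh s - S s)"
  have N: "N holomorphic_on UNIV" unfolding N_def by (intro holomorphic_intros S holomorphic_sinh_cosh)
  define N1 where "N1 = (\<lambda>s. if s = 0 then deriv N 0 else (N s - N 0) / (s - 0))"
  have N1: "N1 holomorphic_on UNIV" unfolding N1_def by (rule pole_lemma_open[OF N]) auto
  have N0: "N 0 = 0" by (simp add: N_def S_def d)
  have nz: "sinh s \<noteq> 0" if "s \<noteq> 0" "\<bar>Im s\<bar> < pi" for s :: complex
  proof
    assume "sinh s = 0"
    then have "(sinh (Re s))\<^sup>2 + (sin (Im s))\<^sup>2 = 0" using norm_sinh_squared[of s] by simp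
    then have "Re s = 0" "sin (Im s) = 0" by (auto simp: sum_power2_eq_zero_iff)
    moreover have "Im s = 0" using \<open>sin (Im s) = 0\<close> that sin_eq_0_pi[of "Im s"] by auto
    ultimately show False using that by (auto simp: complex_eq_iff)
  qed
  have S0: "S s \<noteq> 0" if "\<bar>Im s\<bar> < pi" for s
    using nz[of s] that by (auto simp: S_def d)
  show ?thesis
  proof (intro exI conjI allI impI)
    show "(\<lambda>s. N1 s / S s) holomorphic_on {s. \<bar>Im s\<bar> < pi}"
      using S0 by (intro holomorphic_intros holomorphic_on_subset[OF N1] holomorphic_on_subset[OF S]) auto
    fix s :: complex assume s: "s \<noteq> 0" "\<bar>Im s\<bar> < pi"
    then show "N1 s / S s = coth s - 1 / s"
      using nz[OF s] by (simp add: N1_def N0) (simp add: N_def S_def coth_def field_simps)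
  qed
qed

text \<open>Specified by its properties rather than by a formula: holomorphy forces the value at 0,
  where the pole of \<open>coth\<close> has been removed.\<close>

definition coth_regular :: "complex \<Rightarrow> complex" where
  "coth_regular = (SOME R. R holomorphic_on {s. \<bar>Im s\<bar> < pi} \<and> (\<forall>s. s \<noteq> 0 \<longrightarrow> \<bar>Im s\<bar> < pi \<longrightarrow> R s = coth s - 1 / s))"

lemma holomorphic_coth_regular: "coth_regular holomorphic_on {s. \<bar>Im s\<bar> < pi}"
  and coth_regular_eq: "s \<noteq> 0 \<Longrightarrow> \<bar>Im s\<bar> < pi \<Longrightarrow> coth_regular s = coth s - 1 / s"
  using someI_ex[OF coth_regular_part_exists] unfolding coth_regular_def by auto

locale strip_problem =
  fixes l y0 :: real
  assumes l: "l > 0" and y0: "\<bar>y0\<bar> < l / 2"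
begin

definition "k = pi / (2 * l)"
text \<open>The poles of \<open>f\<close> lie on the imaginary axis at heights (2 n + 1) l - y0, and
  \<open>d\<close> is the distance of the nearest one from the real axis. As |y0| < l/2, the region
  |Im z| < \<open>d\<close> contains the closed strip of the problem; it is symmetric under
  conjugation, as is needed for evaluating \<open>g\<close> at \<open>cnj z\<close>.\<close>

definition "d = l - \<bar>y0\<bar>"
definition "U = {z. \<bar>Im z\<bar> < d}"
abbreviation "p \<equiv> \<i> * complex_of_real y0"

definition f where "f z = of_real (2 * k) * tanh (of_real k * (z + p))"
text \<open>Removing the polar part 1/s of \<open>coth\<close> at s = k (w + p), with the factor -2
  k in front, produces exactly the summand 2 / (w + p) of the explicit formula.\<close>

definition g where "g w = - of_real (2 * k) * coth_regular (of_real k * (w + p))"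
definition h where "h z = f z + g (cnj z)"

lemma k_pos: "k > 0" using l by (simp add: k_def)

lemma d: "l / 2 < d" using y0 by (simp add: d_def)

lemma open_U: "open U" unfolding U_def by (intro open_Collect_less continuous_intros)

lemma cnj_U: "z \<in> U \<Longrightarrow> cnj z \<in> U" by (simp add: U_def)

lemma closed_strip_U: "\<bar>Im z\<bar> \<le> l / 2 \<Longrightarrow> z \<in> U" using d by (simp add: U_def)

lemma strip_U: "z \<in> strip l \<Longrightarrow> z \<in> U" by (rule closed_strip_U) (auto simp: strip_def)

lemma Im_arg:
  assumes "z \<in> U" shows "\<bar>Im (of_real k * (z + p))\<bar> < pi / 2"
proof -
  have "\<bar>Im z + y0\<bar> < l" using assms by (auto simp: U_def d_def)
  then have "k * \<bar>Im z + y0\<bar> < k * l" using k_pos by simp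
  also have "k * l = pi / 2" using l by (simp add: k_def)
  finally show ?thesis using k_pos by (simp add: abs_mult)
qed

lemma cosh_arg_nz: "z \<in> U \<Longrightarrow> cosh (of_real k * (z + p)) \<noteq> 0"
proof
  assume "z \<in> U" "cosh (of_real k * (z + p)) = 0"
  then have "(sinh (Re (of_real k * (z + p))))\<^sup>2 + (cos (Im (of_real k * (z + p))))\<^sup>2 = 0"
    using norm_cosh_squared[of "of_real k * (z + p)"] by simp
  then have "cos (Im (of_real k * (z + p))) = 0" by (simp only: sum_power2_eq_zero_iff)
  moreover have "cos (Im (of_real k * (z + p))) > 0"
    using Im_arg[OF \<open>z \<in> U\<close>] by (intro cos_gt_zero_pi) (simp_all only: abs_less_iff, linarith+)
  ultimately show False by simp
qed

lemma deriv_f: "z \<in> U \<Longrightarrow> (f has_field_derivative of_real (2 * k\<^sup>2) / (cosh (of_real k * (z + p)))\<^sup>2) (at z)"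
proof -
  assume z: "z \<in> U"
  have "(f has_field_derivative of_real (2 * k) * ((1 - (tanh (of_real k * (z + p)))\<^sup>2) * of_real k)) (at z)"
    unfolding f_def using cosh_arg_nz[OF z] by (auto intro!: derivative_eq_intros)
  moreover have "1 - (tanh (of_real k * (z + p)))\<^sup>2 = 1 / (cosh (of_real k * (z + p)))\<^sup>2"
    using cosh_arg_nz[OF z] hyperbolic_pythagoras[of "of_real k * (z + p)"]
    by (simp add: tanh_def power_divide divide_simps)
  ultimately show ?thesis by (simp add: power2_eq_square mult.assoc)
qed

lemma holo_f: "f holomorphic_on U"
  using deriv_f by (meson field_differentiable_at_within field_differentiable_def holomorphic_on_def)

lemma holo_g: "g holomorphic_on U"
proof -
  have "(\<lambda>w. coth_regular (of_real k * (w + p))) holomorphic_on U"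
    by (rule holomorphic_on_compose_gen[OF _ holomorphic_coth_regular, unfolded o_def])
      (use Im_arg in \<open>force intro!: holomorphic_intros\<close>)+
  then show ?thesis unfolding g_def[abs_def] by (intro holomorphic_intros)
qed

lemma g_eq: "w \<in> U \<Longrightarrow> w + p \<noteq> 0 \<Longrightarrow> g w = - of_real (2 * k) * coth (of_real k * (w + p)) + 2 / (w + p)"
proof -
  assume w: "w \<in> U" "w + p \<noteq> 0"
  have "coth_regular (of_real k * (w + p)) = coth (of_real k * (w + p)) - 1 / (of_real k * (w + p))"
    by (rule coth_regular_eq) (use w k_pos in simp, use Im_arg[OF w(1)] pi_gt_zero in linarith)
  moreover have "of_real (2 * k) * (1 / (of_real k * (w + p))) = 2 / (w + p)"
    using k_pos by simp
  ultimately show ?thesis by (simp only: g_def right_diff_distrib) (simp add: algebra_simps)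
qed

lemma sinh_arg_nz:
  assumes "w \<in> U" "w + p \<noteq> 0"
  shows "sinh (of_real k * (w + p)) \<noteq> 0"
proof
  assume "sinh (of_real k * (w + p)) = 0"
  then have s: "(sinh (Re (of_real k * (w + p))))\<^sup>2 + (sin (Im (of_real k * (w + p))))\<^sup>2 = 0"
    using norm_sinh_squared[of "of_real k * (w + p)"] by simp
  then have "Re (of_real k * (w + p)) = 0" "sin (Im (of_real k * (w + p))) = 0"
    by (simp_all only: sum_power2_eq_zero_iff sinh_real_zero_iff)
  moreover from this have "Im (of_real k * (w + p)) = 0"
    using sin_eq_0_pi[of "Im (of_real k * (w + p))"] Im_arg[OF assms(1)] pi_gt_zero by (simp only: abs_less_iff) linarith
  ultimately have "of_real k * (w + p) = 0" by (simp only: complex_eq_iff zero_complex.sel simp_thms)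
  then show False using assms(2) k_pos by simp
qed

lemma deriv_g:
  assumes w: "w \<in> U" "w + p \<noteq> 0"
  shows "(g has_field_derivative of_real (2 * k\<^sup>2) / (sinh (of_real k * (w + p)))\<^sup>2 - 2 / (w + p)\<^sup>2) (at w)"
proof -
  let ?s = "of_real k * (w + p)"
  have "((\<lambda>w. - of_real (2 * k) * (cosh (of_real k * (w + p)) / sinh (of_real k * (w + p))) + 2 / (w + p)) has_field_derivative
      - of_real (2 * k) * ((sinh ?s * of_real k * sinh ?s - cosh ?s * (cosh ?s * of_real k)) / (sinh ?s * sinh ?s)) + - 2 / (w + p)\<^sup>2) (at w)"
    using sinh_arg_nz[OF w] w by (intro DERIV_add DERIV_cmult DERIV_divide) (auto intro!: derivative_eq_intros simp: power2_eq_square)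
  moreover have "sinh ?s * of_real k * sinh ?s - cosh ?s * (cosh ?s * of_real k) = - of_real k"
    using hyperbolic_pythagoras[of ?s] by (simp add: power2_eq_square algebra_simps)
  ultimately have "((\<lambda>w. - of_real (2 * k) * coth (of_real k * (w + p)) + 2 / (w + p)) has_field_derivative
      of_real (2 * k\<^sup>2) / (sinh ?s)\<^sup>2 - 2 / (w + p)\<^sup>2) (at w)"
    by (simp add: coth_def power2_eq_square mult.assoc)
  then show ?thesis
  proof (rule has_field_derivative_transform_within_open)
    show "open (U - {- p})" using open_U by auto
  qed (use w g_eq in \<open>auto simp: add_eq_0_iff2\<close>)
qed

end

lemma holomorphic_has_vector_derivative_lines:
  assumes "F holomorphic_on S" "open S" "Complex x y \<in> S"
  shows "((\<lambda>t. F (Complex t y)) has_vector_derivative deriv F (Complex x y)) (at x)"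
    and "((\<lambda>t. F (Complex x t)) has_vector_derivative \<i> * deriv F (Complex x y)) (at y)"
proof -
  have "(F has_derivative (\<lambda>h. deriv F (Complex x y) * h)) (at (Complex x y))"
    using holomorphic_derivI[OF assms] by (simp add: has_field_derivative_def)
  from has_vector_derivative_row[OF this]
  show "((\<lambda>t. F (Complex t y)) has_vector_derivative deriv F (Complex x y)) (at x)"
    "((\<lambda>t. F (Complex x t)) has_vector_derivative \<i> * deriv F (Complex x y)) (at y)"
    by (simp_all add: mult.commute)
qed

lemma antiholomorphic_has_derivative:
  assumes "G holomorphic_on S" "open S" "cnj z \<in> S"
  shows "((\<lambda>z. G (cnj z)) has_derivative (\<lambda>t. deriv G (cnj z) * cnj t)) (at z)"
proof -
  have "(G has_derivative (\<lambda>h. deriv G (cnj z) * h)) (at (cnj z))"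
    using holomorphic_derivI[OF assms] by (simp add: has_field_derivative_def)
  from has_derivative_compose[OF bounded_linear_imp_has_derivative[OF bounded_linear_cnj] this]
  show ?thesis by simp
qed

lemma antiholomorphic_has_vector_derivative_lines:
  assumes "G holomorphic_on S" "open S" "cnj (Complex x y) \<in> S"
  shows "((\<lambda>t. G (cnj (Complex t y))) has_vector_derivative deriv G (cnj (Complex x y))) (at x)"
    and "((\<lambda>t. G (cnj (Complex x t))) has_vector_derivative - \<i> * deriv G (cnj (Complex x y))) (at y)"
  using has_vector_derivative_row[OF antiholomorphic_has_derivative[OF assms]]
  by (simp_all add: mult.commute)

context strip_problem
begin

definition c where "c = 2 * k\<^sup>2 / (cos (pi * y0 / l))\<^sup>2"

definition h1 where "h1 z = deriv f z + deriv g (cnj z)"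
definition h2 where "h2 z = \<i> * (deriv f z - deriv g (cnj z))"

lemma cos_pos: "cos (pi * y0 / l) > 0"
proof -
  have "\<bar>pi * y0 / l\<bar> = pi / l * \<bar>y0\<bar>" using l by (simp add: abs_mult)
  also have "\<dots> < pi / l * (l / 2)" using y0 l by (intro mult_strict_left_mono) auto
  finally have "\<bar>pi * y0 / l\<bar> < pi / 2" using l by simp
  then show ?thesis by (intro cos_gt_zero_pi) (simp_all only: abs_less_iff, linarith+)
qed

lemma p_U: "p \<in> U" using y0 l d by (intro closed_strip_U) simp

text \<open>At z = p the argument k (p + p) = i pi y0 / l is purely imaginary and cosh becomes a
  cosine. This is where the cosine in the energy comes from.\<close>

lemma deriv_f_p: "deriv f p = of_real c"
proof -
  have e: "of_real k * (p + p) = \<i> * of_real (pi * y0 / l)" using l by (simp add: k_def)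
  have "cosh (\<i> * of_real t) = of_real (cos t)" for t
    using cosh_complex[of "\<i> * of_real t"] by (simp add: cosh_field_def exp_minus cos_of_real)
  then have "cosh (of_real k * (p + p)) = of_real (cos (pi * y0 / l))" unfolding e by blast
  then show ?thesis using DERIV_imp_deriv[OF deriv_f[OF p_U]] by (simp add: c_def)
qed

lemma h_has_derivative:
  assumes z: "z \<in> U"
  shows "(h has_derivative (\<lambda>t. Re t *\<^sub>R h1 z + Im t *\<^sub>R h2 z)) (at z)"
proof -
  have "(f has_derivative (\<lambda>t. deriv f z * t)) (at z)"
    using holomorphic_derivI[OF holo_f open_U z] by (simp add: has_field_derivative_def)
  from has_derivative_add[OF this antiholomorphic_has_derivative[OF holo_g open_U cnj_U[OF z]]]
  have "(h has_derivative (\<lambda>t. deriv f z * t + deriv g (cnj z) * cnj t)) (at z)"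
    by (simp add: h_def[abs_def])
  moreover have "deriv f z * t + deriv g (cnj z) * cnj t = Re t *\<^sub>R h1 z + Im t *\<^sub>R h2 z" for t
    by (simp add: h1_def h2_def complex_eq_iff algebra_simps)
  ultimately show ?thesis by simp
qed

lemma continuous_on_U:
  "continuous_on U f" "continuous_on U (deriv f)" "continuous_on U (\<lambda>z. g (cnj z))" "continuous_on U (\<lambda>z. deriv g (cnj z))"
proof -
  show "continuous_on U f" "continuous_on U (deriv f)"
    using holo_f holomorphic_deriv[OF holo_f open_U] by (auto intro: holomorphic_on_imp_continuous_on)
  have "continuous_on U g" "continuous_on U (deriv g)"
    using holo_g holomorphic_deriv[OF holo_g open_U] by (auto intro: holomorphic_on_imp_continuous_on)
  then show "continuous_on U (\<lambda>z. g (cnj z))" "continuous_on U (\<lambda>z. deriv g (cnj z))"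
    by (auto elim!: continuous_on_compose2 intro!: continuous_intros cnj_U)
qed

lemma continuous_on_h: "continuous_on U h" "continuous_on U h1" "continuous_on U h2"
  unfolding h_def[abs_def] h1_def[abs_def] h2_def[abs_def] by (intro continuous_intros continuous_on_U)+

lemma Re_arg: "Re (of_real k * (z + p)) = k * Re z" by simp

lemma norm_f_le: "z \<in> U \<Longrightarrow> Re z \<noteq> 0 \<Longrightarrow> norm (f z) \<le> 2 * k + 2 / \<bar>Re z\<bar>"
proof -
  assume z: "z \<in> U" "Re z \<noteq> 0"
  have "norm (tanh (of_real k * (z + p))) \<le> 1 + 1 / (k * \<bar>Re z\<bar>)"
    using norm_tanh_coth_le(1)[of "of_real k * (z + p)"] z(2) k_pos unfolding Re_arg by (simp add: abs_mult)
  then have "2 * k * norm (tanh (of_real k * (z + p))) \<le> 2 * k * (1 + 1 / (k * \<bar>Re z\<bar>))"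
    using k_pos by (intro mult_left_mono) auto
  also have "\<dots> = 2 * k + 2 / \<bar>Re z\<bar>" using k_pos z(2) by (simp add: distrib_left)
  finally show ?thesis using k_pos by (simp add: f_def norm_mult)
qed

lemma shift_nz: "Re w \<noteq> 0 \<Longrightarrow> w + p \<noteq> 0" by (auto simp: complex_eq_iff)

lemma norm_shift: "\<bar>Re w\<bar> \<le> norm (w + p)" using abs_Re_le_cmod[of "w + p"] by simp

lemma norm_g_le: "w \<in> U \<Longrightarrow> Re w \<noteq> 0 \<Longrightarrow> norm (g w) \<le> 2 * k + 4 / \<bar>Re w\<bar>"
proof -
  assume z: "w \<in> U" "Re w \<noteq> 0"
  have "norm (coth (of_real k * (w + p))) \<le> 1 + 1 / (k * \<bar>Re w\<bar>)"
    using norm_tanh_coth_le(2)[of "of_real k * (w + p)"] z(2) k_pos unfolding Re_arg by (simp add: abs_mult)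
  then have "2 * k * norm (coth (of_real k * (w + p))) \<le> 2 * k * (1 + 1 / (k * \<bar>Re w\<bar>))"
    using k_pos by (intro mult_left_mono) auto
  also have "\<dots> = 2 * k + 2 / \<bar>Re w\<bar>" using k_pos z(2) by (simp add: distrib_left)
  finally have 1: "norm (- of_real (2 * k) * coth (of_real k * (w + p))) \<le> 2 * k + 2 / \<bar>Re w\<bar>"
    using k_pos by (simp add: norm_mult)
  have "norm (2 / (w + p)) \<le> 2 / \<bar>Re w\<bar>" unfolding norm_divide
    using norm_shift[of w] z(2) by (simp add: frac_le)
  then have "norm (- of_real (2 * k) * coth (of_real k * (w + p)) + 2 / (w + p)) \<le> 2 * k + 2 / \<bar>Re w\<bar> + 2 / \<bar>Re w\<bar>"
    by (intro norm_triangle_le add_mono 1)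
  then show ?thesis unfolding g_eq[OF z(1) shift_nz[OF z(2)]] by simp
qed

lemma norm_inverse_square_le:
  assumes "x \<noteq> 0" "k * \<bar>x\<bar> \<le> norm (a::complex)"
  shows "norm (of_real (2 * k\<^sup>2) / a\<^sup>2) \<le> 2 / x\<^sup>2"
proof -
  have "(k * \<bar>x\<bar>)\<^sup>2 \<le> (norm a)\<^sup>2" using assms k_pos by (intro power_mono) auto
  moreover have "0 < (k * \<bar>x\<bar>)\<^sup>2" using assms k_pos by simp
  ultimately have "2 * k\<^sup>2 / (norm a)\<^sup>2 \<le> 2 * k\<^sup>2 / (k * \<bar>x\<bar>)\<^sup>2" by (intro frac_le) auto
  also have "\<dots> = 2 / x\<^sup>2" using k_pos assms by (simp add: power_mult_distrib)
  finally show ?thesis using k_pos by (simp add: norm_divide norm_mult norm_power)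
qed

lemma norm_deriv_f_le: "z \<in> U \<Longrightarrow> Re z \<noteq> 0 \<Longrightarrow> norm (deriv f z) \<le> 2 / (Re z)\<^sup>2"
  unfolding DERIV_imp_deriv[OF deriv_f]
  using norm_cosh_sinh_lower(1)[of "of_real k * (z + p)"] k_pos
  by (intro norm_inverse_square_le) (simp_all add: abs_mult)

lemma norm_deriv_g_le: "w \<in> U \<Longrightarrow> Re w \<noteq> 0 \<Longrightarrow> norm (deriv g w) \<le> 4 / (Re w)\<^sup>2"
proof -
  assume w: "w \<in> U" "Re w \<noteq> 0"
  have 1: "norm (of_real (2 * k\<^sup>2) / (sinh (of_real k * (w + p)))\<^sup>2) \<le> 2 / (Re w)\<^sup>2"
    using norm_cosh_sinh_lower(2)[of "of_real k * (w + p)"] k_pos w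
    by (intro norm_inverse_square_le) (simp_all add: abs_mult)
  have "(Re w)\<^sup>2 \<le> (norm (w + p))\<^sup>2" using power_mono[OF norm_shift[of w], of 2] by simp
  then have "2 / (norm (w + p))\<^sup>2 \<le> 2 / (Re w)\<^sup>2" using w(2) by (intro frac_le) auto
  then have 2: "norm (2 / (w + p)\<^sup>2) \<le> 2 / (Re w)\<^sup>2" by (simp add: norm_divide norm_power)
  have "norm (of_real (2 * k\<^sup>2) / (sinh (of_real k * (w + p)))\<^sup>2 - 2 / (w + p)\<^sup>2) \<le> 2 / (Re w)\<^sup>2 + 2 / (Re w)\<^sup>2"
    by (rule order_trans[OF norm_triangle_ineq4 add_mono[OF 1 2]])
  then show ?thesis using DERIV_imp_deriv[OF deriv_g[OF w(1) shift_nz[OF w(2)]]] by simp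
qed

text \<open>The gradient decays even quadratically, but 1 / |Re z| is all that the vertical sides in
  Green's formula need. The constants are 4 k + 6 = (2 k + 2) + (2 k + 4) and 6 = 2 + 4, from the
  bounds on \<open>f\<close>, \<open>g\<close> and their derivatives.\<close>

lemma norm_h_le:
  assumes "z \<in> U" "1 \<le> \<bar>Re z\<bar>"
  shows "norm (h z) \<le> 4 * k + 6" "norm (h1 z) \<le> 6 / \<bar>Re z\<bar>"
proof -
  have nz: "Re z \<noteq> 0" using assms by auto
  have "2 / \<bar>Re z\<bar> \<le> 2" "4 / \<bar>Re z\<bar> \<le> 4" using assms by (auto simp: divide_le_eq)
  then show "norm (h z) \<le> 4 * k + 6"
    using norm_triangle_ineq[of "f z" "g (cnj z)"] norm_f_le[OF assms(1) nz] norm_g_le[OF cnj_U[OF assms(1)]] nz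
    unfolding h_def by simp
  have "norm (h1 z) \<le> 2 / (Re z)\<^sup>2 + 4 / (Re z)\<^sup>2"
    using norm_triangle_ineq[of "deriv f z" "deriv g (cnj z)"] norm_deriv_f_le[OF assms(1) nz] norm_deriv_g_le[OF cnj_U[OF assms(1)]] nz
    unfolding h1_def by simp
  also have "\<dots> = 6 / \<bar>Re z\<bar> * (1 / \<bar>Re z\<bar>)" using nz by (simp add: power2_eq_square)
  also have "\<dots> \<le> 6 / \<bar>Re z\<bar> * 1" using assms by (intro mult_left_mono) auto
  finally show "norm (h1 z) \<le> 6 / \<bar>Re z\<bar>" by simp
qed

text \<open>On the boundary \<open>z\<close> and \<open>cnj z\<close> differ by i l, and k i l = i
  pi / 2 is the shift that exchanges sinh and cosh up to a factor i. So tanh and coth cancel in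
  \<open>h\<close>, and the squares in the derivatives become opposite, which expresses the
  derivative of \<open>g\<close> by that of \<open>f\<close>.\<close>

lemma boundary:
  assumes "\<bar>Im z\<bar> = l / 2"
  shows "h z = 2 / (cnj z + p)" "deriv g (cnj z) = - deriv f z - 2 / (cnj z + p)\<^sup>2" "cnj z + p \<noteq> 0"
proof -
  have zU: "z \<in> U" using assms by (intro closed_strip_U) simp
  have "Im (cnj z + p) \<noteq> 0" using assms y0 l by auto
  then show nz: "cnj z + p \<noteq> 0" by (metis zero_complex.sel(2))
  let ?s = "of_real k * (cnj z + p)"
  have "sinh ?s \<noteq> 0" by (rule sinh_arg_nz[OF cnj_U[OF zU] nz])
  have kl: "of_real k * (\<i> * of_real l) = \<i> * of_real pi / 2" using l by (simp add: k_def)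
  consider "Im z = l / 2" | "Im z = - l / 2" using assms by linarith
  then have ts: "tanh (of_real k * (z + p)) = coth ?s \<and> (cosh (of_real k * (z + p)))\<^sup>2 = - (sinh ?s)\<^sup>2"
  proof cases
    case 1
    then have "z = cnj z + \<i> * of_real l" by (simp add: complex_eq_iff)
    then have "of_real k * (z + p) = ?s + \<i> * of_real pi / 2"
      unfolding kl[symmetric] by (metis (no_types, lifting) add.assoc add.commute distrib_left)
    then show ?thesis by (simp add: tanh_def coth_def cosh_add_i_half_pi power_mult_distrib)
  next
    case 2
    then have "cnj z = z + \<i> * of_real l" by (simp add: complex_eq_iff)
    then have "?s = of_real k * (z + p) + \<i> * of_real pi / 2"
      unfolding kl[symmetric] by (metis (no_types, lifting) add.assoc add.commute distrib_left)
    then show ?thesis by (simp add: tanh_def coth_def cosh_add_i_half_pi power_mult_distrib)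
  qed
  show "h z = 2 / (cnj z + p)"
    unfolding h_def g_eq[OF cnj_U[OF zU] nz] using ts by (simp add: f_def)
  show "deriv g (cnj z) = - deriv f z - 2 / (cnj z + p)\<^sup>2"
    using DERIV_imp_deriv[OF deriv_g[OF cnj_U[OF zU] nz]] DERIV_imp_deriv[OF deriv_f[OF zU]] ts by simp
qed

end

lemma Re_has_real_derivative:
  "(f has_vector_derivative f') (at x) \<Longrightarrow> ((\<lambda>t. Re (f t)) has_real_derivative Re f') (at x)"
  using bounded_linear.has_vector_derivative[OF bounded_linear_Re]
  by (simp add: has_real_derivative_iff_has_vector_derivative)

lemma cnj_has_vector_derivative:
  "(f has_vector_derivative f') (at x) \<Longrightarrow> ((\<lambda>t. cnj (f t)) has_vector_derivative cnj f') (at x)"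
  by (rule bounded_linear.has_vector_derivative[OF bounded_linear_cnj])

section \<open>Gluing across the boundary lines and admissibility\<close>

context strip_problem
begin

definition K1 where "K1 z = - 2 / (cnj z + p)\<^sup>2"
definition K2 where "K2 z = 2 * \<i> / (cnj z + p)\<^sup>2"
definition v1 where "v1 z = (if z \<in> strip l then h1 z else K1 z)"
definition v2 where "v2 z = (if z \<in> strip l then h2 z else K2 z)"

lemma pole_iff: "cnj z + p = 0 \<longleftrightarrow> z = p"
  by (auto simp: complex_eq_iff)

lemma strip_formula_eq_h:
  assumes "z \<in> U" "z \<noteq> p"
  shows "strip_formula l y0 z = h z"
proof -
  have nz: "cnj z + p \<noteq> 0" using assms pole_iff by simp
  have k: "pi / l = 2 * k" "pi / (2 * l) = k" using l by (simp_all add: k_def)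
  show ?thesis
    unfolding strip_formula_def h_def f_def g_eq[OF cnj_U[OF assms(1)] nz] k by simp
qed

lemma isCont_h: "z \<in> U \<Longrightarrow> isCont h z"
  using continuous_on_h(1) open_U continuous_on_eq_continuous_at by blast

text \<open>The case split is moved to the closed strip, since both formulas agree on the boundary
  lines. With two closed pieces that overlap exactly in these lines, continuity of the whole map
  follows by gluing.\<close>

lemma u_opt_eq: "u_opt l y0 z = (if \<bar>Im z\<bar> \<le> l / 2 then h z else 2 / (cnj z + p))"
proof -
  have "h \<midarrow>p\<rightarrow> h p" using isCont_h[OF p_U] by (simp add: isCont_def)
  then have "strip_formula l y0 \<midarrow>p\<rightarrow> h p"
    by (rule Lim_transform_within_open[OF _ open_U p_U]) (simp add: strip_formula_eq_h)
  then have Lim: "Lim (at p) (strip_formula l y0) = h p" by (rule tendsto_Lim[rotated]) simp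
  consider "z = p" | "z \<noteq> p" "z \<in> strip l" | "z \<noteq> p" "z \<notin> strip l" by blast
  then show ?thesis
  proof cases
    case 1
    then show ?thesis using Lim y0 l by (auto simp: u_opt_def)
  next
    case 2
    then have "\<bar>Im z\<bar> \<le> l / 2" by (auto simp: strip_def)
    then show ?thesis using 2 strip_formula_eq_h[OF strip_U[OF 2(2)] 2(1)] by (simp add: u_opt_def)
  next
    case 3
    then have "\<bar>Im z\<bar> = l / 2 \<or> \<not> \<bar>Im z\<bar> \<le> l / 2" unfolding strip_def by auto
    then show ?thesis using 3 boundary(1)[of z] by (auto simp: u_opt_def)
  qed
qed

lemma strip_abs: "z \<in> strip l \<Longrightarrow> \<bar>Im z\<bar> \<le> l / 2"
  unfolding strip_def by auto

lemma off_strip_nz: "z \<notin> strip l \<Longrightarrow> cnj z + p \<noteq> 0"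
  using y0 l by (auto simp: pole_iff strip_def)

lemma K_has_derivative:
  assumes z: "cnj z + p \<noteq> 0"
  shows "((\<lambda>z. 2 / (cnj z + p)) has_derivative (\<lambda>t. Re t *\<^sub>R K1 z + Im t *\<^sub>R K2 z)) (at z)"
proof -
  have "((\<lambda>w. 2 / (w + p)) has_field_derivative - 2 / (cnj z + p)\<^sup>2) (at (cnj z))"
    using z by (auto intro!: derivative_eq_intros simp: power2_eq_square)
  then have "((\<lambda>w. 2 / (w + p)) has_derivative (\<lambda>t. - 2 / (cnj z + p)\<^sup>2 * t)) (at (cnj z))"
    unfolding has_field_derivative_def .
  from has_derivative_compose[OF bounded_linear_imp_has_derivative[OF bounded_linear_cnj] this]
  have "((\<lambda>z. 2 / (cnj z + p)) has_derivative (\<lambda>t. - 2 / (cnj z + p)\<^sup>2 * cnj t)) (at z)" by simp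
  moreover have "- 2 / (cnj z + p)\<^sup>2 * cnj t = Re t *\<^sub>R K1 z + Im t *\<^sub>R K2 z" for t
  proof -
    have "K2 z = - \<i> * K1 z" by (simp add: K1_def K2_def)
    then have "K1 z * cnj t = Re t *\<^sub>R K1 z + Im t *\<^sub>R K2 z" by (simp add: complex_eq_iff algebra_simps)
    then show ?thesis by (simp add: K1_def)
  qed
  ultimately show ?thesis by simp
qed

lemma continuous_on_K: "continuous_on (- strip l) (\<lambda>z. 2 / (cnj z + p))" "continuous_on (- strip l) K1" "continuous_on (- strip l) K2"
  unfolding K1_def[abs_def] K2_def[abs_def] using off_strip_nz by (auto intro!: continuous_intros)

text \<open>Although the strip is open, \<open>a\<close> is bounded on its bounded parts because it
  is continuous up to and beyond the boundary lines.\<close>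

lemma piecewise_measurable_bounded:
  fixes a b :: "complex \<Rightarrow> complex"
  assumes a: "continuous_on U a" and b: "continuous_on (- strip l) b"
  shows "(\<lambda>z. if z \<in> strip l then a z else b z) \<in> borel_measurable borel"
    and "compact C \<Longrightarrow> \<exists>B. \<forall>z\<in>C. norm (if z \<in> strip l then a z else b z) \<le> B"
proof -
  have "continuous_on (strip l) a" using a strip_U by (auto intro: continuous_on_subset)
  then have "(\<lambda>z. indicator (strip l) z *\<^sub>R a z + indicator (- strip l) z *\<^sub>R b z) \<in> borel_measurable borel"
    using b by (intro borel_measurable_add borel_measurable_continuous_on_indicator) (auto simp: strip_sets borel_comp)
  moreover have "(\<lambda>z. indicator (strip l) z *\<^sub>R a z + indicator (- strip l) z *\<^sub>R b z) = (\<lambda>z. if z \<in> strip l then a z else b z)"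
    by (auto simp: fun_eq_iff)
  ultimately show "(\<lambda>z. if z \<in> strip l then a z else b z) \<in> borel_measurable borel" by simp
  assume C: "compact C"
  have "closed {z. \<bar>Im z\<bar> \<le> l / 2}" by (intro closed_Collect_le continuous_intros)
  then have "compact (C \<inter> {z. \<bar>Im z\<bar> \<le> l / 2})" by (rule compact_Int_closed[OF C])
  then have "compact (a ` (C \<inter> {z. \<bar>Im z\<bar> \<le> l / 2}))"
    by (rule compact_continuous_image[rotated]) (rule continuous_on_subset[OF a], use closed_strip_U in blast)
  then obtain A where A: "\<And>z. z \<in> C \<Longrightarrow> \<bar>Im z\<bar> \<le> l / 2 \<Longrightarrow> norm (a z) \<le> A"
    using compact_imp_bounded bounded_iff by (metis (mono_tags, lifting) IntI imageI mem_Collect_eq)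
  have "compact (C \<inter> - strip l)" using open_strip by (intro compact_Int_closed[OF C]) auto
  then have "compact (b ` (C \<inter> - strip l))"
    by (rule compact_continuous_image[rotated]) (rule continuous_on_subset[OF b], blast)
  then obtain B where B: "\<And>z. z \<in> C \<Longrightarrow> z \<notin> strip l \<Longrightarrow> norm (b z) \<le> B"
    using compact_imp_bounded bounded_iff by (metis (mono_tags, lifting) ComplI IntI imageI)
  show "\<exists>B. \<forall>z\<in>C. norm (if z \<in> strip l then a z else b z) \<le> B"
  proof (intro exI ballI)
    fix z assume "z \<in> C"
    then show "norm (if z \<in> strip l then a z else b z) \<le> max A B"
      using A[of z] B[of z] strip_abs[of z] by (cases "z \<in> strip l") auto
  qed
qed

lemma piecewise: "piecewise_differentiable (u_opt l y0) v1 v2 (l / 2)"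
proof
  have cl: "closed {z. \<bar>Im z\<bar> \<le> l / 2}" "closed (- strip l)"
    using open_strip by (auto intro!: closed_Collect_le continuous_intros)
  have UN: "{z. \<bar>Im z\<bar> \<le> l / 2} \<union> - strip l = UNIV" by (auto simp: strip_def)
  have "continuous_on ({z. \<bar>Im z\<bar> \<le> l / 2} \<union> - strip l) (\<lambda>z. if \<bar>Im z\<bar> \<le> l / 2 then h z else 2 / (cnj z + p))"
  proof (rule continuous_on_cases[OF cl])
    show "continuous_on {z. \<bar>Im z\<bar> \<le> l / 2} h"
      using continuous_on_h(1) closed_strip_U by (auto intro: continuous_on_subset)
    show "continuous_on (- strip l) (\<lambda>z. 2 / (cnj z + p))" by (rule continuous_on_K)
    have "h z = 2 / (cnj z + p)" if "\<bar>Im z\<bar> \<le> l / 2" "z \<notin> strip l" for z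
    proof -
      have "\<bar>Im z\<bar> = l / 2" using that unfolding strip_def by auto
      then show ?thesis by (rule boundary)
    qed
    then show "\<forall>z. z \<in> {z. \<bar>Im z\<bar> \<le> l / 2} \<and> \<not> \<bar>Im z\<bar> \<le> l / 2 \<or> z \<in> - strip l \<and> \<bar>Im z\<bar> \<le> l / 2 \<longrightarrow> h z = 2 / (cnj z + p)"
      by blast
  qed
  then show "continuous_on UNIV (u_opt l y0)" unfolding UN by (simp add: u_opt_eq[abs_def])
  note m1 = piecewise_measurable_bounded[OF continuous_on_h(2) continuous_on_K(2)]
  note m2 = piecewise_measurable_bounded[OF continuous_on_h(3) continuous_on_K(3)]
  show "v1 \<in> borel_measurable borel" "v2 \<in> borel_measurable borel"
    using m1(1) m2(1) by (simp_all only: v1_def[abs_def] v2_def[abs_def])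
  show "\<exists>B. \<forall>z\<in>C. norm (v1 z) \<le> B" "\<exists>B. \<forall>z\<in>C. norm (v2 z) \<le> B" if "compact C" for C
    using m1(2)[OF that] m2(2)[OF that] by (simp_all only: v1_def v2_def)
  fix z assume z: "\<bar>Im z\<bar> \<noteq> l / 2"
  show "(u_opt l y0 has_derivative (\<lambda>t. Re t *\<^sub>R v1 z + Im t *\<^sub>R v2 z)) (at z)"
  proof (cases "z \<in> strip l")
    case True
    have "(u_opt l y0 has_derivative (\<lambda>t. Re t *\<^sub>R h1 z + Im t *\<^sub>R h2 z)) (at z)"
      by (rule has_derivative_transform_within_open[OF h_has_derivative[OF strip_U[OF True]] open_strip True])
        (auto simp: u_opt_eq strip_def)
    then show ?thesis using True by (simp add: v1_def v2_def)
  next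
    case False
    then have z': "z \<in> {z. \<bar>Im z\<bar> > l / 2}" using z unfolding strip_def by auto
    have o: "open {z. \<bar>Im z\<bar> > l / 2}" by (intro open_Collect_less continuous_intros)
    have "(u_opt l y0 has_derivative (\<lambda>t. Re t *\<^sub>R K1 z + Im t *\<^sub>R K2 z)) (at z)"
      by (rule has_derivative_transform_within_open[OF K_has_derivative[OF off_strip_nz[OF False]] o z'])
        (auto simp: u_opt_eq)
    then show ?thesis using False by (simp add: v1_def v2_def)
  qed
qed

lemma isCont_u_opt: "isCont (u_opt l y0) p"
  using piecewise_differentiable.cont[OF piecewise] by (simp add: continuous_on_eq_continuous_at)

lemma u_opt_admissible: "u_opt l y0 \<in> admissible l y0"
proof -
  have "u_opt l y0 z = 2 / (cnj z + \<i> * of_real y0)" if "z \<notin> strip l" for z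
    using off_strip_nz[OF that] that by (simp add: u_opt_def pole_iff)
  then show ?thesis
    using piecewise_differentiable.H1_loc[OF piecewise] by (simp add: admissible_def)
qed

section \<open>Energy inside the strip\<close>

definition F where "F z = (if z = p then deriv (deriv f) p else (deriv f z - deriv f p) / (z - p))"
text \<open>The second horizontal derivative of \<open>h\<close>. By harmonicity the second vertical
  one is its negative, and the two cancel in the divergence.\<close>

definition h11 where "h11 z = deriv (deriv f) z + deriv (deriv g) (cnj z)"

lemma holo_deriv: "deriv f holomorphic_on U" "deriv g holomorphic_on U"
  using holomorphic_deriv[OF holo_f open_U] holomorphic_deriv[OF holo_g open_U] by auto

lemma holo_F: "F holomorphic_on U"
  unfolding F_def[abs_def] by (rule pole_lemma_open[OF holo_deriv(1) open_U])

lemma continuous_on_F: "continuous_on U F" "continuous_on U (deriv F)" "continuous_on U h11"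
proof -
  show "continuous_on U F" "continuous_on U (deriv F)"
    using holo_F holomorphic_deriv[OF holo_F open_U] by (auto intro: holomorphic_on_imp_continuous_on)
  have dd: "continuous_on U (deriv (deriv f))" "continuous_on U (deriv (deriv g))"
    using holomorphic_deriv[OF holo_deriv(1) open_U] holomorphic_deriv[OF holo_deriv(2) open_U]
    by (auto intro: holomorphic_on_imp_continuous_on)
  have "continuous_on U (\<lambda>z. deriv (deriv g) (cnj z))"
    by (rule continuous_on_compose2[OF dd(2) continuous_on_cnj[OF continuous_on_id]]) (use cnj_U in blast)
  then show "continuous_on U h11" unfolding h11_def[abs_def] by (intro continuous_on_add dd)
qed

lemma h_lines:
  assumes z: "Complex x y \<in> U"
  shows "((\<lambda>t. h (Complex t y)) has_vector_derivative h1 (Complex x y)) (at x)"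
    and "((\<lambda>t. h (Complex x t)) has_vector_derivative h2 (Complex x y)) (at y)"
    and "((\<lambda>t. h1 (Complex t y)) has_vector_derivative h11 (Complex x y)) (at x)"
    and "((\<lambda>t. h2 (Complex x t)) has_vector_derivative - h11 (Complex x y)) (at y)"
proof -
  show "((\<lambda>t. h (Complex t y)) has_vector_derivative h1 (Complex x y)) (at x)"
    "((\<lambda>t. h (Complex x t)) has_vector_derivative h2 (Complex x y)) (at y)"
    using has_vector_derivative_row[OF h_has_derivative[OF z]] by simp_all
  note L = holomorphic_has_vector_derivative_lines[OF holo_deriv(1) open_U z]
    antiholomorphic_has_vector_derivative_lines[OF holo_deriv(2) open_U cnj_U[OF z]]
  show "((\<lambda>t. h1 (Complex t y)) has_vector_derivative h11 (Complex x y)) (at x)"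
    unfolding h1_def h11_def by (intro has_vector_derivative_add L)
  have "((\<lambda>t. h2 (Complex x t)) has_vector_derivative \<i> * (\<i> * deriv (deriv f) (Complex x y) - - \<i> * deriv (deriv g) (cnj (Complex x y)))) (at y)"
    unfolding h2_def by (intro has_vector_derivative_mult_right has_vector_derivative_diff L)
  then show "((\<lambda>t. h2 (Complex x t)) has_vector_derivative - h11 (Complex x y)) (at y)"
    by (simp add: h11_def algebra_simps)
qed

text \<open>With q = z - p and w = cnj q, the boundary values give cnj h = 2 / q and h2 = i (2 f' +
  2 / w^2). The product contains 4 i f' / q, which \<open>4 * \<i> * F z\<close> removes up to 4 i c
  / q; what is left depends on q alone and is rationalised by q w = |q|^2.\<close>

lemma boundary_flux:
  assumes "\<bar>Im z\<bar> = l / 2"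
  defines "x \<equiv> Re z" and "s \<equiv> Im z - y0"
  shows "Re (cnj (h z) * h2 z) - Re (4 * \<i> * F z) = 4 * c * s * (1 / (x\<^sup>2 + s\<^sup>2)) - 4 * s * (1 / (x\<^sup>2 + s\<^sup>2)\<^sup>2)"
proof -
  define q where "q = z - p"
  define w where "w = cnj z + p"
  define N where "N = (of_real (x\<^sup>2 + s\<^sup>2) :: complex)"
  have w: "w = cnj q" "q = Complex x s" by (simp_all add: w_def q_def x_def s_def complex_eq_iff)
  have nz: "w \<noteq> 0" using boundary(3)[OF assms(1)] by (simp add: w_def)
  then have q: "q \<noteq> 0" using w by auto
  have qw: "q * w = N" unfolding w N_def by (simp add: complex_eq_iff power2_eq_square)
  have N0: "N \<noteq> 0" using nz q qw by auto
  have 1: "cnj (h z) = 2 / q" unfolding boundary(1)[OF assms(1)] w_def[symmetric] by (simp add: w)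
  have 2: "h2 z = \<i> * (2 * deriv f z + 2 / w\<^sup>2)"
    unfolding h2_def boundary(2)[OF assms(1)] w_def by simp
  have 3: "F z = (deriv f z - of_real c) / q"
    using q by (simp add: F_def q_def deriv_f_p)
  have 4: "\<i> / q = \<i> * w / N" "\<i> / (q * w\<^sup>2) = \<i> * q / N\<^sup>2"
    using q nz by (simp_all add: qw[symmetric] power2_eq_square)
  have "2 / q * (\<i> * (2 * D + 2 / w\<^sup>2)) - 4 * \<i> * ((D - of_real c) / q) = 4 * of_real c * (\<i> / q) + 4 * (\<i> / (q * w\<^sup>2))" for D
    using q nz by (simp add: field_simps)
  then have "cnj (h z) * h2 z - 4 * \<i> * F z = 4 * of_real c * (\<i> * w / N) + 4 * (\<i> * q / N\<^sup>2)"
    unfolding 1 2 3 4 by blast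
  then have "Re (cnj (h z) * h2 z) - Re (4 * \<i> * F z) = Re (4 * of_real c * (\<i> * w / N) + 4 * (\<i> * q / N\<^sup>2))"
    by (metis minus_complex.sel(1))
  also have "Re (4 * of_real c * (\<i> * w / N) + 4 * (\<i> * q / N\<^sup>2)) = 4 * c * s * (1 / (x\<^sup>2 + s\<^sup>2)) - 4 * s * (1 / (x\<^sup>2 + s\<^sup>2)\<^sup>2)"
  proof -
    have "Re (\<i> * w / N) = s / (x\<^sup>2 + s\<^sup>2)" "Re (\<i> * q / N\<^sup>2) = - s / (x\<^sup>2 + s\<^sup>2)\<^sup>2"
      unfolding N_def of_real_power[symmetric] Re_divide_of_real by (simp_all add: w)
    moreover have "Re (4 * of_real c * (\<i> * w / N) + 4 * (\<i> * q / N\<^sup>2)) = 4 * c * Re (\<i> * w / N) + 4 * Re (\<i> * q / N\<^sup>2)"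
      by (simp del: times_divide_eq_right)
    ultimately show ?thesis by simp
  qed
  finally show ?thesis .
qed

text \<open>The two boundary lines lie at distances \<open>sp\<close> and \<open>sm\<close> from the
  pole, and each contributes 4 pi c - 2 pi / s^2 by the integrals of the first two Cauchy kernels.
  On the lower line the relative height is -\<open>sm\<close>, and the sign is undone by the
  opposite orientation.\<close>

lemma strip_energy:
  defines "I \<equiv> 8 * pi * c - 2 * pi / (l / 2 - y0)\<^sup>2 - 2 * pi / (l / 2 + y0)\<^sup>2"
  shows "(\<integral>\<^sup>+z. ennreal (indicator {z. \<bar>Im z\<bar> \<le> l / 2} z * ((norm (h1 z))\<^sup>2 + (norm (h2 z))\<^sup>2)) \<partial>lborel) = ennreal I"
    and "0 \<le> I"
proof -
  define S where "S = {z. \<bar>Im z\<bar> \<le> l / 2}"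
  have SU: "S \<subseteq> U" using closed_strip_U by (auto simp: S_def)
  note cU = continuous_on_subset[OF continuous_on_h(1) SU] continuous_on_subset[OF continuous_on_h(2) SU]
    continuous_on_subset[OF continuous_on_h(3) SU] continuous_on_subset[OF continuous_on_F(1) SU]
    continuous_on_subset[OF continuous_on_F(2) SU] continuous_on_subset[OF continuous_on_F(3) SU]
  define P where "P z = Re (cnj (h z) * h1 z) - Re (4 * F z)" for z
  define Q where "Q z = Re (cnj (h z) * h2 z) - Re (4 * \<i> * F z)" for z
  define P1 where "P1 z = Re (cnj (h z) * h11 z + cnj (h1 z) * h1 z) - Re (4 * deriv F z)" for z
  define Q2 where "Q2 z = Re (cnj (h z) * (- h11 z) + cnj (h2 z) * h2 z) - Re (4 * \<i> * (\<i> * deriv F z))" for z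
  \<comment> \<open>The terms with \<open>h11\<close> cancel since \<open>h\<close> is harmonic, and
    those with \<open>deriv F\<close> cancel because the square of i is -1.\<close>
  have sum: "P1 z + Q2 z = (norm (h1 z))\<^sup>2 + (norm (h2 z))\<^sup>2" for z
    unfolding P1_def Q2_def cmod_power2 by (simp add: power2_eq_square)
  define sp where "sp = l / 2 - y0"
  define sm where "sm = l / 2 + y0"
  have s: "sp > 0" "sm > 0" using y0 by (auto simp: sp_def sm_def)
  \<comment> \<open>The decay constant adds the bounds |h| \<le> 4 k + 6 and |h1| \<le> 6 / |x| for
    the first part of \<open>P\<close>, and |F| \<le> (2 + |c|) / |x| for the second, where 2 bounds
    |f'| for |x| \<ge> 1.\<close>
  note green = green_strip[of "l / 2" S P P1 Q2 Q "(4 * k + 6) * 6 + 4 * (2 + \<bar>c\<bar>)" I, unfolded sum]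
  have cP: "continuous_on S P" unfolding P_def[abs_def] by (intro continuous_intros cU)
  have cP1: "continuous_on S P1" unfolding P1_def[abs_def] by (intro continuous_intros cU)
  have cQ2: "continuous_on S Q2" unfolding Q2_def[abs_def] by (intro continuous_intros cU)
  have dP: "((\<lambda>t. P (Complex t y)) has_real_derivative P1 (Complex x y)) (at x)"
    and dQ: "((\<lambda>t. Q (Complex x t)) has_real_derivative Q2 (Complex x y)) (at y)" if "Complex x y \<in> S" for x y
  proof -
    have z: "Complex x y \<in> U" using that SU by auto
    note FL = holomorphic_has_vector_derivative_lines[OF holo_F open_U z]
    show "((\<lambda>t. P (Complex t y)) has_real_derivative P1 (Complex x y)) (at x)"
      unfolding P_def P1_def
      by (intro DERIV_diff Re_has_real_derivative has_vector_derivative_mult has_vector_derivative_mult_right cnj_has_vector_derivative h_lines[OF z] FL)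
    show "((\<lambda>t. Q (Complex x t)) has_real_derivative Q2 (Complex x y)) (at y)"
      unfolding Q_def Q2_def
      by (intro DERIV_diff Re_has_real_derivative has_vector_derivative_mult has_vector_derivative_mult_right cnj_has_vector_derivative h_lines[OF z] FL)
  qed
  have decay: "\<bar>P z\<bar> \<le> ((4 * k + 6) * 6 + 4 * (2 + \<bar>c\<bar>)) / \<bar>Re z\<bar>" if z: "z \<in> S" "1 \<le> \<bar>Re z\<bar>" for z
  proof -
    have zU: "z \<in> U" using z SU by auto
    have nz: "Re z \<noteq> 0" using z by auto
    note hb = norm_h_le[OF zU z(2)]
    have "norm (h z) * norm (h1 z) \<le> (4 * k + 6) * (6 / \<bar>Re z\<bar>)"
      using hb k_pos by (intro mult_mono) auto
    moreover have "norm (F z) \<le> (2 + \<bar>c\<bar>) / \<bar>Re z\<bar>"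
    proof -
      have zp: "z \<noteq> p" "\<bar>Re z\<bar> \<le> norm (z - p)" using nz abs_Re_le_cmod[of "z - p"] by auto
      have "1\<^sup>2 \<le> \<bar>Re z\<bar>\<^sup>2" using z(2) by (intro power_mono) auto
      then have "2 / (Re z)\<^sup>2 \<le> 2" using nz by (simp add: divide_le_eq)
      then have "norm (deriv f z) \<le> 2" using norm_deriv_f_le[OF zU nz] by linarith
      then have "norm (deriv f z - of_real c) \<le> 2 + \<bar>c\<bar>"
        using norm_triangle_ineq4[of "deriv f z" "of_real c"] by simp
      then show ?thesis unfolding F_def using zp nz by (simp add: deriv_f_p norm_divide frac_le)
    qed
    moreover have "\<bar>P z\<bar> \<le> norm (h z) * norm (h1 z) + 4 * norm (F z)"
      using abs_Re_le_cmod[of "cnj (h z) * h1 z"] abs_Re_le_cmod[of "4 * F z"] unfolding P_def norm_mult by simp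
    ultimately have "\<bar>P z\<bar> \<le> (4 * k + 6) * (6 / \<bar>Re z\<bar>) + 4 * ((2 + \<bar>c\<bar>) / \<bar>Re z\<bar>)" by linarith
    then show ?thesis by (simp add: add_divide_distrib)
  qed
  have flux: "has_bochner_integral lborel (\<lambda>x. Q (Complex x (l / 2)) - Q (Complex x (- (l / 2)))) I"
  proof -
    have Q: "Q (Complex x (l / 2)) - Q (Complex x (- (l / 2))) =
      (4 * c * sp * (1 / (x\<^sup>2 + sp\<^sup>2)) - 4 * sp * (1 / (x\<^sup>2 + sp\<^sup>2)\<^sup>2)) +
      (4 * c * sm * (1 / (x\<^sup>2 + sm\<^sup>2)) - 4 * sm * (1 / (x\<^sup>2 + sm\<^sup>2)\<^sup>2))" for x
    proof -
      have "(- (l / 2) - y0)\<^sup>2 = sm\<^sup>2" by (simp add: sm_def power2_eq_square algebra_simps)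
      moreover have "- (l / 2) - y0 = - sm" by (simp add: sm_def)
      ultimately show ?thesis
        using boundary_flux[of "Complex x (l / 2)"] boundary_flux[of "Complex x (- (l / 2))"] l
        unfolding Q_def sp_def by simp
    qed
    have "has_bochner_integral lborel (\<lambda>x. Q (Complex x (l / 2)) - Q (Complex x (- (l / 2))))
      ((4 * c * sp * (pi / sp) - 4 * sp * (pi / (2 * sp ^ 3))) + (4 * c * sm * (pi / sm) - 4 * sm * (pi / (2 * sm ^ 3))))"
      unfolding Q by (intro has_bochner_integral_add has_bochner_integral_diff has_bochner_integral_mult_right cauchy_kernel_integrals s)
    moreover have t: "4 * c * t * (pi / t) - 4 * t * (pi / (2 * t ^ 3)) = 4 * c * pi - 2 * pi / t\<^sup>2" if "t > 0" for t
      using that by (simp add: power2_eq_square power3_eq_cube)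
    ultimately have "has_bochner_integral lborel (\<lambda>x. Q (Complex x (l / 2)) - Q (Complex x (- (l / 2))))
      ((4 * c * pi - 2 * pi / sp\<^sup>2) + (4 * c * pi - 2 * pi / sm\<^sup>2))"
      unfolding t[OF s(1)] t[OF s(2)] by blast
    moreover have "(4 * c * pi - 2 * pi / sp\<^sup>2) + (4 * c * pi - 2 * pi / sm\<^sup>2) = I"
      unfolding I_def sp_def sm_def by simp
    ultimately show ?thesis by simp
  qed
  have "(\<integral>\<^sup>+z. ennreal (indicator S z * ((norm (h1 z))\<^sup>2 + (norm (h2 z))\<^sup>2)) \<partial>lborel) = ennreal I"
    by (rule green(1)[OF _ S_def cP cP1 cQ2 dP dQ _ decay flux]) (use l in auto)
  moreover have "0 \<le> I"
    by (rule green(2)[OF _ S_def cP cP1 cQ2 dP dQ _ decay flux]) (use l in auto)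
  ultimately show "(\<integral>\<^sup>+z. ennreal (indicator {z. \<bar>Im z\<bar> \<le> l / 2} z * ((norm (h1 z))\<^sup>2 + (norm (h2 z))\<^sup>2)) \<partial>lborel) = ennreal I"
    "0 \<le> I" by (simp_all add: S_def)
qed

end

section \<open>Minimality\<close>

context strip_problem
begin

lemma v_measurable [measurable]: "v1 \<in> borel_measurable borel" "v2 \<in> borel_measurable borel"
  using piecewise_differentiable.meas[OF piecewise] by auto

lemma v_measurable_lebesgue [measurable]: "v1 \<in> borel_measurable lebesgue" "v2 \<in> borel_measurable lebesgue"
  by (simp_all add: measurable_completion)

lemma AE_lborel_if_lebesgue: "AE z in lebesgue. R z \<Longrightarrow> AE z in lborel. R z"
  by (simp add: AE_completion_iff)

text \<open>The strip contributes the value from Green's formula and its complement the dipole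
  energy. Nonnegativity of the strip part is needed for adding the two numbers inside
  \<open>ennreal\<close>, where a negative one would be truncated to 0.\<close>

lemma energy_v: "(\<integral>\<^sup>+z. ennreal ((norm (v1 z))\<^sup>2 + (norm (v2 z))\<^sup>2) \<partial>lebesgue) = ennreal (8 * pi * c)"
proof -
  let ?D = "\<lambda>z. (norm (v1 z))\<^sup>2 + (norm (v2 z))\<^sup>2"
  let ?I = "8 * pi * c - 2 * pi / (l / 2 - y0)\<^sup>2 - 2 * pi / (l / 2 + y0)\<^sup>2"
  let ?E = "2 * pi / (l / 2 - y0)\<^sup>2 + 2 * pi / (l / 2 + y0)\<^sup>2"
  have off: "indicator (- strip l) z * ?D z = indicator (- strip l) z * (8 / ((Re z)\<^sup>2 + (Im z - y0)\<^sup>2)\<^sup>2)" for z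
  proof (cases "z \<in> strip l")
    case False
    have "norm (cnj z + p) = norm (z - p)"
      by (metis complex_cnj_diff complex_cnj_i complex_cnj_complex_of_real complex_cnj_mult complex_mod_cnj diff_minus_eq_add mult_minus_left)
    then have n: "(norm (cnj z + p))\<^sup>2 = (Re z)\<^sup>2 + (Im z - y0)\<^sup>2" by (simp add: cmod_power2)
    have "?D z = 4 / ((norm (cnj z + p))\<^sup>2)\<^sup>2 + 4 / ((norm (cnj z + p))\<^sup>2)\<^sup>2"
      using False by (simp add: v1_def v2_def K1_def K2_def norm_divide norm_power norm_mult power_divide)
    then show ?thesis unfolding n by simp
  qed simp
  have "(\<integral>\<^sup>+z. ennreal (?D z) \<partial>lebesgue) = (\<integral>\<^sup>+z. ennreal (?D z) \<partial>lborel)"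
    by (simp add: nn_integral_completion)
  also have "\<dots> = (\<integral>\<^sup>+z. ennreal (indicator (strip l) z * ?D z) + ennreal (indicator (- strip l) z * ?D z) \<partial>lborel)"
    by (intro nn_integral_cong) (simp add: indicator_def)
  also have "\<dots> = (\<integral>\<^sup>+z. ennreal (indicator (strip l) z * ?D z) \<partial>lborel) + (\<integral>\<^sup>+z. ennreal (indicator (- strip l) z * ?D z) \<partial>lborel)"
    by (intro nn_integral_add) auto
  also have "(\<integral>\<^sup>+z. ennreal (indicator (- strip l) z * ?D z) \<partial>lborel) = ennreal ?E"
    unfolding off using y0 by (rule dipole_energy_off_strip)
  also have "(\<integral>\<^sup>+z. ennreal (indicator (strip l) z * ?D z) \<partial>lborel) =
      (\<integral>\<^sup>+z. ennreal (indicator {z. \<bar>Im z\<bar> \<le> l / 2} z * ((norm (h1 z))\<^sup>2 + (norm (h2 z))\<^sup>2)) \<partial>lborel)"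
  proof (rule nn_integral_cong_AE)
    have "AE z in lborel. Im z \<noteq> l / 2" "AE z in lborel. Im z \<noteq> - l / 2"
      by (rule AE_lborel_if_lebesgue[OF AE_Im_neq])+
    then show "AE z in lborel. ennreal (indicator (strip l) z * ?D z) = ennreal (indicator {z. \<bar>Im z\<bar> \<le> l / 2} z * ((norm (h1 z))\<^sup>2 + (norm (h2 z))\<^sup>2))"
    proof eventually_elim
      case (elim z)
      then have "z \<in> strip l \<longleftrightarrow> \<bar>Im z\<bar> \<le> l / 2" by (auto simp: strip_def)
      then show ?case by (simp add: v1_def v2_def indicator_def)
    qed
  qed
  also have "\<dots> = ennreal ?I" by (rule strip_energy(1))
  also have "ennreal ?I + ennreal ?E = ennreal (8 * pi * c)"
    using strip_energy(2) by (subst ennreal_plus[symmetric]) (auto simp: algebra_simps)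
  finally show ?thesis .
qed

lemma integrable_if_sum_finite:
  fixes a b :: "complex \<Rightarrow> complex"
  assumes [measurable]: "a \<in> borel_measurable lebesgue" "b \<in> borel_measurable lebesgue"
    and fin: "(\<integral>\<^sup>+z. ennreal ((norm (a z))\<^sup>2 + (norm (b z))\<^sup>2) \<partial>lebesgue) < \<infinity>"
  shows "integrable lebesgue (\<lambda>z. (norm (a z))\<^sup>2)" "integrable lebesgue (\<lambda>z. (norm (b z))\<^sup>2)"
proof -
  have i: "integrable lebesgue (\<lambda>z. (norm (a z))\<^sup>2 + (norm (b z))\<^sup>2)"
    by (rule integrableI_nonneg) (use fin in auto)
  show "integrable lebesgue (\<lambda>z. (norm (a z))\<^sup>2)"
    by (rule Bochner_Integration.integrable_bound[OF i]) auto
  show "integrable lebesgue (\<lambda>z. (norm (b z))\<^sup>2)"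
    by (rule Bochner_Integration.integrable_bound[OF i]) auto
qed

lemma integrable_v: "integrable lebesgue (\<lambda>z. (norm (v1 z))\<^sup>2)" "integrable lebesgue (\<lambda>z. (norm (v2 z))\<^sup>2)"
  using integrable_if_sum_finite[OF v_measurable_lebesgue, unfolded energy_v] by (simp_all add: infinity_ennreal_def)

text \<open>The conjugate of \<open>h\<close>, so that \<open>h1\<close> and \<open>h2\<close> form the gradient of \<open>G\<close> rotated by a right angle.\<close>

definition G where "G z = - \<i> * (f z - g (cnj z))"

lemma G_has_derivative:
  assumes z: "z \<in> U"
  shows "(G has_derivative (\<lambda>t. Re t *\<^sub>R (- h2 z) + Im t *\<^sub>R h1 z)) (at z)"
proof -
  have "(f has_derivative (\<lambda>t. deriv f z * t)) (at z)"
    using holomorphic_derivI[OF holo_f open_U z] by (simp add: has_field_derivative_def)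
  from has_derivative_mult_right[OF has_derivative_diff[OF this antiholomorphic_has_derivative[OF holo_g open_U cnj_U[OF z]]]]
  have "(G has_derivative (\<lambda>t. - \<i> * (deriv f z * t - deriv g (cnj z) * cnj t))) (at z)"
    unfolding G_def[abs_def] .
  moreover have "- \<i> * (deriv f z * t - deriv g (cnj z) * cnj t) = Re t *\<^sub>R (- h2 z) + Im t *\<^sub>R h1 z" for t
    by (simp add: h1_def h2_def complex_eq_iff algebra_simps)
  ultimately show ?thesis by simp
qed

lemma h12_has_derivative:
  assumes z: "z \<in> U"
  shows "\<exists>D. (h1 has_derivative D) (at z) \<and> D 1 = h11 z" "\<exists>D. (h2 has_derivative D) (at z) \<and> D \<i> = - h11 z"
proof -
  have 1: "(deriv f has_derivative (\<lambda>t. deriv (deriv f) z * t)) (at z)"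
    using holomorphic_derivI[OF holo_deriv(1) open_U z] by (simp add: has_field_derivative_def)
  note 2 = antiholomorphic_has_derivative[OF holo_deriv(2) open_U cnj_U[OF z]]
  show "\<exists>D. (h1 has_derivative D) (at z) \<and> D 1 = h11 z"
    by (rule exI, rule conjI, unfold h1_def[abs_def], rule has_derivative_add[OF 1 2]) (simp add: h11_def)
  show "\<exists>D. (h2 has_derivative D) (at z) \<and> D \<i> = - h11 z"
    by (rule exI, rule conjI, unfold h2_def[abs_def], rule has_derivative_mult_right[OF has_derivative_diff[OF 1 2]])
      (simp add: h11_def algebra_simps)
qed

lemma smooth_on_G: "smooth_on U G"
proof -
  have e: "cnj ` U = U" using cnj_U by (metis (no_types, lifting) complex_cnj_cnj image_eqI image_subset_iff subsetI subset_antisym)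
  have "smooth_on U (\<lambda>z. - \<i> * f z + (\<lambda>w. \<i> * g w) (cnj z))"
    using holo_f holo_g by (intro smooth_on_add open_U smooth_on_holomorphic smooth_on_antiholomorphic) (auto simp: e intro!: holomorphic_intros)
  then show ?thesis by (simp add: G_def[abs_def] algebra_simps)
qed

text \<open>Far out, \<open>G\<close> is controlled by the bounds on tanh and coth; near the
  imaginary axis, where those bounds blow up, compactness of a rectangle takes over. Decay cannot be
  expected: \<open>G\<close> has nonzero limits at both ends of the strip.\<close>

lemma bounded_G: "\<exists>B. \<forall>z\<in>strip l. norm (G z) \<le> B"
proof -
  have cG: "continuous_on U G"
    by (rule continuous_at_imp_continuous_on)
      (use smooth_on_differentiable[OF smooth_on_G] differentiable_imp_continuous_within in blast)
  have "cbox (Complex (- 1) (- l / 2)) (Complex 1 (l / 2)) \<subseteq> U"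
    by (auto simp: in_cbox_complex_iff intro!: closed_strip_U)
  then have "compact (G ` cbox (Complex (- 1) (- l / 2)) (Complex 1 (l / 2)))"
    by (intro compact_continuous_image continuous_on_subset[OF cG]) auto
  from compact_imp_bounded[OF this] obtain A where "\<forall>w\<in>G ` cbox (Complex (- 1) (- l / 2)) (Complex 1 (l / 2)). norm w \<le> A"
    unfolding bounded_iff by (rule exE)
  then have A: "norm (G z) \<le> A" if "z \<in> cbox (Complex (- 1) (- l / 2)) (Complex 1 (l / 2))" for z
    using that by simp
  show ?thesis
  proof (intro exI ballI)
    fix z assume z: "z \<in> strip l"
    show "norm (G z) \<le> max A (4 * k + 6)"
    proof (cases "\<bar>Re z\<bar> \<le> 1")
      case True
      then have "norm (G z) \<le> A" using strip_abs[OF z] by (intro A) (auto simp: in_cbox_complex_iff abs_le_iff)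
      then show ?thesis by simp
    next
      case False
      then have nz: "Re z \<noteq> 0" "2 / \<bar>Re z\<bar> \<le> 2" "4 / \<bar>Re z\<bar> \<le> 4" by (auto simp: divide_le_eq)
      have "norm (G z) \<le> norm (f z) + norm (g (cnj z))"
        unfolding G_def norm_mult using norm_triangle_ineq4[of "f z" "g (cnj z)"] by simp
      also have "\<dots> \<le> 4 * k + 6"
        using norm_f_le[OF strip_U[OF z] nz(1)] norm_g_le[OF cnj_U[OF strip_U[OF z]]] nz by simp
      finally show ?thesis by simp
    qed
  qed
qed

text \<open>\<open>L\<close> stands for the real or the imaginary part: test functions are real, so
  \<open>G\<close> enters through its real components. The partial derivatives of
  \<open>L (G z)\<close> are -L(h2) and L(h1), so on the strip the curl integrand is L(v1) w1 +
  L(v2) w2.\<close>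

lemma orthogonal_component:
  fixes L :: "complex \<Rightarrow> real" and w w1 w2 :: "complex \<Rightarrow> complex"
  assumes L: "bounded_linear L" "\<And>z. \<bar>L z\<bar> \<le> norm z"
    and w: "is_weak_partial 1 w w1" "is_weak_partial \<i> w w2" "L2_loc w1" "L2_loc w2"
    and wi: "integrable lebesgue (\<lambda>z. (norm (w1 z))\<^sup>2)" "integrable lebesgue (\<lambda>z. (norm (w2 z))\<^sup>2)"
    and off: "AE z in lebesgue. z \<notin> strip l \<longrightarrow> w1 z = 0" "AE z in lebesgue. z \<notin> strip l \<longrightarrow> w2 z = 0"
  shows "(\<integral>z. L (v1 z) *\<^sub>R w1 z + L (v2 z) *\<^sub>R w2 z \<partial>lebesgue) = 0"
proof -
  interpret L: bounded_linear L by fact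
  let ?\<gamma> = "\<lambda>z. L (G z)"
  have D\<gamma>: "partial_deriv 1 ?\<gamma> z = - L (h2 z)" "partial_deriv \<i> ?\<gamma> z = L (h1 z)" if "z \<in> U" for z
    using partial_deriv_eqI[OF L.has_derivative[OF G_has_derivative[OF that]]] by (simp_all add: L.neg)
  have UU: "U = {z. \<bar>Im z\<bar> < d}" by (simp add: U_def)
  have sm: "smooth_on U ?\<gamma>" by (rule smooth_on_linear_comp[OF open_U smooth_on_G L(1)])
  have ms: "mixed_symmetric U ?\<gamma>"
    unfolding mixed_symmetric_def
  proof
    fix z assume z: "z \<in> U"
    obtain D1 where D1: "(h1 has_derivative D1) (at z)" "D1 1 = h11 z" using h12_has_derivative(1)[OF z] by blast
    obtain D2 where D2: "(h2 has_derivative D2) (at z)" "D2 \<i> = - h11 z" using h12_has_derivative(2)[OF z] by blast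
    note E1 = L.has_derivative[OF D1(1)] and E2 = has_derivative_minus[OF L.has_derivative[OF D2(1)]]
    have "partial_deriv 1 (\<lambda>z. L (h1 z)) z = partial_deriv 1 (partial_deriv \<i> ?\<gamma>) z"
      by (rule partial_deriv_cong_open[OF open_U z]) (use E1 D\<gamma> in \<open>auto simp: differentiable_def\<close>)
    moreover have "partial_deriv \<i> (\<lambda>z. - L (h2 z)) z = partial_deriv \<i> (partial_deriv 1 ?\<gamma>) z"
      by (rule partial_deriv_cong_open[OF open_U z]) (use E2 D\<gamma> in \<open>auto simp: differentiable_def\<close>)
    ultimately show "partial_deriv 1 (partial_deriv \<i> ?\<gamma>) z = partial_deriv \<i> (partial_deriv 1 ?\<gamma>) z"
      using partial_deriv_eqI[OF E1, of 1] partial_deriv_eqI[OF E2, of \<i>] D1(2) D2(2) by (simp add: L.neg)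
  qed
  obtain B where B: "\<And>z. z \<in> strip l \<Longrightarrow> norm (G z) \<le> B" using bounded_G by blast
  have L_meas [measurable]: "L \<in> borel_measurable borel"
    by (intro borel_measurable_continuous_onI L.continuous_on continuous_on_id)
  have iv: "integrable lebesgue (\<lambda>z. (indicator (strip l) z * L (a z))\<^sup>2)"
    if a: "a \<in> borel_measurable borel" "integrable lebesgue (\<lambda>z. (norm (a z))\<^sup>2)" for a
  proof (rule Bochner_Integration.integrable_bound[OF a(2)])
    have "(\<lambda>z. (indicator (strip l) z * L (a z))\<^sup>2) \<in> borel_measurable borel" using a(1) by measurable
    then show "(\<lambda>z. (indicator (strip l) z * L (a z))\<^sup>2) \<in> borel_measurable lebesgue" by (simp add: measurable_completion)
    have "(L x)\<^sup>2 \<le> (norm x)\<^sup>2" for x using power_mono[OF L(2)[of x], of 2] by simp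
    then show "AE z in lebesgue. norm ((indicator (strip l) z * L (a z))\<^sup>2) \<le> norm ((norm (a z))\<^sup>2)"
      by (intro AE_I2) (auto simp: indicator_def)
  qed
  have \<gamma>i: "integrable lebesgue (\<lambda>z. (indicator (strip l) z * partial_deriv e ?\<gamma> z)\<^sup>2)" if "e \<in> Basis" for e
  proof -
    have "e = 1 \<or> e = \<i>" using that by (auto simp: Basis_complex_def)
    moreover have "(\<lambda>z. (indicator (strip l) z * partial_deriv 1 ?\<gamma> z)\<^sup>2) = (\<lambda>z. (indicator (strip l) z * L (v2 z))\<^sup>2)"
      using D\<gamma>(1) strip_U by (auto simp: fun_eq_iff v2_def indicator_def)
    moreover have "(\<lambda>z. (indicator (strip l) z * partial_deriv \<i> ?\<gamma> z)\<^sup>2) = (\<lambda>z. (indicator (strip l) z * L (v1 z))\<^sup>2)"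
      using D\<gamma>(2) strip_U by (auto simp: fun_eq_iff v1_def indicator_def)
    ultimately show ?thesis using iv[OF v_measurable(1) integrable_v(1)] iv[OF v_measurable(2) integrable_v(2)] by auto
  qed
  let ?X = "\<lambda>z. indicator (strip l) z *\<^sub>R (partial_deriv \<i> ?\<gamma> z *\<^sub>R w1 z - partial_deriv 1 ?\<gamma> z *\<^sub>R w2 z)" and ?Y = "\<lambda>z. L (v1 z) *\<^sub>R w1 z + L (v2 z) *\<^sub>R w2 z"
  have "(\<integral>z. ?X z \<partial>lebesgue) = 0"
    by (rule gradient_orthogonal_rotated_gradient[OF l d w wi off sm[unfolded UU] ms[unfolded UU] _ \<gamma>i, of B])
      (use B L(2) in \<open>auto intro: order_trans\<close>)
  moreover have "(\<integral>z. ?Y z \<partial>lebesgue) =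
    (\<integral>z. ?X z \<partial>lebesgue)"
  proof (rule integral_cong_AE)
    have m: "w1 \<in> borel_measurable lebesgue" "w2 \<in> borel_measurable lebesgue" using w by (auto simp: L2_loc_def)
    have Lv: "(\<lambda>z. L (v1 z)) \<in> borel_measurable lebesgue" "(\<lambda>z. L (v2 z)) \<in> borel_measurable lebesgue"
      by (auto intro!: measurable_completion)
    have e: "?X z = indicator (strip l) z *\<^sub>R (?Y z)" for z
      using D\<gamma>[OF strip_U, of z] by (cases "z \<in> strip l") (simp_all add: v1_def v2_def)
    show "(\<lambda>z. ?Y z) \<in> borel_measurable lebesgue"
      by (intro borel_measurable_add borel_measurable_scaleR m Lv)
    then show "(\<lambda>z. ?X z) \<in> borel_measurable lebesgue"
      unfolding e by (intro borel_measurable_scaleR borel_measurable_indicator strip_sets_lebesgue)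
    show "AE z in lebesgue. ?Y z = ?X z"
      unfolding e using off by eventually_elim (auto simp: indicator_def)
  qed
  ultimately show ?thesis by simp
qed

text \<open>The inner product of complex numbers is the sum of the products of real parts and of
  imaginary parts, so the pairing is the real part of the component identity for \<open>Re\<close>
  plus the imaginary part of the one for \<open>Im\<close>.\<close>

lemma orthogonal:
  fixes w w1 w2 :: "complex \<Rightarrow> complex"
  assumes w: "is_weak_partial 1 w w1" "is_weak_partial \<i> w w2" "L2_loc w1" "L2_loc w2"
    and wi: "integrable lebesgue (\<lambda>z. (norm (w1 z))\<^sup>2)" "integrable lebesgue (\<lambda>z. (norm (w2 z))\<^sup>2)"
    and off: "AE z in lebesgue. z \<notin> strip l \<longrightarrow> w1 z = 0" "AE z in lebesgue. z \<notin> strip l \<longrightarrow> w2 z = 0"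
  shows "integrable lebesgue (\<lambda>z. v1 z \<bullet> w1 z + v2 z \<bullet> w2 z)"
    and "(\<integral>z. v1 z \<bullet> w1 z + v2 z \<bullet> w2 z \<partial>lebesgue) = 0"
proof -
  have m: "w1 \<in> borel_measurable lebesgue" "w2 \<in> borel_measurable lebesgue" using w by (auto simp: L2_loc_def)
  have int: "integrable lebesgue (\<lambda>z. L (v1 z) *\<^sub>R w1 z + L (v2 z) *\<^sub>R w2 z)"
    if L: "bounded_linear L" "\<And>z. \<bar>L z\<bar> \<le> norm z" for L :: "complex \<Rightarrow> real"
  proof -
    have [measurable]: "L \<in> borel_measurable borel"
      by (rule borel_measurable_continuous_onI[OF bounded_linear.continuous_on[OF L(1) continuous_on_id]])
    have Lv: "(\<lambda>z. L (v1 z)) \<in> borel_measurable lebesgue" "(\<lambda>z. L (v2 z)) \<in> borel_measurable lebesgue"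
      by (auto intro!: measurable_completion)
    have sq: "(L x)\<^sup>2 \<le> (norm x)\<^sup>2" for x using power_mono[OF L(2)[of x], of 2] by simp
    have "integrable lebesgue (\<lambda>z. (L (v1 z))\<^sup>2)"
      by (rule Bochner_Integration.integrable_bound[OF integrable_v(1)]) (use Lv sq in auto)
    moreover have "integrable lebesgue (\<lambda>z. (L (v2 z))\<^sup>2)"
      by (rule Bochner_Integration.integrable_bound[OF integrable_v(2)]) (use Lv sq in auto)
    ultimately show ?thesis using Lv m wi by (intro Bochner_Integration.integrable_add integrable_scaleR_square)
  qed
  note ReL = bounded_linear_Re abs_Re_le_cmod and ImL = bounded_linear_Im abs_Im_le_cmod
  have e: "v1 z \<bullet> w1 z + v2 z \<bullet> w2 z = Re (Re (v1 z) *\<^sub>R w1 z + Re (v2 z) *\<^sub>R w2 z) + Im (Im (v1 z) *\<^sub>R w1 z + Im (v2 z) *\<^sub>R w2 z)" for z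
    by (simp add: inner_complex_def)
  show "integrable lebesgue (\<lambda>z. v1 z \<bullet> w1 z + v2 z \<bullet> w2 z)"
    unfolding e by (intro Bochner_Integration.integrable_add integrable_Re integrable_Im int ReL ImL)
  have "(\<integral>z. v1 z \<bullet> w1 z + v2 z \<bullet> w2 z \<partial>lebesgue) =
    Re (\<integral>z. Re (v1 z) *\<^sub>R w1 z + Re (v2 z) *\<^sub>R w2 z \<partial>lebesgue) + Im (\<integral>z. Im (v1 z) *\<^sub>R w1 z + Im (v2 z) *\<^sub>R w2 z \<partial>lebesgue)"
    unfolding e
    by (subst Bochner_Integration.integral_add; (intro integrable_Re integrable_Im int ReL ImL)?)
      (simp only: integral_Re[OF int[OF ReL]] integral_Im[OF int[OF ImL]])
  also have "\<dots> = 0"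
    unfolding orthogonal_component[OF ReL w wi off] orthogonal_component[OF ImL w wi off] by simp
  finally show "(\<integral>z. v1 z \<bullet> w1 z + v2 z \<bullet> w2 z \<partial>lebesgue) = 0" .
qed

lemma energy_u_opt: "dirichlet_energy (u_opt l y0) = ennreal (8 * pi * c)"
  unfolding energy_v[symmetric]
  by (intro dirichlet_energy_eq piecewise_differentiable.H1_loc[OF piecewise] piecewise_differentiable.L2[OF piecewise]
      piecewise_differentiable.weak_partial_1[OF piecewise] piecewise_differentiable.weak_partial_i[OF piecewise])

text \<open>Pythagoras: \<open>J\<close> is the energy of the difference of the two maps, and the
  cross term vanishes by orthogonality. Finite energy of \<open>v\<close> is what makes the gradient
  of the difference square integrable. Keeping \<open>J\<close> explicit serves both the lower bound
  and uniqueness.\<close>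

lemma energy_gap:
  assumes v: "v \<in> admissible l y0" and fin: "dirichlet_energy v < \<infinity>"
  obtains J where "J \<ge> 0" "dirichlet_energy v = ennreal (8 * pi * c + J)"
    "J = 0 \<Longrightarrow> AE z in lebesgue. v z = u_opt l y0 z"
proof -
  have vH: "v \<in> H1_loc" using v by (simp add: admissible_def)
  define a1 where "a1 = weak_partial 1 v"
  define a2 where "a2 = weak_partial \<i> v"
  have a: "L2_loc a1" "L2_loc a2" "is_weak_partial 1 v a1" "is_weak_partial \<i> v a2"
    using weak_partial_H1_loc[OF vH] by (auto simp: a1_def a2_def Basis_complex_def)
  have vL: "L2_loc v" using vH by (simp add: H1_loc_def)
  note u = piecewise_differentiable.L2[OF piecewise] piecewise_differentiable.weak_partial_1[OF piecewise] piecewise_differentiable.weak_partial_i[OF piecewise]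
  define w where "w z = v z - u_opt l y0 z" for z
  define w1 where "w1 z = a1 z - v1 z" for z
  define w2 where "w2 z = a2 z - v2 z" for z
  have wL: "L2_loc w" "L2_loc w1" "L2_loc w2"
    unfolding w_def[abs_def] w1_def[abs_def] w2_def[abs_def] by (intro L2_loc_diff vL a u)+
  have ww: "is_weak_partial 1 w w1" "is_weak_partial \<i> w w2"
    unfolding w_def[abs_def] w1_def[abs_def] w2_def[abs_def] by (intro is_weak_partial_diff vL a u; simp)+
  have woff: "AE z in lebesgue. z \<notin> strip l \<longrightarrow> w z = 0"
  proof -
    have "AE z in lebesgue. z \<notin> strip l \<longrightarrow> v z = 2 / (cnj z + p)" "AE z in lebesgue. z \<notin> strip l \<longrightarrow> u_opt l y0 z = 2 / (cnj z + p)"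
      using v u_opt_admissible by (auto simp: admissible_def)
    then show ?thesis by eventually_elim (simp add: w_def)
  qed
  have off: "AE z in lebesgue. z \<notin> strip l \<longrightarrow> w1 z = 0" "AE z in lebesgue. z \<notin> strip l \<longrightarrow> w2 z = 0"
    by (rule weak_partial_eq_0_off_strip[OF wL(2) ww(1) _ woff], simp)
       (rule weak_partial_eq_0_off_strip[OF wL(3) ww(2) _ woff], simp)
  have Ev: "dirichlet_energy v = (\<integral>\<^sup>+z. ennreal ((norm (a1 z))\<^sup>2 + (norm (a2 z))\<^sup>2) \<partial>lebesgue)"
    by (rule dirichlet_energy_eq[OF vH a(1,3,2,4)])
  have m: "a1 \<in> borel_measurable lebesgue" "a2 \<in> borel_measurable lebesgue" "w1 \<in> borel_measurable lebesgue" "w2 \<in> borel_measurable lebesgue"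
    using a wL by (auto simp: L2_loc_def)
  have ai: "integrable lebesgue (\<lambda>z. (norm (a1 z))\<^sup>2)" "integrable lebesgue (\<lambda>z. (norm (a2 z))\<^sup>2)"
    using integrable_if_sum_finite[OF m(1,2)] fin Ev by auto
  have sq_diff: "integrable lebesgue (\<lambda>z. (norm (a z - b z))\<^sup>2)"
    if "integrable lebesgue (\<lambda>z. (norm (a z))\<^sup>2)" "integrable lebesgue (\<lambda>z. (norm (b z))\<^sup>2)" "(\<lambda>z. a z - b z) \<in> borel_measurable lebesgue"
    for a b :: "complex \<Rightarrow> complex"
  proof (rule Bochner_Integration.integrable_bound)
    show "integrable lebesgue (\<lambda>z. 2 * (norm (a z))\<^sup>2 + 2 * (norm (b z))\<^sup>2)" using that by auto
    show "(\<lambda>z. (norm (a z - b z))\<^sup>2) \<in> borel_measurable lebesgue" using that(3) by measurable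
    show "AE z in lebesgue. norm ((norm (a z - b z))\<^sup>2) \<le> norm (2 * (norm (a z))\<^sup>2 + 2 * (norm (b z))\<^sup>2)"
      using norm_add_squared_le[of "a _" "- b _"] by (intro AE_I2) simp
  qed
  have wi: "integrable lebesgue (\<lambda>z. (norm (w1 z))\<^sup>2)" "integrable lebesgue (\<lambda>z. (norm (w2 z))\<^sup>2)"
    using sq_diff[OF ai(1) integrable_v(1)] sq_diff[OF ai(2) integrable_v(2)] m(3,4) by (auto simp: w1_def[abs_def] w2_def[abs_def])
  note orth = orthogonal[OF ww wL(2,3) wi off]
  define J where "J = (\<integral>z. (norm (w1 z))\<^sup>2 + (norm (w2 z))\<^sup>2 \<partial>lebesgue)"
  have J0: "J \<ge> 0" unfolding J_def by (intro integral_nonneg_AE AE_I2) simp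
  have c0: "0 \<le> 8 * pi * c" by (simp add: c_def)
  have vI: "(\<integral>z. (norm (v1 z))\<^sup>2 + (norm (v2 z))\<^sup>2 \<partial>lebesgue) = 8 * pi * c"
  proof -
    have "ennreal (\<integral>z. (norm (v1 z))\<^sup>2 + (norm (v2 z))\<^sup>2 \<partial>lebesgue) = ennreal (8 * pi * c)"
      unfolding energy_v[symmetric] using integrable_v by (intro nn_integral_eq_integral[symmetric]) auto
    then show ?thesis using c0 by (subst (asm) ennreal_inj) (auto intro!: integral_nonneg_AE AE_I2)
  qed
  have "(norm (a1 z))\<^sup>2 + (norm (a2 z))\<^sup>2 = ((norm (v1 z))\<^sup>2 + (norm (v2 z))\<^sup>2) + 2 * (v1 z \<bullet> w1 z + v2 z \<bullet> w2 z) + ((norm (w1 z))\<^sup>2 + (norm (w2 z))\<^sup>2)" for z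
    unfolding w1_def w2_def power2_norm_eq_inner by (simp add: algebra_simps inner_commute)
  then have "(\<integral>z. (norm (a1 z))\<^sup>2 + (norm (a2 z))\<^sup>2 \<partial>lebesgue) =
    (\<integral>z. ((norm (v1 z))\<^sup>2 + (norm (v2 z))\<^sup>2) + 2 * (v1 z \<bullet> w1 z + v2 z \<bullet> w2 z) + ((norm (w1 z))\<^sup>2 + (norm (w2 z))\<^sup>2) \<partial>lebesgue)"
    by simp
  also have "\<dots> = (\<integral>z. (norm (v1 z))\<^sup>2 + (norm (v2 z))\<^sup>2 \<partial>lebesgue) + 2 * (\<integral>z. v1 z \<bullet> w1 z + v2 z \<bullet> w2 z \<partial>lebesgue) + J"
    unfolding J_def
    using Bochner_Integration.integrable_add[OF integrable_v] Bochner_Integration.integrable_add[OF wi] integrable_mult_right[OF orth(1), of 2]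
    by (simp only: Bochner_Integration.integral_add Bochner_Integration.integrable_add integral_mult_right_zero)
  finally have "(\<integral>z. (norm (a1 z))\<^sup>2 + (norm (a2 z))\<^sup>2 \<partial>lebesgue) = 8 * pi * c + J"
    unfolding vI orth(2) by simp
  then have "dirichlet_energy v = ennreal (8 * pi * c + J)"
    unfolding Ev using ai by (subst nn_integral_eq_integral) auto
  moreover have "AE z in lebesgue. v z = u_opt l y0 z" if "J = 0"
  proof -
    have "AE z in lebesgue. (norm (w1 z))\<^sup>2 + (norm (w2 z))\<^sup>2 = 0"
      using that wi unfolding J_def by (subst (asm) integral_nonneg_eq_0_iff_AE) auto
    \<comment> \<open>The vertical derivative alone suffices, because every vertical line leaves the
      strip.\<close>
    then have "AE z in lebesgue. w2 z = 0"
      by eventually_elim (simp add: add_nonneg_eq_0_iff)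
    from eq_0_if_vertical_derivative_0[OF l wL(1) ww(2) this woff]
    show ?thesis by eventually_elim (simp add: w_def)
  qed
  ultimately show ?thesis using that J0 by blast
qed

lemma T_eq: "T l y0 = ennreal (8 * pi * c)"
  unfolding T_def
proof (rule antisym)
  show "(INF u\<in>admissible l y0. dirichlet_energy u) \<le> ennreal (8 * pi * c)"
    using INF_lower[OF u_opt_admissible, of dirichlet_energy] energy_u_opt by simp
  show "ennreal (8 * pi * c) \<le> (INF u\<in>admissible l y0. dirichlet_energy u)"
  proof (rule INF_greatest)
    fix v assume v: "v \<in> admissible l y0"
    show "ennreal (8 * pi * c) \<le> dirichlet_energy v"
    proof (cases "dirichlet_energy v < \<infinity>")
      case True
      from energy_gap[OF v True] obtain J where J: "J \<ge> 0" "dirichlet_energy v = ennreal (8 * pi * c + J)" by metis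
      show ?thesis unfolding J(2) by (rule ennreal_leI) (use J(1) in linarith)
    qed (simp add: not_less top_unique)
  qed
qed

lemma minimizer_unique:
  assumes v: "v \<in> admissible l y0" and e: "dirichlet_energy v = T l y0"
  shows "AE z in lebesgue. v z = u_opt l y0 z"
proof -
  have "dirichlet_energy v < \<infinity>" using e T_eq by simp
  from energy_gap[OF v this] obtain J where J: "J \<ge> 0" "dirichlet_energy v = ennreal (8 * pi * c + J)"
    "J = 0 \<Longrightarrow> AE z in lebesgue. v z = u_opt l y0 z" by metis
  have "0 \<le> 8 * pi * c" by (simp add: c_def)
  then have "8 * pi * c + J = 8 * pi * c" using J(1,2) e T_eq by (simp add: ennreal_inj)
  then show ?thesis using J(3) by simp
qed

lemma T_value: "T l y0 = ennreal (4 * pi ^ 3 / (l\<^sup>2 * (cos (pi * y0 / l))\<^sup>2))"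
  unfolding T_eq c_def k_def
  by (rule arg_cong[where f = ennreal]) (simp add: field_simps power2_eq_square power3_eq_cube)

end

section \<open>Minimisation over the height and over the radius\<close>

lemma is_arg_min_iff_strict:
  fixes f :: "'a \<Rightarrow> 'b::order"
  assumes "P a" "\<And>x. P x \<Longrightarrow> x \<noteq> a \<Longrightarrow> f a < f x"
  shows "is_arg_min f P x \<longleftrightarrow> x = a"
  unfolding is_arg_min_def using assms by (metis less_asym)

theorem proposition2p11:
  fixes l y0 :: real
  assumes "l > 0" and "y0 \<in> {-l/2<..<l/2}"
  shows
    "isCont (u_opt l y0) (\<i> * of_real y0)
     \<and> u_opt l y0 \<in> admissible l y0
     \<and> dirichlet_energy (u_opt l y0) = T l y0
     \<and> (\<forall>v \<in> admissible l y0. dirichlet_energy v = T l y0 \<longrightarrow>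
          (AE z in lebesgue. v z = u_opt l y0 z))
     \<and> T l y0 = ennreal (4 * pi ^ 3 / (l\<^sup>2 * (cos (pi * y0 / l))\<^sup>2))
     \<and> (\<forall>y. is_arg_min (T l) (\<lambda>y. y \<in> {-l/2<..<l/2}) y \<longleftrightarrow> y = 0)
     \<and> T l 0 = ennreal (4 * pi ^ 3 / l\<^sup>2)
     \<and> (\<forall>r. is_arg_min (\<lambda>r. E0 l (mat 1) r 0) (\<lambda>r. r > 0) r \<longleftrightarrow> r = l\<^sup>2 / pi\<^sup>2)
     \<and> 4 * pi / enn2real (T l 0) = l\<^sup>2 / pi\<^sup>2
     \<and> E0 l (mat 1) (l\<^sup>2 / pi\<^sup>2) 0 = - (4 * l\<^sup>2 / pi)"
proof -
  have sp: "strip_problem l y" if "y \<in> {-l/2<..<l/2}" for y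
    using assms(1) that by unfold_locales (auto simp: abs_less_iff)
  interpret strip_problem l y0 by (rule sp[OF assms(2)])
  have T0: "T l 0 = ennreal (4 * pi ^ 3 / l\<^sup>2)"
    using strip_problem.T_value[OF sp[of 0]] assms(1) by simp
  have e0: "enn2real (T l 0) = 4 * pi ^ 3 / l\<^sup>2" unfolding T0 by simp
  have T_gt: "T l 0 < T l y" if y: "y \<in> {-l/2<..<l/2}" "y \<noteq> 0" for y
  proof -
    have "\<bar>pi * y / l\<bar> < pi / 2"
    proof -
      have "pi / l * \<bar>y\<bar> < pi / l * (l / 2)" using y assms(1) by (intro mult_strict_left_mono) auto
      then show ?thesis using assms(1) by (simp add: abs_mult)
    qed
    then have "cos \<bar>pi * y / l\<bar> < cos 0"
    proof (intro cos_monotone_0_pi)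
      show "\<bar>pi * y / l\<bar> \<le> pi" using \<open>\<bar>pi * y / l\<bar> < pi / 2\<close> pi_gt_zero by linarith
    qed (use y assms(1) in auto)
    then have "cos (pi * y / l) < 1" unfolding cos_abs_real cos_zero .
    moreover have "cos (pi * y / l) > 0" by (rule strip_problem.cos_pos[OF sp[OF y(1)]])
    ultimately have "(cos (pi * y / l))\<^sup>2 < 1" "0 < (cos (pi * y / l))\<^sup>2" by (auto simp: abs_square_less_1)
    then have "4 * pi ^ 3 / l\<^sup>2 < 4 * pi ^ 3 / (l\<^sup>2 * (cos (pi * y / l))\<^sup>2)"
      using assms(1) by (intro divide_strict_left_mono) auto
    moreover have "0 \<le> 4 * pi ^ 3 / l\<^sup>2" by simp
    ultimately show ?thesis unfolding T0 strip_problem.T_value[OF sp[OF y(1)]]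
      by (intro ennreal_lessI) linarith+
  qed
  have arg_T: "is_arg_min (T l) (\<lambda>y. y \<in> {-l/2<..<l/2}) y \<longleftrightarrow> y = 0" for y
    by (rule is_arg_min_iff_strict) (use assms(1) T_gt in auto)
  \<comment> \<open>Completing the square in T r^2 - 8 pi r with T = 4 pi^3 / l^2: the vertex is 4
    pi / T = l^2 / pi^2, and the minimum is -16 pi^2 / T = -4 l^2 / pi.\<close>
  have E: "E0 l (mat 1) r 0 = 4 * pi ^ 3 / l\<^sup>2 * (r - l\<^sup>2 / pi\<^sup>2)\<^sup>2 - 4 * l\<^sup>2 / pi" for r
    unfolding E0_def e0 skyrmion_integral using assms(1)
    by (simp add: field_simps power2_eq_square power3_eq_cube)
  have r0: "l\<^sup>2 / pi\<^sup>2 > 0" using assms(1) by simp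
  have E_gt: "E0 l (mat 1) (l\<^sup>2 / pi\<^sup>2) 0 < E0 l (mat 1) r 0" if "r \<noteq> l\<^sup>2 / pi\<^sup>2" for r
    unfolding E using that assms(1) by simp
  have arg_E: "is_arg_min (\<lambda>r. E0 l (mat 1) r 0) (\<lambda>r. r > 0) r \<longleftrightarrow> r = l\<^sup>2 / pi\<^sup>2" for r
    by (rule is_arg_min_iff_strict) (use r0 E_gt in auto)
  have "4 * pi / enn2real (T l 0) = l\<^sup>2 / pi\<^sup>2"
    unfolding e0 using assms(1) by (simp add: field_simps power2_eq_square power3_eq_cube)
  moreover have "E0 l (mat 1) (l\<^sup>2 / pi\<^sup>2) 0 = - (4 * l\<^sup>2 / pi)" unfolding E by simp
  ultimately show ?thesis
    using isCont_u_opt u_opt_admissible energy_u_opt T_eq minimizer_unique T_value arg_T T0 arg_E by auto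
qed

end
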